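(* There exist a smooth surface $M$, a $C^2$-diffeomorphism $f:M\to M$ and a basic set $\Lambda\subset M$ of $f$ such that $f|_\Lambda$ is topologically conjugate to the (two-sided) full shift with $3$ symbols, with the following properties: (i) The set $\mathcal{R}_L(f)\subset\mathbb{R}^2$ has non-empty interior and countably (infinitely) many extreme points, of which all but one are isolated (in the set of extreme points of $\mathcal{R}_L(f)$); (ii) The entropy spectrum $w\mapsto \mathcal{H}_f(w)$, as a function $\mathcal{R}_L(f)\to\mathbb{R}$, is discontinuous at the non-isolated extreme point.
   Context: Let $f:M\to M$ be a $C^{1+\epsilon}$ diffeomorphism on a smooth surface $M$ (with a Riemannian metric). A basic set $\Lambda\subset M$ of $f$ is a compact locally maximal hyperbolic set of $f$ such that $f|_\Lambda$ is topologically mixing. Let $T_\Lambda M=E^u\oplus E^s$ be the hyperbolic splitting over $\Lambda$ (with one-dimensional stable bundle $E^s$ and one-dimensional unstable bundle $E^u$), and put $\phi^{s}=\log\|Df|_{E^{s}}\|$ and $\phi^{u}=\log\|Df|_{E^{u}}\|$, which are continuous functions on $\Lambda$. Let $\mathcal{M}$ denote the set of $f$-invariant Borel probability measures on $\Lambda$. For $\mu\in\mathcal{M}$ let $$\mathrm{rv}(\mu)=\Big(-\int\phi^s\,d\mu,\ \int\phi^u\,d\mu\Big)\in\mathbb{R}^2,$$ and define $\mathcal{R}_L(f)=\{\mathrm{rv}(\mu):\mu\in\mathcal{M}\}$, a compact convex subset of $\mathbb{R}^2$. The entropy spectrum is defined for $w\in\mathcal{R}_L(f)$ by $$\mathcal{H}_f(w)=\sup\{h_\mu(f):\mu\in\mathcal{M},\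 \mathrm{rv}(\mu)=w\},$$ where $h_\mu(f)$ is the measure-theoretic entropy of $\mu$ with respect to $f|_\Lambda$. The full shift with $3$ symbols is the left shift map $\sigma$, $\sigma(\xi)_k=\xi_{k+1}$, on $\Sigma_3^\pm=\{0,1,2\}^{\mathbb{Z}}$ with the product topology. *)

theory Defs
  imports "HOL-Probability.Probability"
begin

section \<open>Maps of class \<open>C\<^sup>k\<close>\<close>

text \<open>Only used on open sets \<open>S\<close>.\<close>

primrec Ck_on :: "nat \<Rightarrow> ('a::euclidean_space \<Rightarrow> 'b::real_normed_vector) \<Rightarrow> 'a set \<Rightarrow> bool" where
  "Ck_on 0 f S \<longleftrightarrow> continuous_on S f"
| "Ck_on (Suc k) f S \<longleftrightarrow>
     (\<forall>x\<in>S. f differentiable at x) \<and> (\<forall>v. Ck_on k (\<lambda>x. frechet_derivative f (at x) v) S)"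


section \<open>Smooth surfaces\<close>

type_synonym plane = "real \<times> real"

text \<open>A chart is a pair of a domain and a coordinate map, whose values outside the domain
  are irrelevant.\<close>

type_synonym 'a chart = "'a set \<times> ('a \<Rightarrow> plane)"

definition is_chart :: "'a topology \<Rightarrow> 'a chart \<Rightarrow> bool" where
  "is_chart M c \<longleftrightarrow> openin M (fst c) \<and> open (snd c ` fst c) \<and>
     homeomorphic_map (subtopology M (fst c)) (top_of_set (snd c ` fst c)) (snd c)"

definition in_charts :: "'a chart \<Rightarrow> 'a chart \<Rightarrow> ('a \<Rightarrow> 'a) \<Rightarrow> plane \<Rightarrow> plane" where
  "in_charts c d F = snd d \<circ> F \<circ> inv_into (fst c) (snd c)"

definition in_charts_dom :: "'a chart \<Rightarrow> 'a chart \<Rightarrow> ('a \<Rightarrow> 'a) \<Rightarrow> plane set" where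
  "in_charts_dom c d F = snd c ` (fst c \<inter> F -` fst d)"

definition smooth_surface :: "'a topology \<Rightarrow> 'a chart set \<Rightarrow> bool" where
  "smooth_surface M A \<longleftrightarrow>
     Hausdorff_space M \<and> second_countable M \<and>
     (\<forall>c\<in>A. is_chart M c) \<and> (\<Union>c\<in>A. fst c) = topspace M \<and>
     (\<forall>c\<in>A. \<forall>d\<in>A. \<forall>k. Ck_on k (in_charts c d id) (in_charts_dom c d id))"

definition Ck_map :: "'a topology \<Rightarrow> 'a chart set \<Rightarrow> nat \<Rightarrow> ('a \<Rightarrow> 'a) \<Rightarrow> bool" where
  "Ck_map M A k F \<longleftrightarrow> continuous_map M M F \<and>
     (\<forall>c\<in>A. \<forall>d\<in>A. Ck_on k (in_charts c d F) (in_charts_dom c d F))"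

definition Ck_diffeo :: "'a topology \<Rightarrow> 'a chart set \<Rightarrow> nat \<Rightarrow> ('a \<Rightarrow> 'a) \<Rightarrow> bool" where
  "Ck_diffeo M A k F \<longleftrightarrow> bij_betw F (topspace M) (topspace M) \<and>
     Ck_map M A k F \<and> Ck_map M A k (inv_into (topspace M) F)"

text \<open>The tangent space at \<open>p\<close> is the plane, read through a chart chosen once and for all at
  each point. Nothing below depends on this choice: another one conjugates all the
  tangent data (derivatives, Riemannian metric, subspaces) by the derivatives of the
  coordinate changes.\<close>

definition chart_at :: "'a chart set \<Rightarrow> 'a \<Rightarrow> 'a chart" where
  "chart_at A p = (SOME c. c \<in> A \<and> p \<in> fst c)"

definition tangent_map :: "'a chart set \<Rightarrow> ('a \<Rightarrow> 'a) \<Rightarrow> 'a \<Rightarrow> plane \<Rightarrow> plane" where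
  "tangent_map A F p =
     frechet_derivative (in_charts (chart_at A p) (chart_at A (F p)) F) (at (snd (chart_at A p) p))"

text \<open>The vector at \<open>p\<close> whose coordinates in the chart \<open>c\<close> are \<open>v\<close>.\<close>

definition from_chart :: "'a chart set \<Rightarrow> 'a chart \<Rightarrow> 'a \<Rightarrow> plane \<Rightarrow> plane" where
  "from_chart A c p = frechet_derivative (in_charts c (chart_at A p) id) (at (snd c p))"

definition riemannian_metric ::
    "'a topology \<Rightarrow> 'a chart set \<Rightarrow> ('a \<Rightarrow> plane \<Rightarrow> plane \<Rightarrow> real) \<Rightarrow> bool" where
  "riemannian_metric M A g \<longleftrightarrow>
     (\<forall>p\<in>topspace M. bilinear (g p) \<and> (\<forall>v w. g p v w = g p w v) \<and> (\<forall>v. v \<noteq> 0 \<longrightarrow> g p v v > 0)) \<and>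
     (\<forall>c\<in>A. \<forall>v w k.
        Ck_on k (\<lambda>x. let p = inv_into (fst c) (snd c) x
                     in g p (from_chart A c p v) (from_chart A c p w)) (snd c ` fst c))"

definition rnorm :: "('a \<Rightarrow> plane \<Rightarrow> plane \<Rightarrow> real) \<Rightarrow> 'a \<Rightarrow> plane \<Rightarrow> real" where
  "rnorm g p v = sqrt (g p v v)"


section \<open>Basic sets\<close>

definition hyperbolic_splitting ::
    "'a topology \<Rightarrow> 'a chart set \<Rightarrow> ('a \<Rightarrow> plane \<Rightarrow> plane \<Rightarrow> real) \<Rightarrow> ('a \<Rightarrow> 'a) \<Rightarrow> 'a set
      \<Rightarrow> ('a \<Rightarrow> plane set) \<Rightarrow> ('a \<Rightarrow> plane set) \<Rightarrow> bool" where
  "hyperbolic_splitting M A g f \<Lambda> Es Eu \<longleftrightarrow>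
     (\<forall>x\<in>\<Lambda>. subspace (Es x) \<and> subspace (Eu x) \<and> dim (Es x) = 1 \<and> dim (Eu x) = 1 \<and>
            Es x \<inter> Eu x = {0} \<and> {v + w |v w. v \<in> Es x \<and> w \<in> Eu x} = UNIV \<and>
            tangent_map A f x ` Es x = Es (f x) \<and> tangent_map A f x ` Eu x = Eu (f x)) \<and>
     (\<exists>C>0. \<exists>\<theta>. 0 < \<theta> \<and> \<theta> < 1 \<and> (\<forall>x\<in>\<Lambda>. \<forall>n.
        (\<forall>v\<in>Es x. rnorm g ((f ^^ n) x) (tangent_map A (f ^^ n) x v) \<le> C * \<theta> ^ n * rnorm g x v) \<and>
        (\<forall>v\<in>Eu x. let b = inv_into (topspace M) f ^^ n
                  in rnorm g (b x) (tangent_map A b x v) \<le> C * \<theta> ^ n * rnorm g x v)))"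

definition locally_maximal :: "'a topology \<Rightarrow> ('a \<Rightarrow> 'a) \<Rightarrow> 'a set \<Rightarrow> bool" where
  "locally_maximal M f \<Lambda> \<longleftrightarrow> (\<exists>U. openin M U \<and> \<Lambda> \<subseteq> U \<and>
     \<Lambda> = {x \<in> topspace M. \<forall>n. (f ^^ n) x \<in> U \<and> (inv_into (topspace M) f ^^ n) x \<in> U})"

definition topologically_mixing :: "'a topology \<Rightarrow> ('a \<Rightarrow> 'a) \<Rightarrow> bool" where
  "topologically_mixing X f \<longleftrightarrow>
     (\<forall>U V. openin X U \<and> U \<noteq> {} \<and> openin X V \<and> V \<noteq> {} \<longrightarrow>
        (\<exists>N. \<forall>n\<ge>N. (f ^^ n) ` U \<inter> V \<noteq> {}))"

definition basic_set ::
    "'a topology \<Rightarrow> 'a chart set \<Rightarrow> ('a \<Rightarrow> plane \<Rightarrow> plane \<Rightarrow> real) \<Rightarrow> ('a \<Rightarrow> 'a) \<Rightarrow> 'a set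
      \<Rightarrow> ('a \<Rightarrow> plane set) \<Rightarrow> ('a \<Rightarrow> plane set) \<Rightarrow> bool" where
  "basic_set M A g f \<Lambda> Es Eu \<longleftrightarrow>
     compactin M \<Lambda> \<and> f ` \<Lambda> = \<Lambda> \<and> hyperbolic_splitting M A g f \<Lambda> Es Eu \<and>
     locally_maximal M f \<Lambda> \<and> topologically_mixing (subtopology M \<Lambda>) f"


section \<open>Full shifts and topological conjugacy\<close>

definition full_shift :: "nat \<Rightarrow> (int \<Rightarrow> nat) topology" where
  "full_shift d = product_topology (\<lambda>_. discrete_topology {..<d}) UNIV"

definition left_shift :: "(int \<Rightarrow> nat) \<Rightarrow> int \<Rightarrow> nat" where
  "left_shift \<xi> = (\<lambda>k. \<xi> (k + 1))"

definition topologically_conjugate ::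
    "'a topology \<Rightarrow> ('a \<Rightarrow> 'a) \<Rightarrow> 'b topology \<Rightarrow> ('b \<Rightarrow> 'b) \<Rightarrow> bool" where
  "topologically_conjugate X f Y g \<longleftrightarrow>
     (\<exists>h. homeomorphic_map X Y h \<and> (\<forall>x\<in>topspace X. h (f x) = g (h x)))"


section \<open>Invariant measures and entropy\<close>

definition borel_of :: "'a topology \<Rightarrow> 'a measure" where
  "borel_of X = sigma (topspace X) {U. openin X U}"

definition invariant_measures :: "'a topology \<Rightarrow> ('a \<Rightarrow> 'a) \<Rightarrow> 'a measure set" where
  "invariant_measures X f =
     {\<mu>. sets \<mu> = sets (borel_of X) \<and> prob_space \<mu> \<and> f \<in> \<mu> \<rightarrow>\<^sub>M \<mu> \<and> distr \<mu> \<mu> f = \<mu>}"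

definition finite_partition :: "'a measure \<Rightarrow> 'a set set \<Rightarrow> bool" where
  "finite_partition \<mu> P \<longleftrightarrow> finite P \<and> P \<subseteq> sets \<mu> \<and> partition_on (space \<mu>) P"

text \<open>\<open>P \<or> f\<^sup>-\<^sup>1 P \<or> \<dots> \<or> f\<^sup>-\<^sup>(\<^sup>n\<^sup>-\<^sup>1\<^sup>) P\<close>\<close>

definition dynamical_partition :: "'a measure \<Rightarrow> ('a \<Rightarrow> 'a) \<Rightarrow> 'a set set \<Rightarrow> nat \<Rightarrow> 'a set set" where
  "dynamical_partition \<mu> f P n =
     (\<lambda>a. {x \<in> space \<mu>. \<forall>i<n. (f ^^ i) x \<in> a i}) ` ({..<n} \<rightarrow>\<^sub>E P) - {{}}"

definition partition_entropy :: "'a measure \<Rightarrow> 'a set set \<Rightarrow> real" where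
  "partition_entropy \<mu> P = - (\<Sum>B\<in>P. measure \<mu> B * ln (measure \<mu> B))"

text \<open>The limit exists for invariant \<open>\<mu>\<close> by subadditivity.\<close>

definition entropy_wrt :: "'a measure \<Rightarrow> ('a \<Rightarrow> 'a) \<Rightarrow> 'a set set \<Rightarrow> real" where
  "entropy_wrt \<mu> f P = lim (\<lambda>n. partition_entropy \<mu> (dynamical_partition \<mu> f P n) / real n)"

definition measure_entropy :: "'a measure \<Rightarrow> ('a \<Rightarrow> 'a) \<Rightarrow> ereal" where
  "measure_entropy \<mu> f = (SUP P \<in> {P. finite_partition \<mu> P}. ereal (entropy_wrt \<mu> f P))"


section \<open>The set \<open>\<R>\<^sub>L\<close> and the entropy spectrum\<close>

text \<open>\<open>\<phi>\<^sup>s\<close> and \<open>\<phi>\<^sup>u\<close> are \<open>log_norm A g f Es\<close> and \<open>log_norm A g f Eu\<close>.\<close>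

definition log_norm ::
    "'a chart set \<Rightarrow> ('a \<Rightarrow> plane \<Rightarrow> plane \<Rightarrow> real) \<Rightarrow> ('a \<Rightarrow> 'a) \<Rightarrow> ('a \<Rightarrow> plane set) \<Rightarrow> 'a \<Rightarrow> real" where
  "log_norm A g f E x =
     ln (SUP v \<in> {v \<in> E x. rnorm g x v = 1}. rnorm g (f x) (tangent_map A f x v))"

definition rv :: "('a \<Rightarrow> real) \<Rightarrow> ('a \<Rightarrow> real) \<Rightarrow> 'a measure \<Rightarrow> real \<times> real" where
  "rv \<phi>s \<phi>u \<mu> = (- (LINT x|\<mu>. \<phi>s x), LINT x|\<mu>. \<phi>u x)"

definition RL :: "'a topology \<Rightarrow> ('a \<Rightarrow> 'a) \<Rightarrow> ('a \<Rightarrow> real) \<Rightarrow> ('a \<Rightarrow> real) \<Rightarrow> (real \<times> real) set" where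
  "RL X f \<phi>s \<phi>u = rv \<phi>s \<phi>u ` invariant_measures X f"

definition entropy_spectrum ::
    "'a topology \<Rightarrow> ('a \<Rightarrow> 'a) \<Rightarrow> ('a \<Rightarrow> real) \<Rightarrow> ('a \<Rightarrow> real) \<Rightarrow> real \<times> real \<Rightarrow> ereal" where
  "entropy_spectrum X f \<phi>s \<phi>u w =
     (SUP \<mu> \<in> {\<mu> \<in> invariant_measures X f. rv \<phi>s \<phi>u \<mu> = w}. measure_entropy \<mu> f)"

end

theory Submission
  imports Defs
begin

text \<open>
The surface is the plane, and \<open>f\<close> is a horseshoe with three full branches which expands by \<open>5\<close>
horizontally and contracts by \<open>1/5\<close> vertically, except where the itinerary shows a block
\<open>2 0\<^sup>n 2\<close> (\<open>gap n i\<close> says that such a block starts at position \<open>i\<close>). If a block starts at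
position \<open>0\<close>, the logarithm of the expansion is raised by \<open>(n + 1) r\<^sub>n\<^sup>2 / 4\<close>; if a block ends there,
the logarithm of the contraction is lowered by \<open>(n + 1) r\<^sub>n / 4\<close>. Here \<open>r\<^sub>n = 20\<^sup>-\<^sup>n\<close>.

For an invariant measure \<open>\<mu>\<close> let \<open>q\<^sub>n\<close> be the probability that the origin lies in a block with \<open>n\<close>
zeros. A block has \<open>n + 1\<close> positions (its right end belongs to what follows), so by invariance \<open>q\<^sub>n\<close>
is \<open>n + 1\<close> times the probability that a block starts at the origin, and \<open>\<Sum>q\<^sub>n \<le> 1\<close> since the events
are disjoint (\<open>gap_weight_weights\<close>). Integrating the potentials gives
\<open>rv \<mu> = (ln 5, ln 5) + \<Sum>q\<^sub>n v\<^sub>n\<close> with \<open>v\<^sub>n = (r\<^sub>n, r\<^sub>n\<^sup>2) / 4\<close> (\<open>rv_eq\<close>). Conversely, all nonnegative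
sequences with sum at most \<open>1\<close> occur: mix the periodic orbits of \<open>2 0\<^sup>n\<close> with weights \<open>q\<^sub>n\<close>, and give
the rest to the Bernoulli measure on the digits \<open>0\<close> and \<open>1\<close> (\<open>weights_realised\<close>). Therefore the
rotation set is a translate of the set of all \<open>\<Sum>q\<^sub>n v\<^sub>n\<close>. The \<open>v\<^sub>n\<close> lie on a parabola through the
origin and converge to it, so the extreme points are the origin and the \<open>v\<^sub>n\<close>
(\<open>extreme_points_parabola_hull\<close>), and the origin is the only one that is not isolated.

The tangent to the parabola exposes \<open>v\<^sub>m\<close>. A measure over \<open>v\<^sub>m\<close> therefore has \<open>q\<^sub>m = 1\<close>, which forces
its itineraries to be periodic, and the entropy there is \<open>0\<close> (\<open>entropy_spectrum_vertex\<close>). Over the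
limit point lies the Bernoulli measure, with entropy \<open>ln 2\<close> (\<open>entropy_spectrum_corner\<close>). So the
spectrum is discontinuous at the limit point.

It remains to realise these rates by a diffeomorphism of class \<open>C\<^sup>2\<close>. The points of the Cantor set
with digits \<open>0\<^sup>n 2\<dots>\<close> lie at distance of order \<open>5\<^sup>-\<^sup>n\<close> from the fixed point \<open>0\<close> of the branch with
digit \<open>0\<close>, in disjoint intervals. A sum of rescaled bumps of heights \<open>h\<^sub>n = O(10\<^sup>-\<^sup>n)\<close> gives the
inverse branch with digit \<open>2\<close> the slope \<open>(1 - h\<^sub>n) / 5\<close> at exactly these points, and this sum is of
class \<open>C\<^sup>1\<close> because \<open>\<Sum>5\<^sup>n h\<^sub>n\<close> converges (\<open>dent_addr\<close>, \<open>Ck_contr\<close>). One such contraction of the line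
drives the horizontal coordinate and another one the vertical coordinate. The horseshoe itself
is a composition of four diffeomorphisms of the plane: a horizontal stretching, two shears whose
amount is a step function, locally constant where it matters, and a vertical contraction. Near its
basic set it is thus a product map on each of the three strips.
\<close>

section \<open>Calculus of maps of class \<open>C\<^sup>k\<close>\<close>

lemma Ck_SucI:
  assumes "\<And>x. (f has_derivative D x) (at x)" "\<And>v. Ck_on k (\<lambda>x. D x v) UNIV"
  shows "Ck_on (Suc k) f UNIV"
proof -
  have "frechet_derivative f (at x) = D x" for x
    using frechet_derivative_at[OF assms(1)] by simp
  then show ?thesis
    using assms by (auto simp: differentiable_def)
qed

lemma Ck_SucD:
  assumes "Ck_on (Suc k) f UNIV"
  shows "(f has_derivative frechet_derivative f (at x)) (at x)"
    and "Ck_on k (\<lambda>x. frechet_derivative f (at x) v) UNIV"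
  using assms by (auto simp: frechet_derivative_works)

lemma Ck_Suc_imp: "Ck_on (Suc k) f UNIV \<Longrightarrow> Ck_on k f UNIV"
proof (induction k arbitrary: f)
  case 0
  then show ?case
    by (auto intro!: continuous_at_imp_continuous_on differentiable_imp_continuous_within)
next
  case (Suc k)
  show ?case
  proof (rule Ck_SucI)
    show "(f has_derivative frechet_derivative f (at x)) (at x)" for x
      using Ck_SucD(1)[OF Suc.prems] .
    show "Ck_on k (\<lambda>x. frechet_derivative f (at x) v) UNIV" for v
      using Suc.IH[OF Ck_SucD(2)[OF Suc.prems]] .
  qed
qed

lemma Ck_const: "Ck_on k (\<lambda>x. c) UNIV"
  by (induction k arbitrary: c) auto

lemma Ck_bounded_linear:
  assumes "bounded_linear f" shows "Ck_on k f UNIV"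
proof (cases k)
  case 0
  then show ?thesis using assms by (simp add: linear_continuous_on)
next
  case (Suc j)
  show ?thesis unfolding Suc
    by (rule Ck_SucI[where D="\<lambda>_. f"])
       (use assms in \<open>auto intro: bounded_linear_imp_has_derivative Ck_const\<close>)
qed

lemma Ck_add:
  "Ck_on k f UNIV \<Longrightarrow> Ck_on k g UNIV \<Longrightarrow> Ck_on k (\<lambda>x. f x + g x) UNIV"
proof (induction k arbitrary: f g)
  case 0
  then show ?case by (simp add: continuous_on_add)
next
  case (Suc k)
  show ?case
    by (rule Ck_SucI[OF has_derivative_add[OF Ck_SucD(1)[OF Suc.prems(1)] Ck_SucD(1)[OF Suc.prems(2)]]])
       (rule Suc.IH[OF Ck_SucD(2)[OF Suc.prems(1)] Ck_SucD(2)[OF Suc.prems(2)]])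
qed

lemma Ck_linear_compose:
  assumes "bounded_linear L" "Ck_on k f UNIV"
  shows "Ck_on k (\<lambda>x. L (f x)) UNIV"
  using assms(2)
proof (induction k arbitrary: f)
  case 0
  then show ?case using assms(1) by (auto intro: bounded_linear.continuous_on)
next
  case (Suc k)
  note f = Ck_SucD[OF Suc.prems]
  show ?case
    by (rule Ck_SucI[OF bounded_linear.has_derivative[OF assms(1) f(1)]]) (rule Suc.IH[OF f(2)])
qed

lemma Ck_diff:
  assumes "Ck_on k f UNIV" "Ck_on k g UNIV" shows "Ck_on k (\<lambda>x. f x - g x) UNIV"
  using Ck_add[OF assms(1) Ck_linear_compose[OF bounded_linear_minus[OF bounded_linear_ident] assms(2)]]
  by simp

lemma Ck_sum:
  assumes "\<And>i. i \<in> I \<Longrightarrow> Ck_on k (f i) UNIV"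
  shows "Ck_on k (\<lambda>x. \<Sum>i\<in>I. f i x) UNIV"
  using assms
  by (induction I rule: infinite_finite_induct) (auto intro: Ck_const Ck_add)

lemma (in bounded_bilinear) Ck_bilinear:
  assumes "Ck_on k f UNIV" "Ck_on k g UNIV"
  shows "Ck_on k (\<lambda>x. prod (f x) (g x)) UNIV"
  using assms
proof (induction k arbitrary: f g)
  case 0
  then show ?case by (auto intro: continuous_on)
next
  case (Suc k)
  note f = Ck_SucD[OF Suc.prems(1)] and g = Ck_SucD[OF Suc.prems(2)]
  show ?case
    by (rule Ck_SucI[OF FDERIV[OF f(1) g(1)]])
       (rule Ck_add[OF Suc.IH[OF Ck_Suc_imp[OF Suc.prems(1)] g(2)]
                       Suc.IH[OF f(2) Ck_Suc_imp[OF Suc.prems(2)]]])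
qed

text \<open>The derivative of a composition is expanded in the standard basis, so that each coefficient is a
  product of a partial derivative of the inner map and a partial derivative of the outer one,
  both of class one less.\<close>

lemma Ck_compose:
  fixes f :: "'a::euclidean_space \<Rightarrow> 'b::euclidean_space" and g :: "'b \<Rightarrow> 'c::real_normed_vector"
  assumes "Ck_on k g UNIV" "Ck_on k f UNIV"
  shows "Ck_on k (\<lambda>x. g (f x)) UNIV"
  using assms
proof (induction k arbitrary: f g)
  case 0
  then show ?case by (auto intro: continuous_on_compose2)
next
  case (Suc k)
  note f = Ck_SucD[OF Suc.prems(2)] and g = Ck_SucD[OF Suc.prems(1)]
  let ?D = "\<lambda>x v. frechet_derivative g (at (f x)) (frechet_derivative f (at x) v)"
  have D: "((\<lambda>x. g (f x)) has_derivative ?D x) (at x)" for x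
    using has_derivative_compose[OF f(1) g(1)] .
  have "?D x v = (\<Sum>b\<in>Basis. (frechet_derivative f (at x) v \<bullet> b) *\<^sub>R frechet_derivative g (at (f x)) b)"
    for x v
  proof -
    have "linear (frechet_derivative g (at (f x)))"
      using g(1) has_derivative_linear by blast
    then show ?thesis
      by (subst (1) euclidean_representation[symmetric]) (simp add: linear_sum linear_scale)
  qed
  moreover have "Ck_on k (\<lambda>x. \<Sum>b\<in>Basis. (frechet_derivative f (at x) v \<bullet> b) *\<^sub>R
                           frechet_derivative g (at (f x)) b) UNIV" for v
  proof (rule Ck_sum, rule bounded_bilinear.Ck_bilinear[OF bounded_bilinear_scaleR])
    fix b :: 'b
    show "Ck_on k (\<lambda>x. frechet_derivative f (at x) v \<bullet> b) UNIV"
      by (rule Ck_linear_compose[OF bounded_linear_inner_left f(2)])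
    show "Ck_on k (\<lambda>x. frechet_derivative g (at (f x)) b) UNIV"
      by (rule Suc.IH[OF g(2) Ck_Suc_imp[OF Suc.prems(2)]])
  qed
  ultimately have "Ck_on k (\<lambda>x. ?D x v) UNIV" for v
    by presburger
  then show ?case
    by (rule Ck_SucI[OF D])
qed

lemma Ck_Pair:
  fixes f :: "'a::euclidean_space \<Rightarrow> real" and g :: "'a \<Rightarrow> real"
  assumes "Ck_on k f UNIV" "Ck_on k g UNIV"
  shows "Ck_on k (\<lambda>x. (f x, g x)) UNIV"
proof -
  have "bounded_linear (\<lambda>x::real. (x, 0::real))" "bounded_linear (\<lambda>x::real. (0::real, x))"
    by (intro bounded_linear_Pair bounded_linear_ident bounded_linear_zero)+
  from Ck_add[OF Ck_linear_compose[OF this(1) assms(1)] Ck_linear_compose[OF this(2) assms(2)]]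
  show ?thesis by simp
qed

lemma Ck_real_SucI:
  fixes f :: "real \<Rightarrow> real"
  assumes "\<And>x. (f has_real_derivative f' x) (at x)" "Ck_on k f' UNIV"
  shows "Ck_on (Suc k) f UNIV"
proof (rule Ck_SucI)
  show "(f has_derivative (\<lambda>v. f' x * v)) (at x)" for x
    using assms(1) unfolding has_field_derivative_def .
  show "Ck_on k (\<lambda>x. f' x * v) UNIV" for v
    using Ck_linear_compose[OF bounded_linear_mult_left assms(2)] by simp
qed

lemma Ck_1I:
  fixes f :: "real \<Rightarrow> real"
  assumes "\<And>x. (f has_real_derivative f' x) (at x)" "continuous_on UNIV f'"
  shows "Ck_on 1 f UNIV"
  unfolding One_nat_def by (rule Ck_real_SucI[OF assms(1)]) (use assms(2) in simp)

lemma Ck_2I: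
  fixes f :: "real \<Rightarrow> real"
  assumes "\<And>x. (f has_real_derivative f' x) (at x)" "Ck_on 1 f' UNIV"
  shows "Ck_on 2 f UNIV"
  unfolding numeral_2_eq_2 by (rule Ck_real_SucI[OF assms(1)]) (use assms(2) in \<open>simp only: One_nat_def\<close>)

lemma Ck_1_continuous: "Ck_on 1 f UNIV \<Longrightarrow> continuous_on UNIV f"
  using Ck_Suc_imp[of 0 f] by (simp only: One_nat_def Ck_on.simps(1))

section \<open>Splines\<close>

definition cutpow :: "nat \<Rightarrow> real \<Rightarrow> real" where
  "cutpow k t = max 0 t ^ k"

lemma cutpow_nonpos: "t \<le> 0 \<Longrightarrow> 0 < k \<Longrightarrow> cutpow k t = 0"
  and cutpow_nonneg: "0 \<le> t \<Longrightarrow> cutpow k t = t ^ k"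
  by (auto simp: cutpow_def)

lemma continuous_on_cutpow: "continuous_on S (cutpow k)"
  unfolding cutpow_def by (intro continuous_intros)

lemma DERIV_cutpow:
  "(cutpow (Suc (Suc k)) has_real_derivative (real k + 2) * cutpow (Suc k) t) (at t)"
proof -
  consider "t > 0" | "t < 0" | "t = 0" by linarith
  then show ?thesis
  proof cases
    case 1
    have "((\<lambda>x. x ^ Suc (Suc k)) has_real_derivative (real k + 2) * t ^ Suc k) (at t)"
      by (rule derivative_eq_intros refl | simp)+
    then have "((\<lambda>x. x ^ Suc (Suc k)) has_real_derivative (real k + 2) * cutpow (Suc k) t) (at t)"
      using 1 by (simp add: cutpow_nonneg)
    then show ?thesis
      by (rule has_field_derivative_transform_within_open[where S="{0<..}"])
         (use 1 in \<open>auto simp: cutpow_nonneg\<close>)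
  next
    case 2
    have "((\<lambda>x. 0) has_real_derivative (real k + 2) * cutpow (Suc k) t) (at t)"
      using 2 by (simp add: cutpow_nonpos)
    then show ?thesis
      by (rule has_field_derivative_transform_within_open[where S="{..<0}"])
         (use 2 in \<open>auto simp: cutpow_nonpos\<close>)
  next
    case 3
    have "(cutpow (Suc k) \<longlongrightarrow> cutpow (Suc k) 0) (at 0)"
      using continuous_on_cutpow[of UNIV "Suc k"]
      by (simp add: continuous_on_eq_continuous_at isCont_def)
    then have "(cutpow (Suc k) \<longlongrightarrow> 0) (at 0)"
      by (simp add: cutpow_nonpos)
    moreover have "\<forall>\<^sub>F h in at 0. cutpow (Suc k) h = (cutpow (Suc (Suc k)) (0 + h) - cutpow (Suc (Suc k)) 0) / h"
      by (auto simp: eventually_at_filter cutpow_def max_def)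
    ultimately have "((\<lambda>h. (cutpow (Suc (Suc k)) (0 + h) - cutpow (Suc (Suc k)) 0) / h) \<longlongrightarrow> 0) (at 0)"
      by (rule Lim_transform_eventually)
    then show ?thesis
      using 3 by (simp add: DERIV_def cutpow_nonpos)
  qed
qed

lemma DERIV_cutpow_2: "(cutpow 2 has_real_derivative 2 * cutpow 1 t) (at t)"
  and DERIV_cutpow_3: "(cutpow 3 has_real_derivative 3 * cutpow 2 t) (at t)"
  and DERIV_cutpow_4: "(cutpow 4 has_real_derivative 4 * cutpow 3 t) (at t)"
  using DERIV_cutpow[of 0 t] DERIV_cutpow[of 1 t] DERIV_cutpow[of 2 t]
  by (simp_all add: eval_nat_numeral)

text \<open>Third differences of truncated powers are integrated cubic B-splines: step functions of class
  \<open>C\<^sup>2\<close> with explicit derivatives and antiderivatives.\<close>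

definition third_difference :: "(real \<Rightarrow> real) \<Rightarrow> real \<Rightarrow> real" where
  "third_difference p t = p t - 3 * p (t - 1) + 3 * p (t - 2) - p (t - 3)"

definition ramp :: "real \<Rightarrow> real" where "ramp t = third_difference (cutpow 3) t / 6"
definition ramp' :: "real \<Rightarrow> real" where "ramp' t = third_difference (cutpow 2) t / 2"
definition ramp'' :: "real \<Rightarrow> real" where "ramp'' t = third_difference (cutpow 1) t"
definition iramp :: "real \<Rightarrow> real" where "iramp t = third_difference (cutpow 4) t / 24"

lemma DERIV_third_difference:
  assumes "\<And>t. (p has_real_derivative p' t) (at t)"
  shows "(third_difference p has_real_derivative third_difference p' t) (at t)"
proof -
  have "((\<lambda>t. p (t - c)) has_real_derivative p' (t - c)) (at t)" for c
    using DERIV_shift[of p "p' (t - c)" t "-c"] assms[of "t - c"] by simp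
  note this[THEN DERIV_cmult, of 3 1] this[THEN DERIV_cmult, of 3 2] this[of 3]
  then show ?thesis
    unfolding third_difference_def[abs_def]
    by (intro DERIV_diff DERIV_add assms) auto
qed

lemma third_difference_cmult: "third_difference (\<lambda>t. c * p t) t = c * third_difference p t"
  by (simp add: third_difference_def algebra_simps)

lemma DERIV_ramp: "(ramp has_real_derivative ramp' t) (at t)"
  and DERIV_ramp': "(ramp' has_real_derivative ramp'' t) (at t)"
  and DERIV_iramp: "(iramp has_real_derivative ramp t) (at t)"
  using DERIV_cdivide[OF DERIV_third_difference[OF DERIV_cutpow_3], of 6 t]
    DERIV_cdivide[OF DERIV_third_difference[OF DERIV_cutpow_2], of 2 t]
    DERIV_cdivide[OF DERIV_third_difference[OF DERIV_cutpow_4], of 24 t]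
  unfolding ramp_def[abs_def] ramp'_def[abs_def] ramp''_def[abs_def] iramp_def[abs_def]
    third_difference_cmult
  by (simp_all)

lemma continuous_on_ramp'': "continuous_on S ramp''"
  unfolding ramp''_def[abs_def] third_difference_def
  by (intro continuous_intros continuous_on_compose2[OF continuous_on_cutpow[of UNIV 1]]) auto

lemma ramp_left: "t \<le> 0 \<Longrightarrow> ramp t = 0" and ramp'_left: "t \<le> 0 \<Longrightarrow> ramp' t = 0"
  and iramp_left: "t \<le> 0 \<Longrightarrow> iramp t = 0"
  by (simp_all add: ramp_def ramp'_def iramp_def third_difference_def cutpow_nonpos)

lemma ramp_right: "3 \<le> t \<Longrightarrow> ramp t = 1" and ramp'_right: "3 \<le> t \<Longrightarrow> ramp' t = 0"
  by (simp_all add: ramp_def ramp'_def third_difference_def cutpow_nonneg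
      power2_eq_square power3_eq_cube algebra_simps)

lemma ramp'_bounds: "0 \<le> ramp' t \<and> ramp' t \<le> 1"
proof -
  consider "t \<le> 0" | "0 < t" "t \<le> 1" | "1 < t" "t \<le> 2" | "2 < t" "t \<le> 3" | "3 < t" by linarith
  then show ?thesis
  proof cases
    case 2
    then have "ramp' t = t\<^sup>2 / 2"
      by (simp add: ramp'_def third_difference_def cutpow_def)
    moreover have "t\<^sup>2 \<le> 1" "0 \<le> t\<^sup>2" using 2 by (simp_all add: power_le_one)
    ultimately show ?thesis by linarith
  next
    case 3
    then have *: "ramp' t = (t\<^sup>2 - 3 * (t - 1)\<^sup>2) / 2"
      by (simp add: ramp'_def third_difference_def cutpow_def)
    have "ramp' t = 3/4 - (t - 3/2)\<^sup>2"
      unfolding * by (simp add: field_simps power2_eq_square)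
    moreover have "(t - 3/2)\<^sup>2 \<le> (1/2)\<^sup>2" using 3 by (intro abs_le_square_iff[THEN iffD1]) (simp add: abs_if)
    moreover have "0 \<le> (t - 3/2)\<^sup>2" by simp
    ultimately show ?thesis by (simp only: power_one_over power2_eq_square) linarith
  next
    case 4
    then have *: "ramp' t = (t\<^sup>2 - 3 * (t - 1)\<^sup>2 + 3 * (t - 2)\<^sup>2) / 2"
      by (simp add: ramp'_def third_difference_def cutpow_def)
    have "ramp' t = (3 - t)\<^sup>2 / 2"
      unfolding * by (simp add: field_simps power2_eq_square)
    moreover have "(3 - t)\<^sup>2 \<le> 1" "0 \<le> (3 - t)\<^sup>2" using 4 by (simp_all add: power_le_one)
    ultimately show ?thesis by linarith
  qed (auto simp: ramp'_left ramp'_right)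
qed

lemma ramp_mono: "s \<le> t \<Longrightarrow> ramp s \<le> ramp t"
  using DERIV_nonneg_imp_nondecreasing[of s t ramp] DERIV_ramp ramp'_bounds by blast

lemma ramp_bounds: "0 \<le> ramp t \<and> ramp t \<le> 1"
  using ramp_mono[of "min t 0" t] ramp_mono[of t "max t 3"] by (simp add: ramp_left ramp_right)

text \<open>The bump is \<open>1\<close> on \<open>[2/5, 4/5]\<close> and vanishes outside \<open>[1/5, 1]\<close>. Both ends of the support
  are related by the factor \<open>5\<close>, which is also the ratio of consecutive scales at which the bump
  will be repeated; \<open>ibump\<close> is its antiderivative.\<close>

definition bump :: "real \<Rightarrow> real" where "bump t = ramp (15 * t - 3) - ramp (15 * t - 12)"
definition bump' :: "real \<Rightarrow> real" where "bump' t = 15 * (ramp' (15 * t - 3) - ramp' (15 * t - 12))"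
definition ibump :: "real \<Rightarrow> real" where "ibump t = (iramp (15 * t - 3) - iramp (15 * t - 12)) / 15"

lemma DERIV_affine:
  assumes "\<And>t. (p has_real_derivative p' t) (at t)"
  shows "((\<lambda>t. p (a * t + c)) has_real_derivative a * p' (a * t + c)) (at t)"
proof -
  have "((\<lambda>t. a * t + c) has_real_derivative a) (at t)"
    by (rule derivative_eq_intros refl | simp)+
  from DERIV_chain2[OF assms this] show ?thesis by (simp add: mult.commute)
qed

lemma DERIV_bump: "(bump has_real_derivative bump' t) (at t)"
  using DERIV_diff[OF DERIV_affine[OF DERIV_ramp, of 15 "-3" t] DERIV_affine[OF DERIV_ramp, of 15 "-12" t]]
  unfolding bump_def[abs_def] bump'_def by (simp add: algebra_simps)

lemma DERIV_ibump: "(ibump has_real_derivative bump t) (at t)"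
  using DERIV_cdivide[OF DERIV_diff[OF DERIV_affine[OF DERIV_iramp, of 15 "-3" t]
        DERIV_affine[OF DERIV_iramp, of 15 "-12" t]], of 15]
  unfolding bump_def ibump_def[abs_def] by (simp add: diff_divide_distrib)

lemma continuous_on_affine_arg:
  fixes p :: "real \<Rightarrow> real"
  assumes "continuous_on UNIV p" shows "continuous_on UNIV (\<lambda>t. p (a * t + c))"
proof (rule continuous_on_compose2[OF assms])
  show "continuous_on UNIV (\<lambda>t. a * t + c)" by (intro continuous_intros)
qed simp

lemma continuous_on_bump': "continuous_on UNIV bump'"
proof -
  have "continuous_on UNIV ramp'"
    using DERIV_ramp' by (meson DERIV_isCont continuous_at_imp_continuous_on)
  from continuous_on_affine_arg[OF this, of 15 "-3"] continuous_on_affine_arg[OF this, of 15 "-12"]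
  have "continuous_on UNIV (\<lambda>t. 15 * (ramp' (15 * t - 3) - ramp' (15 * t - 12)))"
    by (intro continuous_on_mult_left continuous_on_diff) simp_all
  then show ?thesis by (simp add: bump'_def[abs_def])
qed

lemma bump_bounds: "0 \<le> bump t \<and> bump t \<le> 1"
  using ramp_bounds[of "15*t-3"] ramp_bounds[of "15*t-12"] ramp_mono[of "15*t-12" "15*t-3"]
  unfolding bump_def by linarith

lemma bump'_bound: "\<bar>bump' t\<bar> \<le> 15"
  using ramp'_bounds[of "15*t-3"] ramp'_bounds[of "15*t-12"]
  unfolding bump'_def by (simp add: abs_le_iff)

lemma bump_left: "t \<le> 1/5 \<Longrightarrow> bump t = 0" and bump_right: "1 \<le> t \<Longrightarrow> bump t = 0"
  and bump_plateau: "2/5 \<le> t \<Longrightarrow> t \<le> 4/5 \<Longrightarrow> bump t = 1"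
  and ibump_left: "t \<le> 1/5 \<Longrightarrow> ibump t = 0"
  by (simp_all add: bump_def ibump_def ramp_left ramp_right iramp_left)

text \<open>The amount of the two shears of the horseshoe: constant near the three intervals around
  \<open>-3\<close>, \<open>0\<close> and \<open>3\<close> onto which the strips are stretched.\<close>

definition stair :: "real \<Rightarrow> real" where
  "stair w = 3 * ramp (3 * w - 3) + 3 * ramp (3 * w + 6) - 3"
definition stair' :: "real \<Rightarrow> real" where
  "stair' w = 9 * ramp' (3 * w - 3) + 9 * ramp' (3 * w + 6)"

lemma DERIV_stair: "(stair has_real_derivative stair' w) (at w)"
  using DERIV_diff[OF DERIV_add[OF DERIV_cmult[OF DERIV_affine[OF DERIV_ramp, of 3 "-3" w], of 3]
      DERIV_cmult[OF DERIV_affine[OF DERIV_ramp, of 3 6 w], of 3]] DERIV_const[of 3]]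
  unfolding stair_def[abs_def] stair'_def by simp

lemma Ck_ramp': "Ck_on 1 ramp' UNIV"
  by (rule Ck_1I[OF DERIV_ramp' continuous_on_ramp''])

lemma Ck_affine: "Ck_on k (\<lambda>t. a * t + c :: real) UNIV"
  by (intro Ck_add Ck_const Ck_bounded_linear bounded_linear_mult_right)

lemma Ck_stair: "Ck_on 2 stair UNIV"
proof (rule Ck_2I[OF DERIV_stair])
  have "Ck_on 1 (\<lambda>w. 9 * ramp' (3 * w + c)) UNIV" for c
    by (rule Ck_linear_compose[OF bounded_linear_mult_right Ck_compose[OF Ck_ramp' Ck_affine]])
  from Ck_add[OF this[of "-3"] this[of 6]] show "Ck_on 1 stair' UNIV"
    unfolding stair'_def[abs_def] by (simp only: add_uminus_conv_diff)
qed

text \<open>Digits beyond \<open>2\<close> act like \<open>2\<close>, so that every sequence of natural numbers is an itinerary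
  and the coding map is total.\<close>

definition offset :: "nat \<Rightarrow> real" where
  "offset d = (if d = 0 then 0 else if d = 1 then -3 else 3)"

lemma stair_offset: "\<bar>t\<bar> \<le> 1 \<Longrightarrow> stair (t + offset d) = offset d"
  and stair'_offset: "\<bar>t\<bar> \<le> 1 \<Longrightarrow> stair' (t + offset d) = 0"
  by (auto simp: stair_def stair'_def offset_def ramp_left ramp_right ramp'_left ramp'_right)

section \<open>A contraction of the line with prescribed slopes\<close>

text \<open>The \<open>n\<close>-th bump lives at scale \<open>5\<^sup>-\<^sup>n\<close> and its derivative has size \<open>5\<^sup>n h n\<close>. The decay of the
  heights makes these derivatives summable; the factor \<open>1/4\<close> keeps the slopes positive.\<close>

locale bump_heights =
  fixes h :: "nat \<Rightarrow> real"
  assumes h_nonneg: "0 \<le> h n" and h_le: "h n \<le> (1/4) * (1/10) ^ n"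
begin

text \<open>The relative defect of the slope, its derivative, and its antiderivative.\<close>

definition dent :: "real \<Rightarrow> real" where "dent t = (\<Sum>n. h n * bump (5 ^ n * t))"
definition dent' :: "real \<Rightarrow> real" where "dent' t = (\<Sum>n. h n * 5 ^ n * bump' (5 ^ n * t))"
definition sag :: "real \<Rightarrow> real" where "sag t = (\<Sum>n. h n / 5 ^ n * ibump (5 ^ n * t))"

lemma h_abs: "\<bar>h n\<bar> \<le> (1/4) * (1/10) ^ n"
  using h_nonneg[of n] h_le[of n] by simp

lemma dent_term_bound: "norm (h n * bump (5 ^ n * t)) \<le> (1/4) * (1/10) ^ n"
proof -
  have "\<bar>h n\<bar> * \<bar>bump (5 ^ n * t)\<bar> \<le> ((1/4) * (1/10) ^ n) * 1"
    using bump_bounds[of "5^n*t"] by (intro mult_mono h_abs) auto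
  then show ?thesis by (simp add: abs_mult)
qed

lemma dent'_term_bound: "norm (h n * 5 ^ n * bump' (5 ^ n * t)) \<le> (15/4) * (1/2) ^ n"
proof -
  have "\<bar>h n\<bar> * 5 ^ n * \<bar>bump' (5 ^ n * t)\<bar> \<le> ((1/4) * (1/10) ^ n) * 5 ^ n * 15"
    by (intro mult_mono h_abs bump'_bound) auto
  also have "\<dots> = (15/4) * (1/2) ^ n"
    using power_mult_distrib[of "1/10" "5::real" n] by simp
  finally show ?thesis by (simp add: abs_mult)
qed

lemma summable_bounds: "summable (\<lambda>n. (1/4) * (1/10::real) ^ n)" "summable (\<lambda>n. (15/4) * (1/2::real) ^ n)"
  by (intro summable_mult summable_geometric; simp)+

lemma dent_uniform: "uniform_limit UNIV (\<lambda>n t. \<Sum>i<n. h i * bump (5 ^ i * t)) dent sequentially"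
  unfolding dent_def[abs_def]
  by (rule Weierstrass_m_test[OF dent_term_bound summable_bounds(1)])

lemma dent'_uniform:
  "uniform_limit UNIV (\<lambda>n t. \<Sum>i<n. h i * 5 ^ i * bump' (5 ^ i * t)) dent' sequentially"
  unfolding dent'_def[abs_def]
  by (rule Weierstrass_m_test[OF dent'_term_bound summable_bounds(2)])

lemma summable_dent: "summable (\<lambda>n. h n * bump (5 ^ n * t))"
  by (rule summable_comparison_test'[OF summable_bounds(1) dent_term_bound])

lemma DERIV_dent: "(dent has_real_derivative dent' t) (at t)"
  unfolding dent_def[abs_def] dent'_def
proof (rule has_field_derivative_series'(2)[where S=UNIV and ?x0.0 = 0])
  show "((\<lambda>t. h n * bump (5 ^ n * t)) has_real_derivative h n * 5 ^ n * bump' (5 ^ n * t)) (at t)" for n t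
    using DERIV_cmult[OF DERIV_affine[OF DERIV_bump, of "5^n" 0 t], of "h n"] by (simp add: mult.assoc)
  show "uniformly_convergent_on UNIV (\<lambda>n x. \<Sum>i<n. h i * 5 ^ i * bump' (5 ^ i * x))"
    by (rule uniformly_convergentI[OF dent'_uniform])
  show "summable (\<lambda>n. h n * bump (5 ^ n * 0))" by (rule summable_dent)
qed auto

lemma DERIV_sag: "(sag has_real_derivative dent t) (at t)"
  unfolding sag_def[abs_def] dent_def
proof (rule has_field_derivative_series'(2)[where S=UNIV and ?x0.0 = 0])
  show "((\<lambda>t. h n / 5 ^ n * ibump (5 ^ n * t)) has_real_derivative h n * bump (5 ^ n * t)) (at t)" for n t
    using DERIV_cmult[OF DERIV_affine[OF DERIV_ibump, of "5^n" 0 t], of "h n / 5 ^ n"] by simp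
  show "uniformly_convergent_on UNIV (\<lambda>n x. \<Sum>i<n. h i * bump (5 ^ i * x))"
    by (rule uniformly_convergentI[OF dent_uniform])
  show "summable (\<lambda>n. h n / 5 ^ n * ibump (5 ^ n * 0))" by (simp add: ibump_left)
qed auto

lemma continuous_on_dent': "continuous_on UNIV dent'"
proof -
  have "continuous_on UNIV (\<lambda>t. \<Sum>i<n. h i * 5 ^ i * bump' (5 ^ i * t))" for n
  proof (intro continuous_on_sum continuous_on_mult_left)
    show "continuous_on UNIV (\<lambda>t. bump' (5 ^ i * t))" for i
      using continuous_on_affine_arg[OF continuous_on_bump', of "5 ^ i" 0] by simp
  qed
  then have "\<forall>\<^sub>F n in sequentially. continuous_on UNIV (\<lambda>t. \<Sum>i<n. h i * 5 ^ i * bump' (5 ^ i * t))"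
    by simp
  from uniform_limit_theorem[OF this dent'_uniform] show ?thesis by simp
qed

lemma dent_bounds: "0 \<le> dent t \<and> dent t \<le> 1/2"
proof
  show "0 \<le> dent t"
    unfolding dent_def using h_nonneg bump_bounds by (intro suminf_nonneg summable_dent) auto
  have "dent t \<le> (\<Sum>n. (1/4) * (1/10::real) ^ n)"
    unfolding dent_def
    using abs_le_D1[OF dent_term_bound[unfolded real_norm_def]]
    by (intro suminf_le summable_dent summable_bounds)
  also have "\<dots> = 1/4 * (1 / (1 - 1/10))"
    using suminf_mult[OF summable_geometric, of "1/10::real" "1/4"] suminf_geometric[of "1/10::real"] by simp
  also have "\<dots> \<le> 1/2" by simp
  finally show "dent t \<le> 1/2" .
qed

lemma sag_left: "t \<le> 0 \<Longrightarrow> sag t = 0"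
proof -
  assume "t \<le> 0"
  then have "ibump (5 ^ n * t) = 0" for n
    using mult_nonneg_nonpos[of "5 ^ n" t] by (intro ibump_left) simp
  then show ?thesis by (simp add: sag_def)
qed

lemma dent_left: "t \<le> 0 \<Longrightarrow> dent t = 0"
proof -
  assume "t \<le> 0"
  then have "bump (5 ^ n * t) = 0" for n
    using mult_nonneg_nonpos[of "5 ^ n" t] by (intro bump_left) simp
  then show ?thesis by (simp add: dent_def)
qed

text \<open>The supports of the rescaled bumps are disjoint up to the plateaux: a point of the
  \<open>n\<close>-th plateau is in the flat part of every other bump.\<close>

lemma dent_plateau:
  assumes "2/5 \<le> t" "t \<le> 4/5"
  shows "dent (t / 5 ^ n) = h n"
proof -
  have "bump (5 ^ m * (t / 5 ^ n)) = of_bool (m = n)" for m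
  proof -
    consider "m = n" | "m < n" | "n < m" by linarith
    then show ?thesis
    proof cases
      case 1
      then show ?thesis using assms by (simp add: bump_plateau)
    next
      case 2
      then obtain j where j: "n = m + Suc j" using less_imp_Suc_add by auto
      have "5 ^ m * (t / 5 ^ n) = t / 5 ^ Suc j" unfolding j by (simp add: power_add)
      also have "\<dots> \<le> t / 5 ^ 1"
        using assms(1) by (intro divide_left_mono power_increasing) auto
      also have "\<dots> \<le> 1/5" using assms by simp
      finally show ?thesis using 2 by (simp add: bump_left)
    next
      case 3
      then obtain j where j: "m = n + Suc j" using less_imp_Suc_add by auto
      have "1 \<le> 5 ^ 1 * t" using assms by simp
      also have "\<dots> \<le> 5 ^ Suc j * t"
        using assms by (intro mult_right_mono power_increasing) auto
      also have "\<dots> = 5 ^ m * (t / 5 ^ n)" unfolding j by (simp add: power_add)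
      finally show ?thesis using 3 by (simp add: bump_right)
    qed
  qed
  then have "dent (t / 5 ^ n) = (\<Sum>m. if m = n then h n else 0)"
    unfolding dent_def by (intro suminf_cong) auto
  also have "\<dots> = h n" using suminf_finite[of "{n}" "\<lambda>m. if m = n then h n else 0"] by simp
  finally show ?thesis .
qed

text \<open>The three inverse branches are restrictions of this one contraction of the line to intervals
  around \<open>0\<close>, \<open>-3\<close> and \<open>3\<close>; the shift of the argument by \<open>3\<close> puts the defect on the branch with digit
  \<open>2\<close>.\<close>

definition contr :: "real \<Rightarrow> real" where "contr w = (w - sag (w - 3)) / 5"
definition contr' :: "real \<Rightarrow> real" where "contr' w = (1 - dent (w - 3)) / 5"
definition expd :: "real \<Rightarrow> real" where "expd = inv contr"

lemma DERIV_contr: "(contr has_real_derivative contr' w) (at w)"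
  using DERIV_cdivide[OF DERIV_diff[OF DERIV_ident DERIV_affine[OF DERIV_sag, of 1 "-3" w]], of 5]
  unfolding contr_def[abs_def] contr'_def by simp

lemma contr'_bounds: "1/10 \<le> contr' w" "contr' w \<le> 1/5"
  using dent_bounds[of "w - 3"] by (auto simp: contr'_def)

lemma contr_bounds:
  assumes "s \<le> t"
  shows "(t - s) / 10 \<le> contr t - contr s" "contr t - contr s \<le> (t - s) / 5"
proof -
  have "\<exists>z. contr t - contr s = (t - s) * contr' z"
  proof (cases "s = t")
    case False
    then show ?thesis using MVT2[of s t contr contr'] DERIV_contr assms by force
  qed simp
  then obtain z where z: "contr t - contr s = (t - s) * contr' z" by blast
  have "(t - s) * (1/10) \<le> (t - s) * contr' z" "(t - s) * contr' z \<le> (t - s) * (1/5)"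
    using assms by (intro mult_left_mono contr'_bounds; simp)+
  then show "(t - s) / 10 \<le> contr t - contr s" "contr t - contr s \<le> (t - s) / 5"
    unfolding z by simp_all
qed

lemma contr_expands: "\<bar>s - t\<bar> \<le> 10 * \<bar>contr s - contr t\<bar>"
  using contr_bounds[of s t] contr_bounds[of t s] by (cases "s \<le> t") auto

lemma contr_contracts: "\<bar>contr s - contr t\<bar> \<le> \<bar>s - t\<bar> / 5"
  using contr_bounds[of s t] contr_bounds[of t s] by (cases "s \<le> t") auto

lemma contr_mono: "s \<le> t \<Longrightarrow> contr s \<le> contr t"
  using contr_bounds(1)[of s t] by simp

lemma bij_contr: "bij contr"
proof (rule bijI)
  show "inj contr"
  proof (rule injI)
    fix s t assume "contr s = contr t"
    then show "s = t" using contr_expands[of s t] by simp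
  qed
  show "surj contr"
  proof
    show "UNIV \<subseteq> range contr"
    proof
      fix v
      let ?a = "- 10 * \<bar>v - contr 0\<bar>" and ?b = "10 * \<bar>v - contr 0\<bar>"
      have "contr ?a \<le> v" "v \<le> contr ?b"
        using contr_bounds(1)[of ?a 0] contr_bounds(1)[of 0 ?b] by auto
      moreover have "isCont contr w" for w using DERIV_contr DERIV_isCont by blast
      ultimately show "v \<in> range contr"
        using IVT[of contr ?a v ?b] by auto
    qed
  qed simp
qed

lemma expd_contr [simp]: "expd (contr w) = w"
  unfolding expd_def using bij_contr by (simp add: bij_is_inj)

lemma contr_expd [simp]: "contr (expd x) = x"
  unfolding expd_def using bij_contr by (simp add: bij_is_surj surj_f_inv_f)

lemma isCont_expd: "isCont expd x"
proof -
  have "((\<lambda>y. 10 * dist y x) \<longlongrightarrow> 10 * dist x x) (at x)"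
    by (intro tendsto_mult tendsto_const tendsto_dist tendsto_ident_at)
  then have *: "((\<lambda>y. 10 * dist y x) \<longlongrightarrow> 0) (at x)" by simp
  have "((\<lambda>y. dist (expd y) (expd x)) \<longlongrightarrow> 0) (at x)"
  proof (rule tendsto_sandwich[OF _ _ tendsto_const *])
    show "\<forall>\<^sub>F y in at x. dist (expd y) (expd x) \<le> 10 * dist y x"
      using contr_expands[of "expd _" "expd x"] by (simp add: dist_real_def)
  qed simp
  then show ?thesis
    unfolding isCont_def by (rule tendsto_dist_iff[THEN iffD2])
qed

lemma DERIV_expd: "(expd has_real_derivative inverse (contr' (expd x))) (at x)"
proof (rule DERIV_inverse_function[where a="x - 1" and b="x + 1"])
  show "(contr has_real_derivative contr' (expd x)) (at (expd x))" by (rule DERIV_contr)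
  show "contr' (expd x) \<noteq> 0" using contr'_bounds(1)[of "expd x"] by linarith
qed (simp_all add: isCont_expd)

lemma DERIV_contr': "(contr' has_real_derivative - dent' (w - 3) / 5) (at w)"
proof -
  have "((\<lambda>w. dent (w - 3)) has_real_derivative dent' (w - 3)) (at w)"
    using DERIV_affine[OF DERIV_dent, of 1 "-3" w] by simp
  then show ?thesis
    unfolding contr'_def[abs_def] by (auto intro!: derivative_eq_intros)
qed

lemma continuous_on_dent'_shift: "continuous_on UNIV (\<lambda>w. - dent' (w - 3) / 5)"
proof -
  have "continuous_on UNIV (\<lambda>w. dent' (w - 3))"
    using continuous_on_affine_arg[OF continuous_on_dent', of 1 "-3"] by simp
  then show ?thesis by (intro continuous_on_divide continuous_on_minus continuous_on_const) simp_all
qed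

lemma Ck_contr': "Ck_on 1 contr' UNIV"
  by (rule Ck_1I[OF DERIV_contr' continuous_on_dent'_shift])

lemma Ck_contr: "Ck_on 2 contr UNIV"
  by (rule Ck_2I[OF DERIV_contr Ck_contr'])

lemma Ck_inverse_contr': "Ck_on 1 (\<lambda>y. inverse (contr' y)) UNIV"
proof (rule Ck_1I)
  have nz: "contr' w \<noteq> 0" for w using contr'_bounds(1)[of w] by linarith
  have c: "continuous_on UNIV (\<lambda>w. inverse (contr' w))"
    using Ck_1_continuous[OF Ck_contr'] nz by (auto intro: continuous_on_inverse)
  show "((\<lambda>y. inverse (contr' y)) has_real_derivative
      - (inverse (contr' w) * (- dent' (w - 3) / 5) * inverse (contr' w))) (at w)" for w
    by (rule DERIV_inverse'[OF DERIV_contr' nz])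
  show "continuous_on UNIV
      (\<lambda>w. - (inverse (contr' w) * (- dent' (w - 3) / 5) * inverse (contr' w)))"
    by (intro continuous_on_minus continuous_on_mult c continuous_on_dent'_shift)
qed

text \<open>The regularity of the inverse is bootstrapped from \<open>expd' = 1 / (contr' \<circ> expd)\<close>.\<close>

lemma Ck_expd: "Ck_on 2 expd UNIV"
proof -
  have "continuous_on UNIV (\<lambda>x. inverse (contr' (expd x)))"
    by (rule continuous_on_compose2[OF Ck_1_continuous[OF Ck_inverse_contr']])
       (simp_all add: isCont_expd continuous_at_imp_continuous_on)
  then have "Ck_on 1 expd UNIV"
    by (rule Ck_1I[OF DERIV_expd])
  from Ck_2I[OF DERIV_expd Ck_compose[OF Ck_inverse_contr' this]] show ?thesis .
qed

end

section \<open>Addresses of points of a Cantor set\<close>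

context bump_heights
begin

definition branch :: "nat \<Rightarrow> real \<Rightarrow> real" where
  "branch d t = contr (t + offset d)"

lemma expd_branch [simp]: "expd (branch d t) = t + offset d"
  by (simp add: branch_def)

lemma branch_contracts: "\<bar>branch d s - branch d t\<bar> \<le> \<bar>s - t\<bar> / 5"
  using contr_contracts[of "s + offset d" "t + offset d"] by (simp add: branch_def)

lemma branch_0: "t \<le> 1 \<Longrightarrow> branch 0 t = t / 5"
  and branch_1: "t \<le> 1 \<Longrightarrow> branch (Suc 0) t = t / 5 - 3 / 5"
  by (simp_all add: branch_def offset_def contr_def sag_left diff_divide_distrib)

lemma branch_2:
  assumes "2 \<le> d" "\<bar>t\<bar> \<le> 1" shows "2/5 \<le> branch d t" "branch d t \<le> 4/5"
proof -
  have "branch d (-1) = 2/5"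
    using assms(1) by (simp add: branch_def offset_def contr_def sag_left)
  moreover have "branch d (-1) \<le> branch d t" "branch d t - branch d (-1) \<le> (t + 1) / 5"
    using contr_mono[of "-1 + offset d" "t + offset d"] contr_bounds(2)[of "-1 + offset d" "t + offset d"] assms(2)
    by (auto simp: branch_def)
  ultimately show "2/5 \<le> branch d t" "branch d t \<le> 4/5"
    using assms(2) by auto
qed

lemma branch_bound:
  assumes "\<bar>t\<bar> \<le> 1" shows "\<bar>branch d t\<bar> \<le> 4/5"
proof -
  consider "d = 0" | "d = Suc 0" | "2 \<le> d" by linarith
  then show ?thesis
  proof cases
    case 1
    then have "branch d t = t / 5" using assms by (simp add: branch_0)
    then show ?thesis using assms by linarith
  next
    case 2
    then have "branch d t = t / 5 - 3 / 5" using assms by (simp add: branch_1)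
    then show ?thesis using assms by linarith
  next
    case 3
    then show ?thesis using branch_2[OF 3 assms] by linarith
  qed
qed

lemma branch_eqD:
  assumes "branch d s = branch e t" "\<bar>s\<bar> \<le> 1" "\<bar>t\<bar> \<le> 1" "d < 3" "e < 3"
  shows "d = e \<and> s = t"
proof -
  have "s + offset d = t + offset e"
    using assms(1) by (metis expd_branch)
  then show ?thesis using assms(2-5) by (auto simp: offset_def split: if_splits)
qed

primrec approx :: "nat \<Rightarrow> (nat \<Rightarrow> nat) \<Rightarrow> real" where
  "approx 0 \<omega> = 0"
| "approx (Suc n) \<omega> = branch (\<omega> 0) (approx n (\<lambda>k. \<omega> (Suc k)))"

definition addr :: "(nat \<Rightarrow> nat) \<Rightarrow> real" where
  "addr \<omega> = lim (\<lambda>n. approx n \<omega>)"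

lemma approx_bound: "\<bar>approx n \<omega>\<bar> \<le> 4/5"
proof (induction n arbitrary: \<omega>)
  case (Suc n)
  have "\<bar>approx n (\<lambda>k. \<omega> (Suc k))\<bar> \<le> 1" using Suc[of "\<lambda>k. \<omega> (Suc k)"] by linarith
  then show ?case unfolding approx.simps by (rule branch_bound)
qed simp

text \<open>Each branch contracts by the factor \<open>5\<close>, so an error at the far end of a backward orbit is
  forgotten.\<close>

lemma approx_shadow:
  assumes "\<And>n. \<bar>x n\<bar> \<le> 1" "\<And>n. x n = branch (\<omega> n) (x (Suc n))"
  shows "\<bar>x 0 - approx n \<omega>\<bar> \<le> (1/5) ^ n"
  using assms
proof (induction n arbitrary: x \<omega>)
  case 0
  show ?case using 0(1)[of 0] by simp
next
  case (Suc n)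
  have IH: "\<bar>x (Suc 0) - approx n (\<lambda>k. \<omega> (Suc k))\<bar> \<le> (1/5) ^ n"
    by (rule Suc.IH[of "\<lambda>n. x (Suc n)" "\<lambda>k. \<omega> (Suc k)"]) (rule Suc.prems)+
  have "\<bar>x 0 - approx (Suc n) \<omega>\<bar> \<le> \<bar>x (Suc 0) - approx n (\<lambda>k. \<omega> (Suc k))\<bar> / 5"
    using branch_contracts[of "\<omega> 0" "x (Suc 0)" "approx n (\<lambda>k. \<omega> (Suc k))"] Suc.prems(2)[of 0] by simp
  with IH show ?case by simp
qed

lemma approx_cauchy: "\<bar>approx (n + m) \<omega> - approx n \<omega>\<bar> \<le> (1/5) ^ n"
proof (induction n arbitrary: \<omega>)
  case 0
  then show ?case using approx_bound[of m \<omega>] by simp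
next
  case (Suc n)
  have "\<bar>approx (Suc n + m) \<omega> - approx (Suc n) \<omega>\<bar>
      \<le> \<bar>approx (n + m) (\<lambda>k. \<omega> (Suc k)) - approx n (\<lambda>k. \<omega> (Suc k))\<bar> / 5"
    unfolding add_Suc approx.simps by (rule branch_contracts)
  then show ?case using Suc[of "\<lambda>k. \<omega> (Suc k)"] by simp
qed

lemma approx_tendsto: "(\<lambda>n. approx n \<omega>) \<longlonglongrightarrow> addr \<omega>"
proof -
  have "Cauchy (\<lambda>n. approx n \<omega>)"
  proof (rule CauchyI')
    fix e :: real assume "e > 0"
    then obtain M where M: "(1/5::real) ^ M < e"
      using real_arch_pow_inv[of e "1/5"] by auto
    show "\<exists>M. \<forall>m\<ge>M. \<forall>n>m. dist (approx m \<omega>) (approx n \<omega>) < e"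
    proof (intro exI[of _ M] allI impI)
      fix m n assume "M \<le> m" "m < n"
      have "dist (approx m \<omega>) (approx n \<omega>) \<le> (1/5) ^ m"
        using approx_cauchy[of m "n - m" \<omega>] \<open>m < n\<close> by (simp add: dist_real_def abs_minus_commute)
      also have "\<dots> \<le> (1/5) ^ M" using \<open>M \<le> m\<close> by (intro power_decreasing) auto
      finally show "dist (approx m \<omega>) (approx n \<omega>) < e" using M by linarith
    qed
  qed
  then show ?thesis
    unfolding addr_def by (simp add: Cauchy_convergent_iff convergent_LIMSEQ_iff)
qed

lemma addr_bound: "\<bar>addr \<omega>\<bar> \<le> 4/5"
  using LIMSEQ_le_const2[OF tendsto_rabs[OF approx_tendsto]] approx_bound by blast

lemma addr_le_1 [simp]: "\<bar>addr \<omega>\<bar> \<le> 1"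
  using addr_bound[of \<omega>] by linarith

lemma addr_le_1' [simp]: "addr \<omega> \<le> 1"
  using addr_bound[of \<omega>] by linarith

lemma addr_rec: "addr \<omega> = branch (\<omega> 0) (addr (\<lambda>k. \<omega> (Suc k)))"
proof -
  have "isCont contr t" for t using DERIV_contr DERIV_isCont by blast
  then have "(\<lambda>n. contr (approx n (\<lambda>k. \<omega> (Suc k)) + offset (\<omega> 0)))
      \<longlonglongrightarrow> contr (addr (\<lambda>k. \<omega> (Suc k)) + offset (\<omega> 0))"
    by (rule isCont_tendsto_compose[OF _ tendsto_add[OF approx_tendsto tendsto_const]])
  then have "(\<lambda>n. approx (Suc n) \<omega>) \<longlonglongrightarrow> branch (\<omega> 0) (addr (\<lambda>k. \<omega> (Suc k)))"
    by (simp add: branch_def)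
  moreover have "(\<lambda>n. approx (Suc n) \<omega>) \<longlonglongrightarrow> addr \<omega>"
    by (rule LIMSEQ_Suc[OF approx_tendsto])
  ultimately show ?thesis using LIMSEQ_unique by blast
qed

lemma addr_unique:
  assumes "\<And>n. \<bar>x n\<bar> \<le> 1" "\<And>n. x n = branch (\<omega> n) (x (Suc n))"
  shows "x 0 = addr \<omega>"
proof -
  have "(\<lambda>n. (1/5::real) ^ n) \<longlonglongrightarrow> 0" by (rule LIMSEQ_realpow_zero) auto
  moreover have "\<forall>n. \<bar>approx n \<omega> - x 0\<bar> \<le> (1/5) ^ n"
    using approx_shadow[of x \<omega>, OF assms] by (simp add: abs_minus_commute)
  ultimately have "(\<lambda>n. approx n \<omega> - x 0) \<longlonglongrightarrow> 0"
    by (intro Lim_null_comparison[of "\<lambda>n. approx n \<omega> - x 0" "\<lambda>n. (1/5) ^ n" sequentially])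
       (simp_all only: real_norm_def eventually_True)
  then have "(\<lambda>n. approx n \<omega>) \<longlonglongrightarrow> x 0" by (simp add: LIM_zero_iff)
  then show ?thesis using approx_tendsto LIMSEQ_unique by blast
qed

lemma addr_shift: "addr (\<lambda>k. \<omega> (n + k)) = branch (\<omega> n) (addr (\<lambda>k. \<omega> (Suc n + k)))"
  using addr_rec[of "\<lambda>k. \<omega> (n + k)"] by simp

lemma addr_agree:
  assumes "\<And>k. k < n \<Longrightarrow> \<omega> k = \<omega>' k"
  shows "\<bar>addr \<omega> - addr \<omega>'\<bar> \<le> 2 * (1/5) ^ n"
proof -
  have eq: "approx n \<omega> = approx n \<omega>'"
    using assms
  proof (induction n arbitrary: \<omega> \<omega>')
    case (Suc n)
    have "approx n (\<lambda>k. \<omega> (Suc k)) = approx n (\<lambda>k. \<omega>' (Suc k))"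
      by (rule Suc.IH) (simp add: Suc.prems)
    moreover have "\<omega> 0 = \<omega>' 0" by (simp add: Suc.prems)
    ultimately show ?case by simp
  qed simp
  have "\<bar>addr (\<lambda>k. \<omega> (0 + k)) - approx n \<omega>\<bar> \<le> (1/5) ^ n" for \<omega>
    by (rule approx_shadow[where x="\<lambda>n. addr (\<lambda>k. \<omega> (n + k))"]) (rule addr_le_1 addr_shift)+
  then have "\<bar>addr \<omega> - approx n \<omega>\<bar> \<le> (1/5) ^ n" for \<omega>
    by simp
  from this[of \<omega>] this[of \<omega>'] eq show ?thesis by linarith
qed

lemma addr_cong_min: "addr (\<lambda>k. min (\<omega> k) 2) = addr \<omega>"
proof -
  have *: "branch (min d 2) t = branch d t" for d t
    by (auto simp: branch_def offset_def min_def)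
  have "addr (\<lambda>k. \<omega> (0 + k)) = addr (\<lambda>k. min (\<omega> k) 2)"
    by (rule addr_unique[where x="\<lambda>n. addr (\<lambda>k. \<omega> (n + k))"]) (rule addr_le_1, unfold *, rule addr_shift)
  then show ?thesis by simp
qed

lemma addr_inj:
  assumes "addr \<omega> = addr \<omega>'" "\<And>k. \<omega> k < 3" "\<And>k. \<omega>' k < 3"
  shows "\<omega> n = \<omega>' n"
  using assms
proof (induction n arbitrary: \<omega> \<omega>')
  case 0
  have "branch (\<omega> 0) (addr (\<lambda>k. \<omega> (Suc k))) = branch (\<omega>' 0) (addr (\<lambda>k. \<omega>' (Suc k)))"
    using 0(1) addr_rec by metis
  then show ?case using branch_eqD 0 addr_le_1 by blast
next
  case (Suc n)
  have "branch (\<omega> 0) (addr (\<lambda>k. \<omega> (Suc k))) = branch (\<omega>' 0) (addr (\<lambda>k. \<omega>' (Suc k)))"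
    using Suc.prems(1) addr_rec by metis
  then have "addr (\<lambda>k. \<omega> (Suc k)) = addr (\<lambda>k. \<omega>' (Suc k))"
    using branch_eqD Suc.prems(2,3) addr_le_1 by blast
  from Suc.IH[OF this] Suc.prems(2,3) show ?case by blast
qed

lemma addr_zeros: "(\<And>k. k < n \<Longrightarrow> \<omega> k = 0) \<Longrightarrow> addr \<omega> = addr (\<lambda>k. \<omega> (n + k)) / 5 ^ n"
proof (induction n)
  case (Suc n)
  have "addr (\<lambda>k. \<omega> (n + k)) = addr (\<lambda>k. \<omega> (Suc n + k)) / 5"
    using addr_shift[of \<omega> n] Suc.prems[of n] by (simp add: branch_0)
  moreover have "addr \<omega> = addr (\<lambda>k. \<omega> (n + k)) / 5 ^ n"
    by (rule Suc.IH) (simp add: Suc.prems)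
  ultimately show ?case by (simp only: power_Suc divide_divide_eq_left)
qed simp

text \<open>The branch with digit \<open>0\<close> divides by \<open>5\<close>, so \<open>n\<close> leading zeros followed by a \<open>2\<close> put the address
  on the \<open>n\<close>-th plateau.\<close>

lemma dent_addr:
  assumes "\<And>k. k < n \<Longrightarrow> \<omega> k = 0" "\<omega> n = 2"
  shows "dent (addr \<omega>) = h n"
proof -
  have "addr \<omega> = addr (\<lambda>k. \<omega> (n + k)) / 5 ^ n"
    by (rule addr_zeros[OF assms(1)])
  moreover have "2/5 \<le> addr (\<lambda>k. \<omega> (n + k))" "addr (\<lambda>k. \<omega> (n + k)) \<le> 4/5"
    unfolding addr_shift[of \<omega> n] assms(2) by (rule branch_2; simp)+
  ultimately show ?thesis by (simp only: dent_plateau)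
qed

text \<open>An address whose first nonzero digit is \<open>1\<close> is negative, and all bumps lie on the positive
  side. This is the reason for placing the digit \<open>1\<close> to the left of the fixed point.\<close>

lemma dent_addr_0:
  assumes "\<And>k. \<omega> k < 3" "\<And>n. (\<And>k. k < n \<Longrightarrow> \<omega> k = 0) \<Longrightarrow> \<omega> n \<noteq> 2"
  shows "dent (addr \<omega>) = 0"
proof (cases "\<forall>k. \<omega> k = 0")
  case True
  then have zero: "0 = branch (\<omega> n) 0" for n by (simp add: branch_0)
  have "0 = addr \<omega>"
    by (rule addr_unique[where x="\<lambda>_. 0" and \<omega>=\<omega>]) (simp, rule zero)
  then have "addr \<omega> \<le> 0" by (rule eq_refl[OF sym])
  then show ?thesis by (rule dent_left)
next
  case False
  then have "\<exists>n. \<omega> n \<noteq> 0" by blast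
  then obtain n where n: "\<omega> n \<noteq> 0" "\<And>k. k < n \<Longrightarrow> \<omega> k = 0"
    using exists_least_iff[of "\<lambda>n. \<omega> n \<noteq> 0"] by blast
  have "\<omega> n \<noteq> 2" by (rule assms(2)) (rule n(2))
  with n(1) assms(1)[of n] have "\<omega> n = Suc 0" by linarith
  then have "addr (\<lambda>k. \<omega> (n + k)) = branch (Suc 0) (addr (\<lambda>k. \<omega> (Suc n + k)))"
    using addr_shift[of \<omega> n] by (simp only:)
  also have "\<dots> = addr (\<lambda>k. \<omega> (Suc n + k)) / 5 - 3 / 5"
    by (rule branch_1) simp
  also have "\<dots> \<le> 0"
    using addr_le_1'[of "\<lambda>k. \<omega> (Suc n + k)"] by linarith
  finally have "addr (\<lambda>k. \<omega> (n + k)) \<le> 0" .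
  moreover have "addr \<omega> = addr (\<lambda>k. \<omega> (n + k)) / 5 ^ n"
    by (rule addr_zeros[OF n(2)])
  ultimately have "addr \<omega> \<le> 0"
    by (simp add: divide_le_0_iff)
  then show ?thesis by (rule dent_left)
qed

lemma measurable_addr:
  assumes "\<And>k. (\<lambda>x. \<omega> x k) \<in> measurable M (count_space UNIV)"
  shows "(\<lambda>x. addr (\<omega> x)) \<in> borel_measurable M"
proof (rule borel_measurable_LIMSEQ_real)
  show "(\<lambda>n. approx n (\<omega> x)) \<longlonglongrightarrow> addr (\<omega> x)" for x by (rule approx_tendsto)
  show "(\<lambda>x. approx n (\<omega> x)) \<in> borel_measurable M" for n
    using assms
  proof (induction n arbitrary: \<omega>)
    case (Suc n)
    have "continuous_on UNIV contr"
      using DERIV_isCont[OF DERIV_contr] by (simp add: continuous_at_imp_continuous_on)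
    then have c: "contr \<in> borel_measurable borel" by (rule borel_measurable_continuous_onI)
    have "(\<lambda>x. approx n (\<lambda>k. \<omega> x (Suc k))) \<in> borel_measurable M"
      by (rule Suc.IH[of "\<lambda>x k. \<omega> x (Suc k)"]) (rule Suc.prems)
    moreover have "(\<lambda>x. offset (\<omega> x 0)) \<in> borel_measurable M"
      by (rule measurable_compose[OF Suc.prems]) simp
    ultimately have "(\<lambda>x. approx n (\<lambda>k. \<omega> x (Suc k)) + offset (\<omega> x 0)) \<in> borel_measurable M"
      by (rule borel_measurable_add)
    from measurable_compose[OF this c] show ?case by (simp add: branch_def)
  qed simp
qed

end

section \<open>A product horseshoe and its symbolic coding\<close>

locale horseshoe = u: bump_heights hu + s: bump_heights hs for hu hs
begin

text \<open>Stretch horizontally, lift the three pieces to different heights by a vertical shear, push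
  them back over each other by a horizontal shear, contract vertically. All four maps are
  diffeomorphisms of the plane, so no extension of a local map has to be constructed.\<close>

definition horse :: "plane \<Rightarrow> plane" where
  "horse p = (let w = u.expd (fst p); v = snd p + stair w in (w - stair v, s.contr v))"

definition horse_inv :: "plane \<Rightarrow> plane" where
  "horse_inv p = (let v = s.expd (snd p); w = fst p + stair v in (u.contr w, v - stair w))"

lemma horse_inv_horse [simp]: "horse_inv (horse p) = p"
  by (simp add: horse_def horse_inv_def Let_def)

lemma horse_horse_inv [simp]: "horse (horse_inv p) = p"
  by (simp add: horse_def horse_inv_def Let_def)

lemma bij_horse: "bij horse"
  by (rule bij_betw_byWitness[where f'=horse_inv]) auto

lemma inv_horse: "inv horse = horse_inv"
  by (rule inv_unique_comp) auto

lemma Ck_horse: "Ck_on 2 horse UNIV"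
proof -
  have w: "Ck_on 2 (\<lambda>p. u.expd (fst p)) UNIV"
    by (rule Ck_compose[OF u.Ck_expd Ck_bounded_linear[OF bounded_linear_fst]])
  have v: "Ck_on 2 (\<lambda>p. snd p + stair (u.expd (fst p))) UNIV"
    by (rule Ck_add[OF Ck_bounded_linear[OF bounded_linear_snd] Ck_compose[OF Ck_stair w]])
  from Ck_Pair[OF Ck_diff[OF w Ck_compose[OF Ck_stair v]] Ck_compose[OF s.Ck_contr v]]
  show ?thesis by (simp only: horse_def[abs_def] Let_def)
qed

lemma Ck_horse_inv: "Ck_on 2 horse_inv UNIV"
proof -
  have v: "Ck_on 2 (\<lambda>p. s.expd (snd p)) UNIV"
    by (rule Ck_compose[OF s.Ck_expd Ck_bounded_linear[OF bounded_linear_snd]])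
  have w: "Ck_on 2 (\<lambda>p. fst p + stair (s.expd (snd p))) UNIV"
    by (rule Ck_add[OF Ck_bounded_linear[OF bounded_linear_fst] Ck_compose[OF Ck_stair v]])
  from Ck_Pair[OF Ck_compose[OF u.Ck_contr w] Ck_diff[OF v Ck_compose[OF Ck_stair w]]]
  show ?thesis by (simp only: horse_inv_def[abs_def] Let_def)
qed

text \<open>On the strips both shears are locally translations, since \<open>stair'\<close> vanishes at the points in
  question; this makes the derivative diagonal.\<close>

lemma horse_has_derivative:
  assumes t: "u.expd (fst p) = t + offset d" "\<bar>t\<bar> \<le> 1" and y: "\<bar>snd p\<bar> \<le> 1"
  shows "(horse has_derivative (\<lambda>q. (inverse (u.contr' (t + offset d)) * fst q,
                                     s.contr' (snd p + offset d) * snd q))) (at p)"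
proof -
  have w: "((\<lambda>p. u.expd (fst p)) has_derivative (\<lambda>q. fst q * inverse (u.contr' (t + offset d)))) (at p)"
    using DERIV_compose_FDERIV[OF u.DERIV_expd has_derivative_fst[OF has_derivative_ident]] t(1) by metis
  have "((\<lambda>p. snd p + stair (u.expd (fst p))) has_derivative
      (\<lambda>q. snd q + (fst q * inverse (u.contr' (t + offset d))) * stair' (u.expd (fst p)))) (at p)"
    by (rule has_derivative_add[OF has_derivative_snd[OF has_derivative_ident] DERIV_compose_FDERIV[OF DERIV_stair w]])
  then have v: "((\<lambda>p. snd p + stair (u.expd (fst p))) has_derivative snd) (at p)"
    by (simp add: t stair'_offset)
  have v_eq: "snd p + stair (u.expd (fst p)) = snd p + offset d"
    by (simp add: t stair_offset)
  have "(horse has_derivative (\<lambda>q. (fst q * inverse (u.contr' (t + offset d))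
            - snd q * stair' (snd p + stair (u.expd (fst p))),
          snd q * s.contr' (snd p + stair (u.expd (fst p)))))) (at p)"
    unfolding horse_def[abs_def] Let_def
    by (rule has_derivative_Pair[OF has_derivative_diff[OF w DERIV_compose_FDERIV[OF DERIV_stair v]]
          DERIV_compose_FDERIV[OF s.DERIV_contr v]])
  then show ?thesis
    unfolding v_eq by (simp add: y stair'_offset mult.commute)
qed

text \<open>The product structure: the future of an itinerary determines the unstable coordinate, its past
  the stable one.\<close>

definition dec :: "(int \<Rightarrow> nat) \<Rightarrow> plane" where
  "dec \<omega> = (u.addr (\<lambda>k. \<omega> (int k)), s.addr (\<lambda>k. \<omega> (- 1 - int k)))"

definition \<Lambda> :: "plane set" where "\<Lambda> = range dec"

lemma expd_dec: "u.expd (fst (dec \<omega>)) = u.addr (\<lambda>k. \<omega> (int k + 1)) + offset (\<omega> 0)"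
proof -
  have "fst (dec \<omega>) = u.branch (\<omega> 0) (u.addr (\<lambda>k. \<omega> (int k + 1)))"
    using u.addr_rec[of "\<lambda>k. \<omega> (int k)"] by (simp add: dec_def add.commute)
  then show ?thesis by simp
qed

lemma dec_le_1: "\<bar>fst (dec \<omega>)\<bar> \<le> 1" "\<bar>snd (dec \<omega>)\<bar> \<le> 1"
  by (simp_all add: dec_def)

lemma horse_dec: "horse (dec \<omega>) = dec (left_shift \<omega>)"
proof -
  have "snd (dec (left_shift \<omega>)) = s.branch (\<omega> 0) (snd (dec \<omega>))"
    using s.addr_rec[of "\<lambda>k. left_shift \<omega> (- 1 - int k)"] by (simp add: dec_def left_shift_def)
  moreover have "fst (dec (left_shift \<omega>)) = u.addr (\<lambda>k. \<omega> (int k + 1))"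
    by (simp add: dec_def left_shift_def)
  moreover have "horse (dec \<omega>) = (u.addr (\<lambda>k. \<omega> (int k + 1)), s.branch (\<omega> 0) (snd (dec \<omega>)))"
    using dec_le_1(2)[of \<omega>] by (simp add: horse_def expd_dec Let_def stair_offset s.branch_def)
  ultimately show ?thesis by (simp add: prod_eq_iff)
qed

lemma horse_inv_dec: "horse_inv (dec \<omega>) = dec (\<lambda>k. \<omega> (k - 1))"
  using horse_dec[of "\<lambda>k. \<omega> (k - 1)"] horse_inv_horse[of "dec (\<lambda>k. \<omega> (k - 1))"]
  by (simp add: left_shift_def)

lemma horse_\<Lambda>: "z \<in> \<Lambda> \<Longrightarrow> horse z \<in> \<Lambda>" and horse_inv_\<Lambda>: "z \<in> \<Lambda> \<Longrightarrow> horse_inv z \<in> \<Lambda>"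
  unfolding \<Lambda>_def using horse_dec horse_inv_dec by auto

lemma horse_image_\<Lambda>: "horse ` \<Lambda> = \<Lambda>"
  using horse_\<Lambda> horse_inv_\<Lambda> by (auto intro: image_eqI[where x="horse_inv _"])

definition seqs :: "(int \<Rightarrow> nat) set" where "seqs = {\<omega>. \<forall>k. \<omega> k < 3}"

lemma dec_min: "dec (\<lambda>k. min (\<omega> k) 2) = dec \<omega>"
  using u.addr_cong_min[of "\<lambda>k. \<omega> (int k)"] s.addr_cong_min[of "\<lambda>k. \<omega> (- 1 - int k)"]
  by (simp add: dec_def)

lemma min_seqs: "(\<lambda>k. min (\<omega> k) 2) \<in> seqs"
  by (simp add: seqs_def min_def)

lemma dec_image_seqs: "dec ` seqs = \<Lambda>"
proof -
  have "dec \<omega> \<in> dec ` seqs" for \<omega>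
    using imageI[OF min_seqs, of dec \<omega>] by (simp only: dec_min)
  then show ?thesis unfolding \<Lambda>_def by blast
qed

lemma inj_on_dec: "inj_on dec seqs"
proof (rule inj_onI, rule ext)
  fix \<omega> \<omega>' k assume *: "\<omega> \<in> seqs" "\<omega>' \<in> seqs" "dec \<omega> = dec \<omega>'"
  show "\<omega> k = \<omega>' k"
  proof (cases "0 \<le> k")
    case True
    have "\<omega> (int (nat k)) = \<omega>' (int (nat k))"
      by (rule u.addr_inj[of "\<lambda>k. \<omega> (int k)" "\<lambda>k. \<omega>' (int k)"]) (use * in \<open>auto simp: dec_def seqs_def\<close>)
    then show ?thesis using True by simp
  next
    case False
    have "\<omega> (- 1 - int (nat (- 1 - k))) = \<omega>' (- 1 - int (nat (- 1 - k)))"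
      by (rule s.addr_inj[of "\<lambda>k. \<omega> (- 1 - int k)" "\<lambda>k. \<omega>' (- 1 - int k)"]) (use * in \<open>auto simp: dec_def seqs_def\<close>)
    then show ?thesis using False by simp
  qed
qed

definition code :: "plane \<Rightarrow> int \<Rightarrow> nat" where "code = inv_into seqs dec"

lemma dec_code [simp]:
  assumes "z \<in> \<Lambda>" shows "dec (code z) = z"
proof -
  have "z \<in> dec ` seqs" using assms by (simp only: dec_image_seqs)
  then show ?thesis unfolding code_def by (rule f_inv_into_f)
qed

lemma code_seqs: "z \<in> \<Lambda> \<Longrightarrow> code z \<in> seqs"
  unfolding code_def dec_image_seqs[symmetric] by (rule inv_into_into)

lemma code_dec: "\<omega> \<in> seqs \<Longrightarrow> code (dec \<omega>) = \<omega>"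
  unfolding code_def by (rule inv_into_f_f[OF inj_on_dec])

lemma code_horse: "z \<in> \<Lambda> \<Longrightarrow> code (horse z) = left_shift (code z)"
  using code_seqs[of z] horse_dec[of "code z"] code_dec[of "left_shift (code z)"]
  by (auto simp: seqs_def left_shift_def)

lemma dist_dec:
  assumes "\<And>k. - int n \<le> k \<Longrightarrow> k < int n \<Longrightarrow> \<omega> k = \<omega>' k"
  shows "dist (dec \<omega>) (dec \<omega>') \<le> 4 * (1/5) ^ n"
proof -
  have "\<bar>fst (dec \<omega>) - fst (dec \<omega>')\<bar> \<le> 2 * (1/5) ^ n"
    unfolding dec_def fst_conv by (rule u.addr_agree) (simp add: assms)
  moreover have "\<bar>snd (dec \<omega>) - snd (dec \<omega>')\<bar> \<le> 2 * (1/5) ^ n"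
    unfolding dec_def snd_conv by (rule s.addr_agree) (simp add: assms)
  moreover have "dist (dec \<omega>) (dec \<omega>') \<le> \<bar>fst (dec \<omega>) - fst (dec \<omega>')\<bar> + \<bar>snd (dec \<omega>) - snd (dec \<omega>')\<bar>"
    unfolding dist_prod_def dist_real_def
    using sqrt_sum_squares_le_sum_abs[of "fst (dec \<omega>) - fst (dec \<omega>')" "snd (dec \<omega>) - snd (dec \<omega>')"] by simp
  ultimately show ?thesis by linarith
qed

text \<open>Agreement on a long central block of digits forces two points to be close.\<close>

lemma cylinder_neighbourhood:
  assumes "open U" "dec \<omega> \<in> U"
  obtains n where "\<And>\<omega>'. (\<And>k. - int n \<le> k \<Longrightarrow> k < int n \<Longrightarrow> \<omega>' k = \<omega> k) \<Longrightarrow> dec \<omega>' \<in> U"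
proof -
  obtain e where e: "e > 0" "ball (dec \<omega>) e \<subseteq> U"
    using assms open_contains_ball by blast
  obtain n where n: "(1/5::real) ^ n < e / 4"
    using real_arch_pow_inv[of "e / 4" "1/5"] e(1) by auto
  show ?thesis
  proof (rule that[of n])
    fix \<omega>' assume "\<And>k. - int n \<le> k \<Longrightarrow> k < int n \<Longrightarrow> \<omega>' k = \<omega> k"
    then have "dist (dec \<omega>) (dec \<omega>') \<le> 4 * (1/5) ^ n"
      by (intro dist_dec) simp
    with n have "dec \<omega>' \<in> ball (dec \<omega>) e" by simp
    then show "dec \<omega>' \<in> U" using e(2) by blast
  qed
qed

lemma topspace_full_shift: "topspace (full_shift 3) = seqs"
  by (auto simp: full_shift_def seqs_def PiE_def Pi_def)

lemma openin_full_shift_cylinder: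
  assumes "finite K" shows "openin (full_shift 3) {\<omega> \<in> seqs. \<forall>k\<in>K. \<omega> k = \<omega>0 k}"
proof -
  have "openin (full_shift 3) {\<omega> \<in> seqs. \<omega> k = a}" for k a
  proof -
    have "continuous_map (full_shift 3) (discrete_topology {..<3}) (\<lambda>\<omega>. \<omega> k)"
      unfolding full_shift_def by (rule continuous_map_product_projection) simp
    from openin_continuous_map_preimage[OF this, of "{a} \<inter> {..<3}"]
    show ?thesis
      unfolding topspace_full_shift
      by (rule back_subst) (auto simp: seqs_def)
  qed
  then have "openin (full_shift 3) (\<Inter> ((\<lambda>k. {\<omega> \<in> seqs. \<omega> k = \<omega>0 k}) ` K) \<inter> topspace (full_shift 3))"
    using assms by (cases "K = {}") auto
  then show ?thesis
    unfolding topspace_full_shift by (rule back_subst) auto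
qed

lemma continuous_map_dec: "continuous_map (full_shift 3) (top_of_set \<Lambda>) dec"
proof -
  have "openin (full_shift 3) {\<omega> \<in> seqs. dec \<omega> \<in> U}" if U: "open U" for U
  proof (subst openin_subopen, safe)
    fix \<omega> assume "\<omega> \<in> seqs" "dec \<omega> \<in> U"
    then obtain n where n: "\<And>\<omega>'. (\<And>k. - int n \<le> k \<Longrightarrow> k < int n \<Longrightarrow> \<omega>' k = \<omega> k) \<Longrightarrow> dec \<omega>' \<in> U"
      using cylinder_neighbourhood[OF U] by blast
    show "\<exists>T. openin (full_shift 3) T \<and> \<omega> \<in> T \<and> T \<subseteq> {\<omega> \<in> seqs. dec \<omega> \<in> U}"
    proof (intro exI conjI)
      show "openin (full_shift 3) {\<omega>' \<in> seqs. \<forall>k\<in>{- int n..<int n}. \<omega>' k = \<omega> k}"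
        by (rule openin_full_shift_cylinder) simp
      show "\<omega> \<in> {\<omega>' \<in> seqs. \<forall>k\<in>{- int n..<int n}. \<omega>' k = \<omega> k}" using \<open>\<omega> \<in> seqs\<close> by simp
      show "{\<omega>' \<in> seqs. \<forall>k\<in>{- int n..<int n}. \<omega>' k = \<omega> k} \<subseteq> {\<omega> \<in> seqs. dec \<omega> \<in> U}"
        using n by auto
    qed
  qed
  then show ?thesis
    unfolding continuous_map_in_subtopology
    using dec_image_seqs by (auto simp: continuous_map topspace_full_shift \<Lambda>_def)
qed

lemma homeomorphic_map_dec: "homeomorphic_map (full_shift 3) (top_of_set \<Lambda>) dec"
proof (rule continuous_imp_homeomorphic_map[OF continuous_map_dec])
  show "compact_space (full_shift 3)"
    unfolding full_shift_def
    by (rule compact_space_product_topology[THEN iffD2, OF disjI2])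
       (simp add: compact_space_discrete_topology)
  show "Hausdorff_space (top_of_set \<Lambda>)"
    by (rule Hausdorff_space_subtopology[OF Hausdorff_space_euclidean])
  show "dec ` topspace (full_shift 3) = topspace (top_of_set \<Lambda>)"
    by (simp only: topspace_full_shift dec_image_seqs topspace_euclidean_subtopology)
  show "inj_on dec (topspace (full_shift 3))"
    by (simp only: topspace_full_shift inj_on_dec)
qed

lemma homeomorphic_maps_dec_code: "homeomorphic_maps (full_shift 3) (top_of_set \<Lambda>) dec code"
proof -
  obtain g where g: "homeomorphic_maps (full_shift 3) (top_of_set \<Lambda>) dec g"
    using homeomorphic_map_dec homeomorphic_map_maps by blast
  have "g z = code z" if "z \<in> \<Lambda>" for z
    using g that code_dec dec_code code_seqs unfolding homeomorphic_maps_def topspace_full_shift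
    by metis
  then show ?thesis
    using homeomorphic_maps_eq[OF g, of dec code] by simp
qed

lemma topologically_conjugate_full_shift:
  "topologically_conjugate (top_of_set \<Lambda>) horse (full_shift 3) left_shift"
  unfolding topologically_conjugate_def
  using homeomorphic_maps_dec_code code_horse by (auto simp: homeomorphic_maps_map)

lemma openin_code_cylinder: "openin (top_of_set \<Lambda>) {z \<in> \<Lambda>. code z k = a}"
proof -
  have "continuous_map (top_of_set \<Lambda>) (full_shift 3) code"
    using homeomorphic_maps_dec_code by (simp add: homeomorphic_maps_def)
  from openin_continuous_map_preimage[OF this openin_full_shift_cylinder[of "{k}" "\<lambda>_. a"]]
  show ?thesis
    by (rule back_subst) (auto simp: code_seqs)
qed

lemma compactin_\<Lambda>: "compactin euclidean \<Lambda>"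
proof -
  have "compact_space (full_shift 3)"
    unfolding full_shift_def
    by (rule compact_space_product_topology[THEN iffD2, OF disjI2])
       (simp add: compact_space_discrete_topology)
  then have "compact_space (top_of_set \<Lambda>)"
    using homeomorphic_map_dec homeomorphic_compact_space homeomorphic_map_imp_homeomorphic_space by blast
  then show ?thesis unfolding compactin_subspace by simp
qed

end

section \<open>Local maximality, mixing and derivatives along orbits\<close>

context horseshoe
begin

definition strips :: "plane set" where
  "strips = {p. \<exists>d<3. \<bar>u.expd (fst p) - offset d\<bar> < 1 \<and> \<bar>snd p\<bar> < 1}"

lemma open_strips: "open strips"
proof -
  have e: "continuous_on UNIV (\<lambda>p::plane. u.expd (fst p))"
    by (rule continuous_on_compose2[of UNIV u.expd])
       (auto intro: continuous_at_imp_continuous_on u.isCont_expd continuous_on_fst)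
  have "open {p::plane. \<bar>u.expd (fst p) - offset d\<bar> < 1}" for d
    by (intro open_Collect_less continuous_on_rabs continuous_on_diff e continuous_on_const)
  moreover have "open {p::plane. \<bar>snd p\<bar> < 1}"
    by (intro open_Collect_less continuous_on_rabs continuous_on_snd continuous_on_id continuous_on_const)
  ultimately have "open (\<Union>d\<in>{..<3::nat}. {p::plane. \<bar>u.expd (fst p) - offset d\<bar> < 1} \<inter> {p. \<bar>snd p\<bar> < 1})"
    by (intro open_UN ballI open_Int)
  then show ?thesis
    by (rule back_subst) (auto simp: strips_def)
qed

lemma \<Lambda>_strips: "\<Lambda> \<subseteq> strips"
proof
  fix z assume "z \<in> \<Lambda>"
  then obtain \<omega> where w: "\<omega> \<in> seqs" "z = dec \<omega>"
    using dec_image_seqs by blast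
  have "\<bar>u.addr (\<lambda>k. \<omega> (int k + 1))\<bar> < 1" "\<bar>snd z\<bar> < 1"
    using u.addr_bound[of "\<lambda>k. \<omega> (int k + 1)"] s.addr_bound[of "\<lambda>k. \<omega> (- 1 - int k)"]
    by (auto simp: w(2) dec_def)
  moreover have "\<omega> 0 < 3" using w(1) by (simp add: seqs_def)
  ultimately show "z \<in> strips"
    unfolding strips_def by (auto simp: w(2) expd_dec)
qed

lemma horse_funpow_\<Lambda>: "z \<in> \<Lambda> \<Longrightarrow> (horse ^^ n) z \<in> \<Lambda>"
  and horse_inv_funpow_\<Lambda>: "z \<in> \<Lambda> \<Longrightarrow> (horse_inv ^^ n) z \<in> \<Lambda>"
  by (induction n) (auto simp: horse_\<Lambda> horse_inv_\<Lambda>)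

text \<open>An orbit that never leaves the strips is coded by the strips which it visits, and both of
  its coordinates are then determined by contraction.\<close>

lemma orbit_in_strips:
  assumes "\<And>k::int. x k \<in> strips" "\<And>k. x (k + 1) = horse (x k)"
  shows "x 0 \<in> \<Lambda>"
proof -
  have "\<forall>k. \<exists>d<3. \<bar>u.expd (fst (x k)) - offset d\<bar> < 1"
    using assms(1) by (auto simp: strips_def)
  then obtain d where d: "\<And>k. d k < 3" "\<And>k. \<bar>u.expd (fst (x k)) - offset (d k)\<bar> < 1"
    by metis
  have y: "\<bar>snd (x k)\<bar> < 1" for k using assms(1)[of k] by (auto simp: strips_def)
  define t where "t k = u.expd (fst (x k)) - offset (d k)" for k
  have w: "u.expd (fst (x k)) = t k + offset (d k)" and t: "\<bar>t k\<bar> \<le> 1" for k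
    using d(2)[of k] by (auto simp: t_def)
  have "horse (x k) = (t k, s.branch (d k) (snd (x k)))" for k
    using y[of k] by (simp add: horse_def Let_def w stair_offset t s.branch_def)
  then have step: "fst (x (k + 1)) = t k" "snd (x (k + 1)) = s.branch (d k) (snd (x k))" for k
    by (simp_all add: assms(2))
  have x_eq: "fst (x k) = u.branch (d k) (fst (x (k + 1)))" for k
    using w[of k] u.contr_expd[of "fst (x k)"] by (simp add: step u.branch_def)
  have "fst (x (int 0)) = u.addr (\<lambda>k. d (int k))"
  proof (rule u.addr_unique[where x="\<lambda>n. fst (x (int n))"])
    show "\<bar>fst (x (int n))\<bar> \<le> 1" for n
      using step(1)[of "int n - 1"] t[of "int n - 1"] by simp
    show "fst (x (int n)) = u.branch (d (int n)) (fst (x (int (Suc n))))" for n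
      using x_eq[of "int n"] by (simp add: add.commute)
  qed
  moreover have "snd (x (- int 0)) = s.addr (\<lambda>k. d (- 1 - int k))"
  proof (rule s.addr_unique[where x="\<lambda>n. snd (x (- int n))"])
    show "\<bar>snd (x (- int n))\<bar> \<le> 1" for n using y[of "- int n"] by simp
    show "snd (x (- int n)) = s.branch (d (- 1 - int n)) (snd (x (- int (Suc n))))" for n
      using step(2)[of "- 1 - int n"] by (simp add: algebra_simps)
  qed
  ultimately have "x 0 = dec d" by (simp add: dec_def prod_eq_iff)
  then show ?thesis by (simp add: \<Lambda>_def)
qed

lemma locally_maximal_\<Lambda>: "locally_maximal euclidean horse \<Lambda>"
  unfolding locally_maximal_def
proof (intro exI conjI)
  show "openin euclidean strips" using open_strips by simp
  show "\<Lambda> \<subseteq> strips" by (rule \<Lambda>_strips)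
  show "\<Lambda> = {x \<in> topspace euclidean. \<forall>n. (horse ^^ n) x \<in> strips \<and> (inv_into (topspace euclidean) horse ^^ n) x \<in> strips}"
    (is "_ = ?R")
  proof
    show "\<Lambda> \<subseteq> ?R"
      using horse_funpow_\<Lambda> horse_inv_funpow_\<Lambda> \<Lambda>_strips by (auto simp: inv_horse)
    show "?R \<subseteq> \<Lambda>"
    proof
      fix z assume "z \<in> ?R"
      then have z: "(horse ^^ n) z \<in> strips" "(horse_inv ^^ n) z \<in> strips" for n
        by (auto simp: inv_horse)
      define x where "x k = (if 0 \<le> k then (horse ^^ nat k) z else (horse_inv ^^ nat (- k)) z)" for k :: int
      have "x 0 \<in> \<Lambda>"
      proof (rule orbit_in_strips)
        show "x k \<in> strips" for k using z by (simp add: x_def)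
        show "x (k + 1) = horse (x k)" for k
        proof (cases "0 \<le> k")
          case True
          then have "nat (k + 1) = Suc (nat k)" by simp
          then show ?thesis using True by (simp add: x_def)
        next
          case False
          define n where "n = nat (- k - 1)"
          have k: "- k = int (Suc n)" "k + 1 = - int n" using False by (simp_all add: n_def)
          have "x k = (horse_inv ^^ Suc n) z"
            using False by (simp only: x_def k(1) nat_int if_False)
          then have "x k = horse_inv ((horse_inv ^^ n) z)" by simp
          moreover have "x (k + 1) = (horse_inv ^^ n) z"
            unfolding k(2) by (cases "n = 0") (simp_all add: x_def)
          ultimately show ?thesis by simp
        qed
      qed
      then show "z \<in> \<Lambda>" by (simp add: x_def)
    qed
  qed
qed

lemma horse_funpow_dec: "(horse ^^ n) (dec \<omega>) = dec (\<lambda>k. \<omega> (k + int n))"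
proof (induction n)
  case (Suc n)
  then show ?case by (simp add: horse_dec left_shift_def algebra_simps)
qed simp

text \<open>The itinerary of a point of the first set is spliced with a far translate of the itinerary
  of a point of the second one.\<close>

lemma topologically_mixing_horse: "topologically_mixing (top_of_set \<Lambda>) horse"
  unfolding topologically_mixing_def
proof (intro allI impI, elim conjE)
  fix U V assume U: "openin (top_of_set \<Lambda>) U" "U \<noteq> {}" and V: "openin (top_of_set \<Lambda>) V" "V \<noteq> {}"
  have *: "\<exists>\<omega> n. \<forall>\<omega>'. (\<forall>k. - int n \<le> k \<and> k < int n \<longrightarrow> \<omega>' k = \<omega> k) \<longrightarrow> dec \<omega>' \<in> W"
    if W: "openin (top_of_set \<Lambda>) W" "W \<noteq> {}" for W
  proof -
    obtain W' where W': "open W'" "W = \<Lambda> \<inter> W'" using W(1) by (auto simp: openin_open)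
    obtain \<omega> where w: "dec \<omega> \<in> W'" using W(2) W'(2) by (auto simp: \<Lambda>_def)
    obtain n where n: "\<And>\<omega>'. (\<And>k. - int n \<le> k \<Longrightarrow> k < int n \<Longrightarrow> \<omega>' k = \<omega> k) \<Longrightarrow> dec \<omega>' \<in> W'"
      using cylinder_neighbourhood[OF W'(1) w] by blast
    show ?thesis
    proof (intro exI allI impI)
      fix \<omega>' assume "\<forall>k. - int n \<le> k \<and> k < int n \<longrightarrow> \<omega>' k = \<omega> k"
      then have "dec \<omega>' \<in> W'" by (intro n) simp
      then show "dec \<omega>' \<in> W" by (simp add: W'(2) \<Lambda>_def)
    qed
  qed
  obtain \<omega> n where n: "\<And>\<omega>'. (\<forall>k. - int n \<le> k \<and> k < int n \<longrightarrow> \<omega>' k = \<omega> k) \<Longrightarrow> dec \<omega>' \<in> U"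
    using *[OF U] by blast
  obtain \<eta> m where m: "\<And>\<omega>'. (\<forall>k. - int m \<le> k \<and> k < int m \<longrightarrow> \<omega>' k = \<eta> k) \<Longrightarrow> dec \<omega>' \<in> V"
    using *[OF V] by blast
  show "\<exists>N. \<forall>j\<ge>N. (horse ^^ j) ` U \<inter> V \<noteq> {}"
  proof (intro exI allI impI)
    fix j assume j: "n + m \<le> j"
    define \<zeta> where "\<zeta> k = (if k < int n then \<omega> k else \<eta> (k - int j))" for k
    have "dec \<zeta> \<in> U" by (rule n) (simp add: \<zeta>_def)
    moreover have "(horse ^^ j) (dec \<zeta>) \<in> V"
      unfolding horse_funpow_dec by (rule m) (use j in \<open>auto simp: \<zeta>_def\<close>)
    ultimately show "(horse ^^ j) ` U \<inter> V \<noteq> {}" by blast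
  qed
qed

definition expansion :: "plane \<Rightarrow> real" where
  "expansion z = inverse (u.contr' (u.expd (fst z)))"

definition contraction :: "plane \<Rightarrow> real" where
  "contraction z = s.contr' (snd z + offset (code z 0))"

lemma expansion_ge: "5 \<le> expansion z"
  using le_imp_inverse_le[of "u.contr' (u.expd (fst z))" "1/5"]
    u.contr'_bounds[of "u.expd (fst z)"] by (simp add: expansion_def)

lemma contraction_bounds: "0 < contraction z" "contraction z \<le> 1/5"
  using s.contr'_bounds[of "snd z + offset (code z 0)"] by (auto simp: contraction_def)

lemma horse_derivative_\<Lambda>:
  assumes "z \<in> \<Lambda>"
  shows "(horse has_derivative (\<lambda>q. (expansion z * fst q, contraction z * snd q))) (at z)"
proof -
  have e: "u.expd (fst z) = u.addr (\<lambda>k. code z (int k + 1)) + offset (code z 0)"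
    using expd_dec[of "code z"] assms by simp
  have "\<bar>snd z\<bar> \<le> 1" using dec_le_1(2)[of "code z"] assms by simp
  from horse_has_derivative[OF e u.addr_le_1 this] show ?thesis
    by (simp add: expansion_def contraction_def e)
qed

lemma horse_inv_derivative_\<Lambda>:
  assumes "z \<in> \<Lambda>"
  shows "(horse_inv has_derivative
    (\<lambda>q. (inverse (expansion (horse_inv z)) * fst q, inverse (contraction (horse_inv z)) * snd q))) (at z)"
proof -
  have "expansion (horse_inv z) \<noteq> 0" "contraction (horse_inv z) \<noteq> 0"
    using expansion_ge[of "horse_inv z"] contraction_bounds(1)[of "horse_inv z"] by auto
  then have bij: "(\<lambda>q. (inverse (expansion (horse_inv z)) * fst q, inverse (contraction (horse_inv z)) * snd q))
      \<circ> (\<lambda>q. (expansion (horse_inv z) * fst q, contraction (horse_inv z) * snd q)) = id"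
    by (auto simp: fun_eq_iff)
  have cont: "continuous_on UNIV horse_inv"
    using Ck_Suc_imp[of 0 horse_inv] Ck_Suc_imp[of 1 horse_inv] Ck_horse_inv
    by (simp only: One_nat_def numeral_2_eq_2 Ck_on.simps(1))
  show ?thesis
  proof (rule has_derivative_inverse_basic[where f=horse and g=horse_inv and y=z and T=UNIV,
        OF horse_derivative_\<Lambda>[OF horse_inv_\<Lambda>[OF assms]] _ bij])
    show "bounded_linear (\<lambda>q::plane. (inverse (expansion (horse_inv z)) * fst q,
        inverse (contraction (horse_inv z)) * snd q))"
      by (intro bounded_linear_Pair bounded_linear_mult_const bounded_linear_const_mult
          bounded_linear_fst bounded_linear_snd)
    show "continuous (at z) horse_inv" using continuous_on_interior[OF cont, of z] by simp
  qed auto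
qed

lemma horse_funpow_derivative:
  assumes "z \<in> \<Lambda>"
  shows "\<exists>a c. \<bar>c\<bar> \<le> (1/5) ^ n \<and> ((horse ^^ n) has_derivative (\<lambda>q. (a * fst q, c * snd q))) (at z)"
proof (induction n)
  case 0
  have "((\<lambda>q. q) has_derivative (\<lambda>q. (1 * fst q, 1 * snd q))) (at z)" by simp
  then show ?case by (intro exI[of _ 1]) (simp add: id_def)
next
  case (Suc n)
  then obtain a c where ac: "\<bar>c\<bar> \<le> (1/5) ^ n" "((horse ^^ n) has_derivative (\<lambda>q. (a * fst q, c * snd q))) (at z)"
    by blast
  let ?y = "(horse ^^ n) z"
  have "((\<lambda>x. horse ((horse ^^ n) x)) has_derivative
      (\<lambda>q. ((expansion ?y * a) * fst q, (contraction ?y * c) * snd q))) (at z)"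
    using has_derivative_compose[OF ac(2) horse_derivative_\<Lambda>[OF horse_funpow_\<Lambda>[OF assms, of n]]]
    by (simp add: mult.assoc)
  moreover have "\<bar>contraction ?y * c\<bar> \<le> (1/5) ^ Suc n"
    using mult_mono[of "\<bar>contraction ?y\<bar>" "1/5" "\<bar>c\<bar>" "(1/5) ^ n"] contraction_bounds[of ?y] ac(1)
    by (simp add: abs_mult)
  ultimately show ?case by (auto simp: o_def)
qed

lemma horse_inv_funpow_derivative:
  assumes "z \<in> \<Lambda>"
  shows "\<exists>a c. \<bar>a\<bar> \<le> (1/5) ^ n \<and> ((horse_inv ^^ n) has_derivative (\<lambda>q. (a * fst q, c * snd q))) (at z)"
proof (induction n)
  case 0
  have "((\<lambda>q. q) has_derivative (\<lambda>q. (1 * fst q, 1 * snd q))) (at z)" by simp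
  then show ?case by (intro exI[of _ 1]) (simp add: id_def)
next
  case (Suc n)
  then obtain a c where ac: "\<bar>a\<bar> \<le> (1/5) ^ n" "((horse_inv ^^ n) has_derivative (\<lambda>q. (a * fst q, c * snd q))) (at z)"
    by blast
  let ?y = "horse_inv ((horse_inv ^^ n) z)"
  have "((\<lambda>x. horse_inv ((horse_inv ^^ n) x)) has_derivative
      (\<lambda>q. ((inverse (expansion ?y) * a) * fst q, (inverse (contraction ?y) * c) * snd q))) (at z)"
    using has_derivative_compose[OF ac(2) horse_inv_derivative_\<Lambda>[OF horse_inv_funpow_\<Lambda>[OF assms, of n]]]
    by (simp add: mult.assoc)
  moreover have "\<bar>inverse (expansion ?y) * a\<bar> \<le> (1/5) ^ Suc n"
    using mult_mono[of "\<bar>inverse (expansion ?y)\<bar>" "1/5" "\<bar>a\<bar>" "(1/5) ^ n"]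
      le_imp_inverse_le[OF expansion_ge[of ?y]] expansion_ge[of ?y] ac(1)
    by (simp add: abs_mult)
  ultimately show ?case by (auto simp: o_def)
qed

end

section \<open>Blocks \<open>2 0\<^sup>n 2\<close> and the geometric potentials\<close>

definition gap :: "nat \<Rightarrow> int \<Rightarrow> (int \<Rightarrow> nat) \<Rightarrow> bool" where
  "gap n i \<omega> \<longleftrightarrow> \<omega> i = 2 \<and> (\<forall>k. i < k \<and> k \<le> i + int n \<longrightarrow> \<omega> k = 0) \<and> \<omega> (i + int n + 1) = 2"

definition plane_atlas :: "plane chart set" where "plane_atlas = {(UNIV, id)}"

definition plane_metric :: "plane \<Rightarrow> plane \<Rightarrow> plane \<Rightarrow> real" where
  "plane_metric p v w = v \<bullet> w"

lemma chart_at_plane [simp]: "chart_at plane_atlas p = (UNIV, id)"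
  unfolding chart_at_def plane_atlas_def by (rule some_equality) auto

lemma in_charts_plane [simp]: "in_charts (UNIV, id) (UNIV, id) F = F"
  by (simp add: in_charts_def)

lemma in_charts_dom_plane [simp]: "in_charts_dom (UNIV, id) (UNIV, id) F = UNIV"
  by (simp add: in_charts_dom_def)

lemma tangent_map_plane: "tangent_map plane_atlas F p = frechet_derivative F (at p)"
  by (simp add: tangent_map_def)

lemma rnorm_plane: "rnorm plane_metric p v = norm v"
  by (simp add: rnorm_def plane_metric_def norm_eq_sqrt_inner)

lemma smooth_surface_plane: "smooth_surface (euclidean :: plane topology) plane_atlas"
proof -
  have "second_countable (euclidean :: plane topology)"
  proof -
    obtain B :: "plane set set" where B: "countable B" "\<And>C. C \<in> B \<Longrightarrow> open C"
      "\<And>S. open S \<Longrightarrow> \<exists>U. U \<subseteq> B \<and> S = \<Union>U"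
      by (rule univ_second_countable) blast
    have "\<exists>V\<in>B. x \<in> V \<and> V \<subseteq> S" if "open S" "x \<in> S" for S x
      using B(3)[OF that(1)] that(2) by blast
    with B(1,2) show ?thesis
      by (auto simp: second_countable_def intro!: exI[of _ B])
  qed
  moreover have "is_chart (euclidean :: plane topology) (UNIV, id)"
    by (simp add: is_chart_def)
  moreover have "Ck_on k (id :: plane \<Rightarrow> plane) UNIV" for k
    unfolding id_def by (rule Ck_bounded_linear[OF bounded_linear_ident])
  ultimately show ?thesis
    by (simp add: smooth_surface_def Hausdorff_space_euclidean plane_atlas_def)
qed

lemma riemannian_metric_plane: "riemannian_metric euclidean plane_atlas plane_metric"
proof -
  have "bilinear (plane_metric p)" for p
    unfolding plane_metric_def[abs_def]
    by (auto simp: bilinear_def linear_iff algebra_simps)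
  moreover have "Ck_on k (\<lambda>x. let p = inv_into UNIV id x in plane_metric p (from_chart plane_atlas (UNIV, id) p v)
      (from_chart plane_atlas (UNIV, id) p w)) UNIV" for k v w
  proof -
    have "frechet_derivative (id :: plane \<Rightarrow> plane) (at x) = id" for x
      using frechet_derivative_at[OF has_derivative_ident, of x] by (simp add: id_def)
    then have "from_chart plane_atlas (UNIV, id) p = id" for p
      by (simp add: from_chart_def)
    then show ?thesis by (simp add: plane_metric_def Ck_const)
  qed
  moreover have "plane_metric p v w = plane_metric p w v" "v \<noteq> 0 \<longrightarrow> 0 < plane_metric p v v" for p v w
    by (simp_all only: plane_metric_def inner_commute inner_gt_zero_iff simp_thms)
  ultimately show ?thesis
    unfolding riemannian_metric_def by (simp add: plane_atlas_def)
qed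

context bump_heights
begin

lemma contr'_gap:
  assumes "d = 2" "\<And>k. k < n \<Longrightarrow> \<omega> k = 0" "\<omega> n = 2"
  shows "contr' (addr \<omega> + offset d) = (1 - h n) / 5"
  using dent_addr[of n \<omega>, OF assms(2,3)] by (simp add: contr'_def offset_def assms(1))

lemma contr'_no_gap:
  assumes "d < 3" "\<And>k. \<omega> k < 3" "\<And>n. d = 2 \<Longrightarrow> (\<And>k. k < n \<Longrightarrow> \<omega> k = 0) \<Longrightarrow> \<omega> n \<noteq> 2"
  shows "contr' (addr \<omega> + offset d) = 1 / 5"
proof (cases "d = 2")
  case True
  have "dent (addr \<omega>) = 0"
    by (rule dent_addr_0) (use assms True in blast)+
  then show ?thesis using True by (simp add: contr'_def offset_def)
next
  case False
  then have "offset d \<le> 0" using assms(1) by (simp add: offset_def)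
  then have "addr \<omega> + offset d - 3 \<le> 0" using addr_le_1'[of \<omega>] by linarith
  then show ?thesis by (simp add: contr'_def dent_left)
qed

end

context horseshoe
begin

lemma expansion_code:
  assumes "z \<in> \<Lambda>"
  shows "expansion z = inverse (u.contr' (u.addr (\<lambda>k. code z (int k + 1)) + offset (code z 0)))"
  using expd_dec[of "code z"] assms by (simp add: expansion_def)

lemma contraction_code:
  assumes "z \<in> \<Lambda>"
  shows "contraction z = s.contr' (s.addr (\<lambda>k. code z (- 1 - int k)) + offset (code z 0))"
proof -
  have "snd z = s.addr (\<lambda>k. code z (- 1 - int k))"
    using dec_code[OF assms] unfolding dec_def by (metis snd_conv)
  then show ?thesis by (simp add: contraction_def)
qed

lemma expansion_gap:
  assumes "z \<in> \<Lambda>" "gap n 0 (code z)" shows "expansion z = 5 / (1 - hu n)"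
proof -
  have "u.contr' (u.addr (\<lambda>k. code z (int k + 1)) + offset (code z 0)) = (1 - hu n) / 5"
    by (rule u.contr'_gap) (use assms(2) in \<open>simp_all add: gap_def\<close>)
  then show ?thesis unfolding expansion_code[OF assms(1)] by (simp only: inverse_divide div_by_1 inverse_eq_divide divide_divide_eq_right mult_1)
qed

lemma expansion_no_gap:
  assumes "z \<in> \<Lambda>" "\<And>n. \<not> gap n 0 (code z)" shows "expansion z = 5"
proof -
  have "u.contr' (u.addr (\<lambda>k. code z (int k + 1)) + offset (code z 0)) = 1 / 5"
  proof (rule u.contr'_no_gap)
    show "code z 0 < 3" "code z (int k + 1) < 3" for k
      using code_seqs[OF assms(1)] by (simp_all add: seqs_def)
    fix n assume d: "code z 0 = 2" and z: "\<And>k. k < n \<Longrightarrow> code z (int k + 1) = 0"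
    have "code z k = 0" if "0 < k" "k \<le> int n" for k
      using z[of "nat (k - 1)"] that by simp
    then show "code z (int n + 1) \<noteq> 2" using assms(2)[of n] d by (auto simp: gap_def)
  qed
  then show ?thesis unfolding expansion_code[OF assms(1)] by (simp only: inverse_divide div_by_1 inverse_eq_divide divide_divide_eq_right mult_1)
qed

lemma contraction_gap:
  assumes "z \<in> \<Lambda>" "gap n (- 1 - int n) (code z)" shows "contraction z = (1 - hs n) / 5"
  unfolding contraction_code[OF assms(1)]
  by (rule s.contr'_gap) (use assms(2) in \<open>simp_all add: gap_def\<close>)

lemma contraction_no_gap:
  assumes "z \<in> \<Lambda>" "\<And>n. \<not> gap n (- 1 - int n) (code z)" shows "contraction z = 1 / 5"
  unfolding contraction_code[OF assms(1)]
proof (rule s.contr'_no_gap)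
  show "code z 0 < 3" "code z (- 1 - int k) < 3" for k
    using code_seqs[OF assms(1)] by (simp_all add: seqs_def)
  fix n assume d: "code z 0 = 2" and z: "\<And>k. k < n \<Longrightarrow> code z (- 1 - int k) = 0"
  have "code z k = 0" if "- 1 - int n < k" "k \<le> - 1" for k
    using z[of "nat (- 1 - k)"] that by simp
  then show "code z (- 1 - int n) \<noteq> 2" using assms(2)[of n] d by (auto simp: gap_def)
qed

definition Es :: "plane \<Rightarrow> plane set" where "Es p = {0} \<times> UNIV"
definition Eu :: "plane \<Rightarrow> plane set" where "Eu p = UNIV \<times> {0}"

lemma tangent_map_horse:
  assumes "z \<in> \<Lambda>"
  shows "tangent_map plane_atlas horse z = (\<lambda>q. (expansion z * fst q, contraction z * snd q))"
  using frechet_derivative_at[OF horse_derivative_\<Lambda>[OF assms]] by (simp add: tangent_map_plane)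

lemma log_norm_Eu:
  assumes "z \<in> \<Lambda>" shows "log_norm plane_atlas plane_metric horse Eu z = ln (expansion z)"
proof -
  have "(\<lambda>v. rnorm plane_metric (horse z) (tangent_map plane_atlas horse z v)) `
      {v \<in> Eu z. rnorm plane_metric z v = 1} = {expansion z}"
  proof
    show "{expansion z} \<subseteq> (\<lambda>v. rnorm plane_metric (horse z) (tangent_map plane_atlas horse z v)) `
      {v \<in> Eu z. rnorm plane_metric z v = 1}"
      using expansion_ge[of z]
      by (auto intro!: image_eqI[where x="(1, 0)"]
          simp: Eu_def rnorm_plane tangent_map_horse[OF assms] norm_Pair abs_mult)
  qed (use expansion_ge[of z] in
      \<open>auto simp: Eu_def rnorm_plane tangent_map_horse[OF assms] norm_Pair abs_mult\<close>)
  then show ?thesis by (simp add: log_norm_def)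
qed

lemma log_norm_Es:
  assumes "z \<in> \<Lambda>" shows "log_norm plane_atlas plane_metric horse Es z = ln (contraction z)"
proof -
  have "(\<lambda>v. rnorm plane_metric (horse z) (tangent_map plane_atlas horse z v)) `
      {v \<in> Es z. rnorm plane_metric z v = 1} = {contraction z}"
  proof
    show "{contraction z} \<subseteq> (\<lambda>v. rnorm plane_metric (horse z) (tangent_map plane_atlas horse z v)) `
      {v \<in> Es z. rnorm plane_metric z v = 1}"
      using contraction_bounds(1)[of z]
      by (auto intro!: image_eqI[where x="(0, 1)"]
          simp: Es_def rnorm_plane tangent_map_horse[OF assms] norm_Pair abs_mult)
  qed (use contraction_bounds(1)[of z] in
      \<open>auto simp: Es_def rnorm_plane tangent_map_horse[OF assms] norm_Pair abs_mult\<close>)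
  then show ?thesis by (simp add: log_norm_def)
qed

lemma dim_axes: "dim ({0} \<times> UNIV :: plane set) = 1" "dim (UNIV \<times> {0} :: plane set) = 1"
proof -
  have "{0} \<times> UNIV = span {(0, 1) :: plane}" "UNIV \<times> {0} = span {(1, 0) :: plane}"
    by (auto simp: span_singleton)
  then show "dim ({0} \<times> UNIV :: plane set) = 1" "dim (UNIV \<times> {0} :: plane set) = 1"
    by (simp_all add: zero_prod_def)
qed

lemma hyperbolic_splitting_\<Lambda>: "hyperbolic_splitting euclidean plane_atlas plane_metric horse \<Lambda> Es Eu"
  unfolding hyperbolic_splitting_def
proof (intro conjI ballI)
  fix z assume z: "z \<in> \<Lambda>"
  show "subspace (Es z)" "subspace (Eu z)"
    by (auto simp: Es_def Eu_def subspace_def zero_prod_def)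
  show "dim (Es z) = 1" "dim (Eu z) = 1"
    by (simp_all add: Es_def Eu_def dim_axes)
  show "Es z \<inter> Eu z = {0}" by (auto simp: Es_def Eu_def zero_prod_def)
  show "{v + w |v w. v \<in> Es z \<and> w \<in> Eu z} = UNIV"
  proof -
    have "p = (0, snd p) + (fst p, 0)" "(0, snd p) \<in> Es z" "(fst p, 0) \<in> Eu z" for p :: plane
      by (simp_all add: Es_def Eu_def)
    then show ?thesis by blast
  qed
  have ne: "expansion z \<noteq> 0" "contraction z \<noteq> 0"
    using expansion_ge[of z] contraction_bounds(1)[of z] by auto
  show "tangent_map plane_atlas horse z ` Es z = Es (horse z)"
    using ne by (auto simp: tangent_map_horse[OF z] Es_def image_iff intro!: exI[of _ "_ / contraction z"])
  show "tangent_map plane_atlas horse z ` Eu z = Eu (horse z)"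
    using ne by (auto simp: tangent_map_horse[OF z] Eu_def image_iff intro!: exI[of _ "_ / expansion z"])
next
  have s: "norm (frechet_derivative (horse ^^ n) (at z) v) \<le> (1/5) ^ n * norm v"
    if z: "z \<in> \<Lambda>" and v: "v \<in> Es z" for z v n
  proof -
    obtain a c where ac: "\<bar>c\<bar> \<le> (1/5) ^ n" "((horse ^^ n) has_derivative (\<lambda>q. (a * fst q, c * snd q))) (at z)"
      using horse_funpow_derivative[OF z] by blast
    have "norm (frechet_derivative (horse ^^ n) (at z) v) = \<bar>c\<bar> * norm v"
      using v unfolding frechet_derivative_at[OF ac(2), symmetric]
      by (auto simp: Es_def norm_Pair abs_mult)
    then show ?thesis using ac(1) by (simp add: mult_right_mono)
  qed
  have u: "norm (frechet_derivative (horse_inv ^^ n) (at z) v) \<le> (1/5) ^ n * norm v"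
    if z: "z \<in> \<Lambda>" and v: "v \<in> Eu z" for z v n
  proof -
    obtain a c where ac: "\<bar>a\<bar> \<le> (1/5) ^ n" "((horse_inv ^^ n) has_derivative (\<lambda>q. (a * fst q, c * snd q))) (at z)"
      using horse_inv_funpow_derivative[OF z] by blast
    have "norm (frechet_derivative (horse_inv ^^ n) (at z) v) = \<bar>a\<bar> * norm v"
      using v unfolding frechet_derivative_at[OF ac(2), symmetric]
      by (auto simp: Eu_def norm_Pair abs_mult)
    then show ?thesis using ac(1) by (simp add: mult_right_mono)
  qed
  show "\<exists>C>0. \<exists>\<theta>. 0 < \<theta> \<and> \<theta> < 1 \<and> (\<forall>x\<in>\<Lambda>. \<forall>n.
        (\<forall>v\<in>Es x. rnorm plane_metric ((horse ^^ n) x) (tangent_map plane_atlas (horse ^^ n) x v)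
            \<le> C * \<theta> ^ n * rnorm plane_metric x v) \<and>
        (\<forall>v\<in>Eu x. let b = inv_into (topspace euclidean) horse ^^ n
                  in rnorm plane_metric (b x) (tangent_map plane_atlas b x v) \<le> C * \<theta> ^ n * rnorm plane_metric x v))"
    by (rule exI[of _ 1], rule conjI, simp, rule exI[of _ "1/5"])
       (use s u in \<open>simp add: rnorm_plane tangent_map_plane inv_horse Let_def\<close>)
qed

lemma basic_set_\<Lambda>: "basic_set euclidean plane_atlas plane_metric horse \<Lambda> Es Eu"
  unfolding basic_set_def
  using compactin_\<Lambda> horse_image_\<Lambda> hyperbolic_splitting_\<Lambda> locally_maximal_\<Lambda> topologically_mixing_horse
  by blast

lemma Ck_diffeo_horse: "Ck_diffeo euclidean plane_atlas 2 horse"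
proof -
  have "continuous_on UNIV f" if "Ck_on 2 f UNIV" for f :: "plane \<Rightarrow> plane"
    using Ck_Suc_imp[of 0 f] Ck_Suc_imp[of 1 f] that
    by (simp only: One_nat_def numeral_2_eq_2 Ck_on.simps(1))
  then have "Ck_map euclidean plane_atlas 2 f" if "Ck_on 2 f UNIV" for f
    using that by (simp add: Ck_map_def plane_atlas_def del: Ck_on.simps)
  then show ?thesis
    using Ck_horse Ck_horse_inv bij_horse by (simp add: Ck_diffeo_def inv_horse)
qed

lemma continuous_map_horse: "continuous_map (top_of_set \<Lambda>) (top_of_set \<Lambda>) horse"
proof -
  have "continuous_on UNIV horse"
    using Ck_Suc_imp[of 0 horse] Ck_Suc_imp[of 1 horse] Ck_horse
    by (simp only: One_nat_def numeral_2_eq_2 Ck_on.simps(1))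
  then have "continuous_on \<Lambda> horse" by (rule continuous_on_subset) simp
  then show ?thesis using horse_\<Lambda> by (auto simp: continuous_map_in_subtopology)
qed

lemma measurable_dec_borel: "dec \<in> measurable (Pi\<^sub>M UNIV (\<lambda>_. count_space UNIV)) (borel_of (top_of_set \<Lambda>))"
  unfolding borel_of_def
proof (rule measurable_measure_of)
  have "(\<lambda>\<omega>. \<omega> k) \<in> measurable (Pi\<^sub>M UNIV (\<lambda>_. count_space UNIV)) (count_space UNIV)" for k :: int
    by (rule measurable_component_singleton) simp
  then have "dec \<in> borel_measurable (Pi\<^sub>M UNIV (\<lambda>_. count_space UNIV))"
    unfolding dec_def[abs_def] by (intro borel_measurable_Pair u.measurable_addr s.measurable_addr)
  then have *: "dec -` W \<inter> space (Pi\<^sub>M UNIV (\<lambda>_. count_space UNIV)) \<in> sets (Pi\<^sub>M UNIV (\<lambda>_. count_space UNIV))"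
    if "open W" for W
    using that by (intro measurable_sets) auto
  fix U assume "U \<in> {U. openin (top_of_set \<Lambda>) U}"
  then obtain W where W: "open W" "U = \<Lambda> \<inter> W" by (auto simp: openin_open)
  then have "dec -` U = dec -` W" by (auto simp: \<Lambda>_def)
  then show "dec -` U \<inter> space (Pi\<^sub>M UNIV (\<lambda>_. count_space UNIV)) \<in> sets (Pi\<^sub>M UNIV (\<lambda>_. count_space UNIV))"
    using *[OF W(1)] by (simp only:)
next
  show "{U. openin (top_of_set \<Lambda>) U} \<subseteq> Pow (topspace (top_of_set \<Lambda>))"
    using openin_subset by blast
  show "dec \<in> space (Pi\<^sub>M UNIV (\<lambda>_. count_space UNIV)) \<rightarrow> topspace (top_of_set \<Lambda>)"
    by (simp add: \<Lambda>_def)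
qed

end

section \<open>Weighted points on a parabola\<close>

text \<open>The ratio \<open>1/20\<close> is small enough for the heights \<open>(n + 1) radius n / 4\<close> to decay like
  \<open>10\<^sup>-\<^sup>n\<close>.\<close>

definition radius :: "nat \<Rightarrow> real" where "radius n = (1/20) ^ n"

text \<open>The missing mass \<open>1 - suminf q\<close> is thought of as sitting at the origin.\<close>

definition weights :: "(nat \<Rightarrow> real) set" where
  "weights = {q. (\<forall>n. 0 \<le> q n) \<and> summable q \<and> suminf q \<le> 1}"

definition barycentre :: "(nat \<Rightarrow> real) \<Rightarrow> plane" where
  "barycentre q = ((\<Sum>n. q n * radius n) / 4, (\<Sum>n. q n * (radius n)\<^sup>2) / 4)"

definition unit_weight :: "nat \<Rightarrow> nat \<Rightarrow> real" where "unit_weight m n = of_bool (n = m)"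

definition parabola_hull :: "plane set" where "parabola_hull = barycentre ` weights"

lemma radius_pos: "0 < radius n" and radius_le_1: "radius n \<le> 1"
  by (simp_all add: radius_def power_le_one)

lemma radius_inj: "radius m = radius n \<longleftrightarrow> m = n"
  unfolding radius_def by (rule power_inject_exp') auto

lemma summable_radius:
  assumes "q \<in> weights"
  shows "summable (\<lambda>n. q n * radius n)" "summable (\<lambda>n. q n * (radius n)\<^sup>2)"
proof -
  have q: "summable q" "\<And>n. 0 \<le> q n" using assms by (auto simp: weights_def)
  have "q n * radius n \<le> q n" "q n * (radius n)\<^sup>2 \<le> q n" for n
    using q(2)[of n] radius_pos[of n] radius_le_1[of n]
    by (auto intro!: mult_right_le_one_le power_le_one)
  then show "summable (\<lambda>n. q n * radius n)" "summable (\<lambda>n. q n * (radius n)\<^sup>2)"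
    using q radius_pos by (auto intro!: summable_comparison_test'[OF q(1), of 0] simp: less_imp_le abs_mult)
qed

lemma weights_le_1:
  assumes "q \<in> weights" shows "q n \<le> 1"
proof -
  have "sum q {n} \<le> suminf q"
    using assms by (intro sum_le_suminf) (auto simp: weights_def)
  then show ?thesis using assms by (simp add: weights_def)
qed

lemma convex_comb_weights:
  assumes "p \<in> weights" "q \<in> weights" "0 \<le> s" "s \<le> 1"
  shows "(\<lambda>n. (1 - s) * p n + s * q n) \<in> weights"
    and "barycentre (\<lambda>n. (1 - s) * p n + s * q n) = (1 - s) *\<^sub>R barycentre p + s *\<^sub>R barycentre q"
proof -
  have p: "summable p" "suminf p \<le> 1" "\<And>n. 0 \<le> p n" and q: "summable q" "suminf q \<le> 1" "\<And>n. 0 \<le> q n"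
    using assms by (auto simp: weights_def)
  have "(\<lambda>n. (1 - s) * p n + s * q n) sums ((1 - s) * suminf p + s * suminf q)"
    by (intro sums_add sums_mult summable_sums p q)
  moreover have "(1 - s) * suminf p + s * suminf q \<le> (1 - s) * 1 + s * 1"
    using assms p q by (intro add_mono mult_left_mono) auto
  ultimately show "(\<lambda>n. (1 - s) * p n + s * q n) \<in> weights"
    using assms p q by (auto simp: weights_def sums_iff)
  have 1: "(\<lambda>n. (1 - s) * (p n * c n) + s * (q n * c n)) sums
      ((1 - s) * (\<Sum>n. p n * c n) + s * (\<Sum>n. q n * c n))"
    if "summable (\<lambda>n. p n * c n)" "summable (\<lambda>n. q n * c n)" for c
    by (intro sums_add sums_mult summable_sums that)
  have 2: "(\<Sum>n. ((1 - s) * p n + s * q n) * c n) = (1 - s) * (\<Sum>n. p n * c n) + s * (\<Sum>n. q n * c n)"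
    if "summable (\<lambda>n. p n * c n)" "summable (\<lambda>n. q n * c n)" for c
    using sums_unique[OF 1[OF that]] by (simp add: algebra_simps)
  show "barycentre (\<lambda>n. (1 - s) * p n + s * q n) = (1 - s) *\<^sub>R barycentre p + s *\<^sub>R barycentre q"
    unfolding barycentre_def
    by (subst (1 2) 2) (simp_all add: summable_radius assms add_divide_distrib)
qed

lemma unit_weight: "unit_weight m \<in> weights"
  and barycentre_unit: "barycentre (unit_weight m) = (radius m / 4, (radius m)\<^sup>2 / 4)"
proof -
  have *: "(\<lambda>n. unit_weight m n * c n) sums c m" for c
  proof -
    have "(\<lambda>n. unit_weight m n * c n) = (\<lambda>n. if n = m then c n else 0)"
      by (auto simp: unit_weight_def)
    then show ?thesis using sums_single[of m c] by simp
  qed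
  from *[of "\<lambda>_. 1"] have "unit_weight m sums 1" by simp
  then show "unit_weight m \<in> weights"
    by (simp add: weights_def sums_iff) (simp add: unit_weight_def)
  show "barycentre (unit_weight m) = (radius m / 4, (radius m)\<^sup>2 / 4)"
    using *[of radius] *[of "\<lambda>n. (radius n)\<^sup>2"] by (simp add: barycentre_def sums_iff)
qed

lemma weights_eq_unit:
  assumes "q \<in> weights" "1 \<le> q m" shows "q = unit_weight m"
proof
  fix n
  have "q n = 0" if "n \<noteq> m"
  proof -
    have "sum q {n, m} \<le> suminf q"
      using assms(1) by (intro sum_le_suminf) (auto simp: weights_def)
    then have "q n + q m \<le> suminf q" using that by simp
    moreover have "suminf q \<le> 1" "0 \<le> q n" using assms(1) by (auto simp: weights_def)
    ultimately show ?thesis using assms(2) by linarith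
  qed
  moreover have "q m = 1" using weights_le_1[OF assms(1), of m] assms(2) by simp
  ultimately show "q n = unit_weight m n" by (simp add: unit_weight_def)
qed

lemma zero_weight: "(\<lambda>_. 0) \<in> weights" "barycentre (\<lambda>_. 0) = 0"
  by (simp_all add: weights_def barycentre_def zero_prod_def)

lemma barycentre_eq_0:
  assumes "q \<in> weights" "barycentre q = 0" shows "q = (\<lambda>_. 0)"
proof -
  have "(\<Sum>n. q n * radius n) = 0" using assms(2) by (simp add: barycentre_def zero_prod_def)
  then have "\<forall>n. q n * radius n = 0"
    using suminf_eq_zero_iff[OF summable_radius(1)[OF assms(1)]] assms(1) radius_pos
    by (simp add: weights_def less_imp_le)
  then show ?thesis using radius_pos by (auto simp: fun_eq_iff) (metis less_irrefl)
qed

text \<open>The vertices lie on a parabola, so the tangent at a vertex exposes it.\<close>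

lemma barycentre_eq_unit:
  assumes q: "q \<in> weights" and eq: "barycentre q = barycentre (unit_weight m)"
  shows "q = unit_weight m"
proof -
  have s: "(\<Sum>n. q n * radius n) = radius m" "(\<Sum>n. q n * (radius n)\<^sup>2) = (radius m)\<^sup>2"
    using eq unfolding barycentre_unit by (simp_all add: barycentre_def)
  have sm: "summable (\<lambda>n. q n * radius n)" "summable (\<lambda>n. q n * (radius n)\<^sup>2)" "summable q"
    using summable_radius[OF q] q by (auto simp: weights_def)
  have "(\<lambda>n. (q n * (radius n)\<^sup>2 - 2 * radius m * (q n * radius n)) + (radius m)\<^sup>2 * q n) sums
      (((radius m)\<^sup>2 - 2 * radius m * radius m) + (radius m)\<^sup>2 * suminf q)"
    using sums_add[OF sums_diff[OF summable_sums[OF sm(2)] sums_mult[OF summable_sums[OF sm(1)], of "2 * radius m"]]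
       sums_mult[OF summable_sums[OF sm(3)], of "(radius m)\<^sup>2"]] unfolding s .
  then have *: "(\<lambda>n. q n * (radius n - radius m)\<^sup>2) sums ((radius m)\<^sup>2 * (suminf q - 1))"
    by (simp add: power2_eq_square algebra_simps)
  have nonneg: "0 \<le> q n * (radius n - radius m)\<^sup>2" for n using q by (simp add: weights_def)
  have "(radius m)\<^sup>2 * (suminf q - 1) \<le> 0"
    using q by (intro mult_nonneg_nonpos) (auto simp: weights_def)
  then have "suminf (\<lambda>n. q n * (radius n - radius m)\<^sup>2) = 0"
    using * suminf_nonneg[OF sums_summable[OF *] nonneg] by (simp add: sums_iff)
  then have "q n * (radius n - radius m)\<^sup>2 = 0" for n
    using suminf_eq_zero_iff[OF sums_summable[OF *] nonneg] by simp
  then have 0: "q n = 0" if "n \<noteq> m" for n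
    using that radius_inj[of n m] by (metis mult_eq_0_iff power_eq_0_iff right_minus_eq)
  have "(\<lambda>n. if n = m then q n * radius n else 0) = (\<lambda>n. q n * radius n)"
    using 0 by auto
  then have "q m * radius m = radius m"
    using sums_single[of m "\<lambda>n. q n * radius n"] s(1) by (simp add: sums_iff)
  then have "q m = 1" using radius_pos[of m] by simp
  then show ?thesis using 0 by (auto simp: unit_weight_def fun_eq_iff)
qed

text \<open>Weights with values in \<open>{0, 1}\<close> are extreme among all weights, and \<open>barycentre\<close> is affine;
  uniqueness of the weights carries extremality over to the image.\<close>

lemma unique_weights_extreme:
  assumes q: "q \<in> weights" and uniq: "\<And>p. p \<in> weights \<Longrightarrow> barycentre p = barycentre q \<Longrightarrow> p = q"
    and ext: "\<And>n. q n = 0 \<or> q n = 1"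
  shows "barycentre q extreme_point_of parabola_hull"
  unfolding extreme_point_of_def
proof (intro conjI ballI notI)
  show "barycentre q \<in> parabola_hull" using q by (simp add: parabola_hull_def)
  fix x y assume xy: "x \<in> parabola_hull" "y \<in> parabola_hull" "barycentre q \<in> open_segment x y"
  obtain a b where a: "a \<in> weights" "x = barycentre a" and b: "b \<in> weights" "y = barycentre b"
    using xy by (auto simp: parabola_hull_def)
  obtain s where s: "x \<noteq> y" "0 < s" "s < 1" "barycentre q = (1 - s) *\<^sub>R x + s *\<^sub>R y"
    using xy(3) by (auto simp: in_segment)
  have "(\<lambda>n. (1 - s) * a n + s * b n) = q"
    using convex_comb_weights[OF a(1) b(1), of s] s by (intro uniq) (simp_all add: a b)
  then have eq: "(1 - s) * a n + s * b n = q n" for n by (simp add: fun_eq_iff)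
  have "a n = b n" for n
  proof (cases "q n = 0")
    case True
    have "0 \<le> (1 - s) * a n" "0 \<le> s * b n" using a(1) b(1) s by (auto simp: weights_def)
    then have "(1 - s) * a n = 0" "s * b n = 0" using eq[of n] True by linarith+
    then show ?thesis using s by simp
  next
    case False
    then have "q n = 1" using ext by blast
    then have "(1 - s) * (1 - a n) + s * (1 - b n) = 0"
      using eq[of n] by (simp add: algebra_simps)
    moreover have "0 \<le> (1 - s) * (1 - a n)" "0 \<le> s * (1 - b n)"
      using s weights_le_1[OF a(1)] weights_le_1[OF b(1)] by auto
    ultimately have "(1 - s) * (1 - a n) = 0" "s * (1 - b n) = 0" by linarith+
    then show ?thesis using s by simp
  qed
  then have "a = b" by blast
  then show False using s(1) a b by simp
qed

text \<open>A weight strictly between \<open>0\<close> and \<open>1\<close> can be split off: the point then lies on the segment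
  from the corresponding vertex to the point given by the other weights, rescaled.\<close>

lemma extreme_point_cases:
  assumes ext: "x extreme_point_of parabola_hull"
  shows "x = 0 \<or> (\<exists>m. x = barycentre (unit_weight m))"
proof -
  obtain q where q: "q \<in> weights" "x = barycentre q"
    using ext by (auto simp: extreme_point_of_def parabola_hull_def)
  show ?thesis
  proof (cases "\<exists>m. q m \<noteq> 0")
    case False
    then have "q = (\<lambda>_. 0)" by auto
    then show ?thesis using q(2) zero_weight(2) by simp
  next
    case True
    then obtain m where m: "q m \<noteq> 0" by blast
    define s where "s = q m"
    have s: "0 < s" "s \<le> 1" using q(1) m weights_le_1[OF q(1), of m] by (auto simp: s_def weights_def less_le)
    have sum: "(\<lambda>n. q n - s * unit_weight m n) sums (suminf q - s * 1)"
    proof (intro sums_diff sums_mult)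
      show "q sums suminf q" using q(1) by (auto simp: weights_def)
      have "unit_weight m = (\<lambda>n. if n = m then 1 else 0)" by (auto simp: unit_weight_def)
      then show "unit_weight m sums 1" using sums_single[of m "\<lambda>_. 1"] by simp
    qed
    have nonneg: "0 \<le> q n - s * unit_weight m n" for n
      using q(1) by (auto simp: unit_weight_def s_def weights_def)
    show ?thesis
    proof (cases "s = 1")
      case True
      have "suminf (\<lambda>n. q n - s * unit_weight m n) = 0"
        using q(1) suminf_nonneg[OF sums_summable[OF sum] nonneg] sum True
        by (auto simp: weights_def sums_iff)
      then have "q n - s * unit_weight m n = 0" for n
        using suminf_eq_zero_iff[OF sums_summable[OF sum] nonneg] by blast
      then have "q = unit_weight m" using True by (auto simp: fun_eq_iff)
      then show ?thesis using q(2) by blast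
    next
      case False
      then have s1: "s < 1" using s by simp
      define p where "p n = (q n - s * unit_weight m n) / (1 - s)" for n
      have p: "p \<in> weights"
      proof -
        have ps: "p sums ((suminf q - s * 1) / (1 - s))"
          unfolding p_def[abs_def] by (rule sums_divide[OF sum])
        moreover have "(suminf q - s * 1) / (1 - s) \<le> 1"
          using s1 q(1) by (simp add: weights_def)
        ultimately show ?thesis
          using nonneg s1 by (auto simp: weights_def sums_iff p_def)
      qed
      have "q = (\<lambda>n. (1 - s) * p n + s * unit_weight m n)"
        using s1 by (auto simp: p_def)
      then have x: "x = (1 - s) *\<^sub>R barycentre p + s *\<^sub>R barycentre (unit_weight m)"
        using convex_comb_weights(2)[OF p unit_weight[of m], of s] s q(2) by simp
      show ?thesis
      proof (cases "barycentre p = barycentre (unit_weight m)")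
        case True
        then have "x = barycentre (unit_weight m)" using x by (simp add: scaleR_add_left[symmetric])
        then show ?thesis by blast
      next
        case False
        then have "x \<in> open_segment (barycentre p) (barycentre (unit_weight m))"
          unfolding in_segment using x s s1 by blast
        then have False
          using ext p unit_weight[of m] by (auto simp: extreme_point_of_def parabola_hull_def)
        then show ?thesis ..
      qed
    qed
  qed
qed

lemma extreme_points_parabola_hull:
  "{x. x extreme_point_of parabola_hull} = insert 0 (range (\<lambda>m. barycentre (unit_weight m)))"
proof -
  have "barycentre (\<lambda>_. 0) extreme_point_of parabola_hull"
  proof (rule unique_weights_extreme[OF zero_weight(1)])
    fix p assume "p \<in> weights" "barycentre p = barycentre (\<lambda>_. 0)"
    then show "p = (\<lambda>_. 0)" using barycentre_eq_0[of p] by (simp only: zero_weight(2))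
  qed simp
  moreover have "barycentre (unit_weight m) extreme_point_of parabola_hull" for m
  proof (rule unique_weights_extreme[OF unit_weight])
    show "unit_weight m n = 0 \<or> unit_weight m n = 1" for n by (simp add: unit_weight_def)
  qed (rule barycentre_eq_unit)
  ultimately show ?thesis
    unfolding zero_weight(2) using extreme_point_cases by blast
qed

lemma interior_parabola_hull: "interior parabola_hull \<noteq> {}"
proof -
  \<comment> \<open>The open triangle spanned by the origin and the first two vertices; \<open>c0\<close> and \<open>c1\<close> are barycentric
    coordinates.\<close>
  define S :: "plane set" where
    "S = {p. 0 < 20 * fst p - 20 * snd p} \<inter> {p. 0 < 400 * snd p - 20 * fst p} \<inter>
         {p. (400 * snd p - 20 * fst p) + 400 * (20 * fst p - 20 * snd p) < 95}"
  have "open S"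
    unfolding S_def by (intro open_Int open_Collect_less continuous_intros)
  moreover have "S \<subseteq> parabola_hull"
  proof
    fix p assume p: "p \<in> S"
    define c1 where "c1 = 4 * (20 * (20 * fst p - 20 * snd p)) / 19"
    define c0 where "c0 = 4 * (400 * snd p - 20 * fst p) / 380"
    have "95 * (c0 + c1) = 7980 * fst p - 7600 * snd p"
      by (simp add: c0_def c1_def field_simps)
    moreover have "7980 * fst p - 7600 * snd p < 95" using p by (simp add: S_def)
    ultimately have "95 * (c0 + c1) < 95" by (simp only:)
    then have "c0 + c1 \<le> 1" by simp
    moreover have "0 \<le> c0" "0 \<le> c1" using p by (simp_all add: S_def c0_def c1_def)
    ultimately have c: "0 \<le> c0" "0 \<le> c1" "c0 + c1 \<le> 1" by auto
    define q :: "nat \<Rightarrow> real" where "q n = c0 * unit_weight 0 n + c1 * unit_weight 1 n" for n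
    have *: "(\<lambda>n. q n * c n) sums (c0 * c 0 + c1 * c 1)" for c
    proof -
      have "(\<lambda>n. c0 * (if n = 0 then c n else 0) + c1 * (if n = 1 then c n else 0)) sums (c0 * c 0 + c1 * c 1)"
        by (intro sums_add sums_mult sums_single)
      moreover have "(\<lambda>n. c0 * (if n = 0 then c n else 0) + c1 * (if n = 1 then c n else 0)) = (\<lambda>n. q n * c n)"
        by (auto simp: q_def unit_weight_def)
      ultimately show ?thesis by simp
    qed
    have "q \<in> weights"
    proof -
      have "q sums (c0 + c1)" using *[of "\<lambda>_. 1"] by simp
      then show ?thesis using c by (simp add: weights_def sums_iff) (simp add: q_def unit_weight_def)
    qed
    moreover have "barycentre q = p"
      using *[of radius] *[of "\<lambda>n. (radius n)\<^sup>2"]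
      by (simp add: barycentre_def sums_iff radius_def c0_def c1_def power2_eq_square prod_eq_iff field_simps)
    ultimately show "p \<in> parabola_hull" by (auto simp: parabola_hull_def)
  qed
  moreover have "(21/320, 401/6400) \<in> S" by (simp add: S_def)
  ultimately show ?thesis using interior_maximal by blast
qed

lemma barycentre_unit_tendsto: "(\<lambda>m. barycentre (unit_weight m)) \<longlonglongrightarrow> 0"
proof -
  have r: "radius \<longlonglongrightarrow> 0"
    unfolding radius_def[abs_def] by (rule LIMSEQ_realpow_zero) auto
  have "(\<lambda>m. (radius m / 4, (radius m)\<^sup>2 / 4)) \<longlonglongrightarrow> (0 / 4, 0\<^sup>2 / 4)"
    by (rule tendsto_Pair[OF tendsto_divide[OF r tendsto_const]
          tendsto_divide[OF tendsto_power[OF r] tendsto_const]]) simp_all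
  moreover have "(0 / 4, 0\<^sup>2 / 4) = (0 :: plane)" by (simp add: zero_prod_def)
  ultimately show ?thesis by (simp only: barycentre_unit)
qed

lemma inj_barycentre_unit: "inj (\<lambda>m. barycentre (unit_weight m))"
  by (auto simp: inj_def barycentre_unit radius_inj)

lemma barycentre_unit_nonzero: "barycentre (unit_weight m) \<noteq> 0"
  using radius_pos[of m] by (simp add: barycentre_unit zero_prod_def)

section \<open>How often an invariant measure sees the blocks\<close>

lemma gap_left_shift: "gap n i (left_shift \<omega>) \<longleftrightarrow> gap n (i + 1) \<omega>"
proof -
  have "(\<forall>k. i < k \<and> k \<le> i + int n \<longrightarrow> \<omega> (k + 1) = 0) \<longleftrightarrow>
      (\<forall>k. i + 1 < k \<and> k \<le> i + 1 + int n \<longrightarrow> \<omega> k = 0)"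
    (is "?L \<longleftrightarrow> ?R")
  proof
    assume L: ?L
    show ?R
    proof (intro allI impI)
      fix k assume "i + 1 < k \<and> k \<le> i + 1 + int n"
      then show "\<omega> k = 0" using L[rule_format, of "k - 1"] by simp
    qed
  next
    assume R: ?R
    show ?L
    proof (intro allI impI)
      fix k assume "i < k \<and> k \<le> i + int n"
      then show "\<omega> (k + 1) = 0" using R[rule_format, of "k + 1"] by simp
    qed
  qed
  then show ?thesis by (simp add: gap_def left_shift_def algebra_simps)
qed

text \<open>An end digit \<open>2\<close> of one block cannot be one of the zeros of another. A block is taken to
  cover its left end but not its right end, as consecutive blocks share a digit \<open>2\<close>.\<close>

lemma gap_unique:
  assumes "gap n i \<omega>" "gap m j \<omega>" "i \<le> c" "c \<le> i + int n" "j \<le> c" "c \<le> j + int m"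
  shows "i = j \<and> n = m"
proof -
  have two: "\<omega> i = 2" "\<omega> j = 2" "\<omega> (i + int n + 1) = 2" "\<omega> (j + int m + 1) = 2"
    and zero: "\<And>k. i < k \<Longrightarrow> k \<le> i + int n \<Longrightarrow> \<omega> k = 0" "\<And>k. j < k \<Longrightarrow> k \<le> j + int m \<Longrightarrow> \<omega> k = 0"
    using assms(1,2) by (auto simp: gap_def)
  have ij: "i = j"
  proof (rule ccontr)
    assume "i \<noteq> j"
    then consider "i < j" | "j < i" by linarith
    then show False using zero(1)[of j] zero(2)[of i] two(1,2) assms(3-6) by cases auto
  qed
  have "n = m"
  proof (rule ccontr)
    assume "n \<noteq> m"
    then consider "n < m" | "m < n" by linarith
    then show False
      using zero(1)[of "j + int m + 1"] zero(2)[of "i + int n + 1"] two(3,4) ij by cases auto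
  qed
  with ij show ?thesis by simp
qed

text \<open>What the study of invariant measures uses of a system conjugate to the full shift. The decoding
  map is defined on all sequences of natural numbers, so that product measures can be pushed
  forward along it.\<close>

locale shift_coding =
  fixes X :: "'a topology" and f :: "'a \<Rightarrow> 'a" and code :: "'a \<Rightarrow> int \<Rightarrow> nat" and dec :: "(int \<Rightarrow> nat) \<Rightarrow> 'a"
  assumes code_less: "z \<in> topspace X \<Longrightarrow> code z k < 3"
    and dec_in: "dec \<omega> \<in> topspace X"
    and code_dec: "code (dec \<omega>) = (\<lambda>k. min (\<omega> k) 2)"
    and dec_code: "z \<in> topspace X \<Longrightarrow> dec (code z) = z"
    and f_dec: "f (dec \<omega>) = dec (left_shift \<omega>)"
    and openin_code: "openin X {z \<in> topspace X. code z k = a}"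
    and measurable_dec: "dec \<in> measurable (Pi\<^sub>M UNIV (\<lambda>_. count_space UNIV)) (borel_of X)"
    and continuous_f: "continuous_map X X f"
begin

lemma space_borel_of [simp]: "space (borel_of X) = topspace X"
  by (simp add: borel_of_def openin_subset space_measure_of_conv)

lemma openin_sets: "openin X U \<Longrightarrow> U \<in> sets (borel_of X)"
  unfolding borel_of_def using openin_subset by (subst sets_measure_of) blast+

lemma f_in: "z \<in> topspace X \<Longrightarrow> f z \<in> topspace X"
  using f_dec[of "code z"] dec_code[of z] dec_in[of "left_shift (code z)"] by simp

lemma code_f: "z \<in> topspace X \<Longrightarrow> code (f z) = left_shift (code z)"
proof -
  assume z: "z \<in> topspace X"
  have "min (code z k) 2 = code z k" for k using code_less[OF z, of k] by simp
  then show ?thesis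
    using f_dec[of "code z"] dec_code[OF z] code_dec[of "left_shift (code z)"]
    by (simp add: left_shift_def)
qed

lemma measurable_f: "f \<in> measurable (borel_of X) (borel_of X)"
  unfolding borel_of_def
proof (rule measurable_measure_of)
  fix U assume "U \<in> {U. openin X U}"
  then have "openin X {z \<in> topspace X. f z \<in> U}"
    using openin_continuous_map_preimage[OF continuous_f] by blast
  moreover have "f -` U \<inter> space (sigma (topspace X) {U. openin X U}) = {z \<in> topspace X. f z \<in> U}"
    using space_borel_of by (auto simp: borel_of_def)
  ultimately show "f -` U \<inter> space (sigma (topspace X) {U. openin X U}) \<in> sets (sigma (topspace X) {U. openin X U})"
    using openin_sets by (simp add: borel_of_def)
qed (use openin_subset f_in space_borel_of in \<open>auto simp: borel_of_def\<close>)

lemma measurable_code [measurable]: "(\<lambda>z. code z k) \<in> measurable (borel_of X) (count_space UNIV)"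
proof (rule measurable_count_space_eq_countable[THEN iffD2])
  show "countable (UNIV :: nat set)" by simp
  have "(\<lambda>z. code z k) -` {a} \<inter> space (borel_of X) = {z \<in> topspace X. code z k = a}" for a
    by auto
  then show "(\<lambda>z. code z k) \<in> space (borel_of X) \<rightarrow> UNIV \<and>
      (\<forall>a\<in>UNIV. (\<lambda>z. code z k) -` {a} \<inter> space (borel_of X) \<in> sets (borel_of X))"
    using openin_sets[OF openin_code] by simp
qed

abbreviation "invariants \<equiv> invariant_measures X f"

lemma invariantsD:
  assumes "\<mu> \<in> invariants"
  shows "sets \<mu> = sets (borel_of X)" "space \<mu> = topspace X" "prob_space \<mu>" "f \<in> measurable \<mu> \<mu>" "distr \<mu> \<mu> f = \<mu>"
  using assms sets_eq_imp_space_eq[of \<mu> "borel_of X"] by (auto simp: invariant_measures_def)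

definition gap_set :: "nat \<Rightarrow> int \<Rightarrow> 'a set" where
  "gap_set n i = {z \<in> topspace X. gap n i (code z)}"

lemma sets_gap_set: "gap_set n i \<in> sets (borel_of X)"
proof -
  have "{z \<in> space (borel_of X). gap n i (code z)} \<in> sets (borel_of X)"
    unfolding gap_def by measurable
  then show ?thesis by (simp add: gap_set_def)
qed

lemma gap_set_vimage: "f -` gap_set n i \<inter> topspace X = gap_set n (i + 1)"
  by (auto simp: gap_set_def f_in code_f gap_left_shift)

lemma measure_vimage_f:
  assumes "\<mu> \<in> invariants" "A \<in> sets \<mu>"
  shows "measure \<mu> (f -` A \<inter> topspace X) = measure \<mu> A"
  using measure_distr[of f \<mu> \<mu> A] invariantsD[OF assms(1)] assms(2) by simp

lemma measure_gap_set:
  assumes "\<mu> \<in> invariants"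
  shows "measure \<mu> (gap_set n i) = measure \<mu> (gap_set n 0)"
proof -
  have step: "measure \<mu> (gap_set n (i + 1)) = measure \<mu> (gap_set n i)" for i
    using measure_vimage_f[OF assms, of "gap_set n i"] sets_gap_set[of n i] invariantsD(1)[OF assms]
    by (simp add: gap_set_vimage)
  show ?thesis
  proof (induction i rule: int_induct[where k=0])
    case (step2 i)
    then show ?case using step[of "i - 1"] by simp
  qed (simp_all add: step)
qed

text \<open>By invariance this is the probability that the origin is covered by a block with \<open>n\<close> zeros, see
  \<open>measure_in_gap\<close>.\<close>

definition gap_weight :: "'a measure \<Rightarrow> nat \<Rightarrow> real" where
  "gap_weight \<mu> n = (real n + 1) * measure \<mu> (gap_set n 0)"

definition in_gap :: "nat \<Rightarrow> int \<Rightarrow> 'a set" where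
  "in_gap n c = (\<Union>i\<in>{c - int n..c}. gap_set n i)"

lemma sets_in_gap: "in_gap n c \<in> sets (borel_of X)"
  unfolding in_gap_def by (intro sets.finite_UN sets_gap_set) simp

lemma measure_in_gap:
  assumes "\<mu> \<in> invariants" shows "measure \<mu> (in_gap n c) = gap_weight \<mu> n"
proof -
  interpret prob_space \<mu> using invariantsD(3)[OF assms] .
  have "measure \<mu> (\<Union>i\<in>{c - int n..c}. gap_set n i) = (\<Sum>i\<in>{c - int n..c}. measure \<mu> (gap_set n i))"
  proof (rule finite_measure_finite_Union)
    show "finite {c - int n..c}" by simp
    show "gap_set n ` {c - int n..c} \<subseteq> sets \<mu>"
      unfolding invariantsD(1)[OF assms] by (rule image_subsetI) (rule sets_gap_set)
    show "disjoint_family_on (gap_set n) {c - int n..c}"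
    proof (unfold disjoint_family_on_def, intro ballI impI)
      fix i j assume ij: "i \<in> {c - int n..c}" "j \<in> {c - int n..c}" "i \<noteq> j"
      then have False if "z \<in> gap_set n i" "z \<in> gap_set n j" for z
        using that gap_unique[of n i "code z" n j c] by (simp add: gap_set_def)
      then show "gap_set n i \<inter> gap_set n j = {}" by blast
    qed
  qed
  also have "\<dots> = (\<Sum>i\<in>{c - int n..c}. measure \<mu> (gap_set n 0))"
    by (rule sum.cong[OF refl]) (rule measure_gap_set[OF assms])
  also have "\<dots> = gap_weight \<mu> n"
    by (simp add: gap_weight_def)
  finally show ?thesis by (simp only: in_gap_def)
qed

lemma disjoint_in_gap: "disjoint_family (\<lambda>n. in_gap n c)"
proof -
  have False if z: "z \<in> in_gap n c" "z \<in> in_gap m c" and "n \<noteq> m" for z n m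
  proof -
    obtain i j where "c - int n \<le> i" "i \<le> c" "gap n i (code z)" "c - int m \<le> j" "j \<le> c" "gap m j (code z)"
      using z by (auto simp: in_gap_def gap_set_def)
    then show False using gap_unique[of n i "code z" m j c] that(3) by simp
  qed
  then show ?thesis unfolding disjoint_family_on_def by blast
qed

text \<open>A form of Kac's lemma: blocks of different lengths cannot both cover the origin.\<close>

lemma gap_weight_weights:
  assumes "\<mu> \<in> invariants" shows "gap_weight \<mu> \<in> weights"
proof -
  interpret prob_space \<mu> using invariantsD(3)[OF assms] .
  have "(\<lambda>n. measure \<mu> (in_gap n 0)) sums measure \<mu> (\<Union>n. in_gap n 0)"
    by (rule finite_measure_UNION[OF _ disjoint_in_gap])
       (use sets_in_gap invariantsD(1)[OF assms] in auto)
  then have s: "gap_weight \<mu> sums measure \<mu> (\<Union>n. in_gap n 0)"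
    by (simp add: measure_in_gap[OF assms])
  have "summable (gap_weight \<mu>)" by (rule sums_summable[OF s])
  moreover have "suminf (gap_weight \<mu>) \<le> 1"
    unfolding sums_unique[OF s, symmetric] by (rule prob_le_1)
  moreover have "0 \<le> gap_weight \<mu> n" for n by (simp add: gap_weight_def)
  ultimately show ?thesis by (simp add: weights_def)
qed

text \<open>All blocks that start at \<open>i n\<close> and have \<open>n\<close> zeros cover the position \<open>c\<close>, so at most one of them
  occurs and \<open>\<psi>\<close> is \<open>L\<close> plus a sum of multiples of indicator functions. For blocks that start at
  the origin \<open>c = 0\<close>, for blocks that end there \<open>c = -1\<close>.\<close>

lemma integral_gap_function:
  assumes \<mu>: "\<mu> \<in> invariants" and summ: "summable a" and nonneg: "\<And>n. 0 \<le> a n"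
    and pos: "\<And>n. i n \<le> c" "\<And>n. c \<le> i n + int n"
    and gap: "\<And>z n. z \<in> topspace X \<Longrightarrow> gap n (i n) (code z) \<Longrightarrow> \<psi> z = L + a n"
    and no_gap: "\<And>z. z \<in> topspace X \<Longrightarrow> (\<And>n. \<not> gap n (i n) (code z)) \<Longrightarrow> \<psi> z = L"
  shows "(LINT z|\<mu>. \<psi> z) = L + (\<Sum>n. a n * measure \<mu> (gap_set n 0))"
proof -
  interpret prob_space \<mu> using invariantsD(3)[OF \<mu>] .
  have sets: "gap_set n j \<in> sets \<mu>" for n j
    using sets_gap_set invariantsD(1)[OF \<mu>] by simp
  let ?g = "\<lambda>n z. a n * indicator (gap_set n (i n)) z :: real"
  have int: "integrable \<mu> (?g n)" for n
    by (intro integrable_mult_right integrable_real_indicator sets) (simp add: less_top[symmetric])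
  have int_eq: "integral\<^sup>L \<mu> (?g n) = a n * measure \<mu> (gap_set n 0)" for n
  proof -
    have "integral\<^sup>L \<mu> (?g n) = a n * measure \<mu> (gap_set n (i n) \<inter> space \<mu>)"
      by (simp only: integral_mult_right_zero Bochner_Integration.integral_indicator)
    also have "gap_set n (i n) \<inter> space \<mu> = gap_set n (i n)"
      by (rule Int_absorb2[OF sets.sets_into_space[OF sets]])
    also have "measure \<mu> (gap_set n (i n)) = measure \<mu> (gap_set n 0)"
      by (rule measure_gap_set[OF \<mu>])
    finally show ?thesis .
  qed
  have summ_meas: "summable (\<lambda>n. a n * measure \<mu> (gap_set n 0))"
    by (rule summable_comparison_test'[OF summ, of 0]) (use nonneg in \<open>simp add: abs_mult mult_left_le\<close>)
  have norm_eq: "norm (?g n z) = ?g n z" for n z using nonneg[of n] by (simp add: abs_mult)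
  have summ_norm: "summable (\<lambda>n. LINT z|\<mu>. norm (?g n z))"
    unfolding norm_eq int_eq by (rule summ_meas)
  have ae_norm: "AE z in \<mu>. summable (\<lambda>n. norm (?g n z))"
    by (intro AE_I2 summable_comparison_test'[OF summ, of 0])
       (use nonneg in \<open>simp add: abs_mult indicator_def\<close>)
  have sum_eq: "\<psi> z = L + (\<Sum>n. ?g n z)" if z: "z \<in> space \<mu>" for z
  proof (cases "\<exists>n. gap n (i n) (code z)")
    case True
    then obtain n where n: "gap n (i n) (code z)" by blast
    have zX: "z \<in> topspace X" using z invariantsD(2)[OF \<mu>] by simp
    have "?g m z = (if m = n then a n else 0)" for m
    proof (cases "m = n")
      case True
      then show ?thesis using n zX by (simp add: gap_set_def)
    next
      case False
      then have "\<not> gap m (i m) (code z)"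
        using gap_unique[OF n _ pos(1,2,1,2)] by metis
      then show ?thesis using False by (simp add: gap_set_def)
    qed
    then have "(\<Sum>n. ?g n z) = a n"
      using sums_single[of n "\<lambda>_. a n"] by (simp add: sums_iff)
    then show ?thesis using gap[OF zX n] by simp
  next
    case False
    then have "?g m z = 0" for m by (simp add: gap_set_def)
    then have "(\<Sum>n. ?g n z) = 0" by (simp only: suminf_zero)
    then show ?thesis using no_gap[of z] False z invariantsD(2)[OF \<mu>] by simp
  qed
  have "(LINT z|\<mu>. \<psi> z) = (LINT z|\<mu>. L + (\<Sum>n. ?g n z))"
    by (rule Bochner_Integration.integral_cong[OF refl sum_eq])
  also have "\<dots> = (LINT z|\<mu>. L) + (LINT z|\<mu>. (\<Sum>n. ?g n z))"
  proof (rule Bochner_Integration.integral_add)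
    show "integrable \<mu> (\<lambda>z. \<Sum>n. ?g n z)"
      by (rule integrable_suminf[OF int ae_norm summ_norm])
  qed simp
  also have "(LINT z|\<mu>. (\<Sum>n. ?g n z)) = (\<Sum>n. a n * measure \<mu> (gap_set n 0))"
    unfolding int_eq[symmetric] by (rule integral_suminf[OF int ae_norm summ_norm])
  finally show ?thesis by (simp add: prob_space)
qed

end

section \<open>Entropy of finitely supported and of uniformly distributed measures\<close>

lemma entropy_term_bounds:
  fixes x :: real
  assumes "0 \<le> x" "x \<le> 1" shows "0 \<le> - (x * ln x)" "- (x * ln x) \<le> 1"
proof -
  show "0 \<le> - (x * ln x)"
    using assms by (cases "x = 0") (auto simp: mult_le_0_iff)
  show "- (x * ln x) \<le> 1"
  proof (cases "x = 0")
    case False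
    then have "ln (1 / x) \<le> 1 / x - 1" using assms by (intro ln_le_minus_one) simp
    then have "x * ln (1 / x) \<le> x * (1 / x - 1)" using assms by (intro mult_left_mono) auto
    also have "\<dots> = 1 - x" using False by (simp add: algebra_simps)
    finally show ?thesis using False assms by (simp add: ln_div)
  qed simp
qed

lemma dynamical_partition:
  assumes "f \<in> measurable \<mu> \<mu>" "finite_partition \<mu> P"
  shows "finite (dynamical_partition \<mu> f P n)" "dynamical_partition \<mu> f P n \<subseteq> sets \<mu>"
    "disjoint (dynamical_partition \<mu> f P n)" "\<Union>(dynamical_partition \<mu> f P n) = space \<mu>"
proof -
  have P: "finite P" "P \<subseteq> sets \<mu>" "\<Union>P = space \<mu>" "disjoint P"
    using assms(2) by (auto simp: finite_partition_def partition_on_def)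
  let ?B = "\<lambda>a. {x \<in> space \<mu>. \<forall>i<n. (f ^^ i) x \<in> a i}"
  have dp: "dynamical_partition \<mu> f P n = ?B ` ({..<n} \<rightarrow>\<^sub>E P) - {{}}"
    by (simp add: dynamical_partition_def)
  show "finite (dynamical_partition \<mu> f P n)"
    unfolding dp using P(1) by (intro finite_Diff finite_imageI finite_PiE) auto
  have meas: "f ^^ i \<in> measurable \<mu> \<mu>" for i
    by (rule measurable_compose_n[OF assms(1)])
  show "dynamical_partition \<mu> f P n \<subseteq> sets \<mu>"
  proof
    fix B assume "B \<in> dynamical_partition \<mu> f P n"
    then obtain a where a: "a \<in> {..<n} \<rightarrow>\<^sub>E P" "B = ?B a" unfolding dp by blast
    have "{x \<in> space \<mu>. (f ^^ i) x \<in> a i} \<in> sets \<mu>" if "i < n" for i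
    proof -
      have "a i \<in> sets \<mu>" using PiE_mem[OF a(1), of i] that P(2) by auto
      from measurable_sets[OF meas[of i] this] show ?thesis
        by (rule back_subst) auto
    qed
    then have "{x \<in> space \<mu>. \<forall>i\<in>{..<n}. (f ^^ i) x \<in> a i} \<in> sets \<mu>"
      by (intro sets.sets_Collect_finite_All) auto
    then show "B \<in> sets \<mu>" unfolding a(2) by (simp only: Ball_def lessThan_iff)
  qed
  show "disjoint (dynamical_partition \<mu> f P n)"
  proof (rule disjointI)
    fix B C assume B: "B \<in> dynamical_partition \<mu> f P n" and C: "C \<in> dynamical_partition \<mu> f P n" and ne: "B \<noteq> C"
    obtain a where a: "a \<in> {..<n} \<rightarrow>\<^sub>E P" "B = ?B a" using B unfolding dp by blast
    obtain b where b: "b \<in> {..<n} \<rightarrow>\<^sub>E P" "C = ?B b" using C unfolding dp by blast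
    have "a \<noteq> b" using ne a(2) b(2) by blast
    then obtain i where i: "i \<in> {..<n}" "a i \<noteq> b i"
      using PiE_ext[OF a(1) b(1)] by blast
    have "a i \<inter> b i = {}"
      using disjointD[OF P(4) PiE_mem[OF a(1) i(1)] PiE_mem[OF b(1) i(1)] i(2)] .
    then show "B \<inter> C = {}" using i(1) a(2) b(2) by auto
  qed
  show "\<Union>(dynamical_partition \<mu> f P n) = space \<mu>"
  proof
    show "\<Union>(dynamical_partition \<mu> f P n) \<subseteq> space \<mu>" unfolding dp by blast
    show "space \<mu> \<subseteq> \<Union>(dynamical_partition \<mu> f P n)"
    proof
      fix x assume x: "x \<in> space \<mu>"
      have "\<exists>p\<in>P. (f ^^ i) x \<in> p" for i
        using measurable_space[OF meas x, of i] P(3) by blast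
      then obtain a where a: "\<And>i. a i \<in> P" "\<And>i. (f ^^ i) x \<in> a i" by metis
      have "x \<in> ?B (restrict a {..<n})" using x a(2) by simp
      moreover have "restrict a {..<n} \<in> {..<n} \<rightarrow>\<^sub>E P" using a(1) by simp
      ultimately show "x \<in> \<Union>(dynamical_partition \<mu> f P n)" unfolding dp by blast
    qed
  qed
qed

lemma sum_measure_dynamical_partition:
  assumes "prob_space \<mu>" "f \<in> measurable \<mu> \<mu>" "finite_partition \<mu> P"
  shows "(\<Sum>B\<in>dynamical_partition \<mu> f P n. measure \<mu> B) = 1"
proof -
  interpret prob_space \<mu> by fact
  note dp = dynamical_partition[OF assms(2,3), of n]
  have "(\<Sum>B\<in>dynamical_partition \<mu> f P n. measure \<mu> B) = measure \<mu> (\<Union>B\<in>dynamical_partition \<mu> f P n. B)"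
    by (rule finite_measure_finite_Union[symmetric])
       (use dp in \<open>auto simp: disjoint_family_on_def dest: disjointD\<close>)
  then show ?thesis using dp(4) prob_space by simp
qed

text \<open>At most one atom of each dynamical partition carries a given point, so the number of atoms of
  positive mass stays bounded.\<close>

lemma measure_entropy_finite_support:
  assumes "prob_space \<mu>" "f \<in> measurable \<mu> \<mu>" "finite Q" "Q \<in> sets \<mu>" "measure \<mu> Q = 1"
  shows "measure_entropy \<mu> f \<le> 0"
proof -
  interpret prob_space \<mu> by fact
  have "entropy_wrt \<mu> f P = 0" if P: "finite_partition \<mu> P" for P
  proof -
    define D where "D n = dynamical_partition \<mu> f P n" for n
    note dp = dynamical_partition[OF assms(2) P, folded D_def]
    have null: "measure \<mu> B = 0" if "B \<in> D n" "B \<inter> Q = {}" for B n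
    proof -
      have "B \<subseteq> space \<mu> - Q" "B \<in> sets \<mu>" using that dp(2)[of n] sets.sets_into_space by blast+
      then have "measure \<mu> B \<le> measure \<mu> (space \<mu> - Q)"
        using assms(4) by (intro finite_measure_mono) auto
      also have "\<dots> = 0" using prob_compl[OF assms(4)] assms(5) by simp
      finally show ?thesis using measure_nonneg[of \<mu> B] by linarith
    qed
    have card_le: "card {B \<in> D n. B \<inter> Q \<noteq> {}} \<le> card Q" for n
    proof -
      have "\<forall>B\<in>{B \<in> D n. B \<inter> Q \<noteq> {}}. \<exists>x. x \<in> B \<and> x \<in> Q" by blast
      then obtain c where c: "\<And>B. B \<in> {B \<in> D n. B \<inter> Q \<noteq> {}} \<Longrightarrow> c B \<in> B \<and> c B \<in> Q" by metis
      have "inj_on c {B \<in> D n. B \<inter> Q \<noteq> {}}"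
      proof (rule inj_onI, rule ccontr)
        fix B C assume *: "B \<in> {B \<in> D n. B \<inter> Q \<noteq> {}}" "C \<in> {B \<in> D n. B \<inter> Q \<noteq> {}}" "c B = c C" "B \<noteq> C"
        then have "B \<inter> C = {}" using disjointD[OF dp(3)[of n], of B C] by simp
        moreover have "c B \<in> B" "c C \<in> C" using c *(1,2) by auto
        ultimately show False using *(3) by auto
      qed
      moreover have "c ` {B \<in> D n. B \<inter> Q \<noteq> {}} \<subseteq> Q" using c by auto
      ultimately show ?thesis using card_inj_on_le assms(3) by blast
    qed
    have bounds: "0 \<le> partition_entropy \<mu> (D n)" "partition_entropy \<mu> (D n) \<le> real (card Q)" for n
    proof -
      have pe: "partition_entropy \<mu> (D n) = (\<Sum>B\<in>D n. - (measure \<mu> B * ln (measure \<mu> B)))"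
        by (simp add: partition_entropy_def sum_negf)
      show "0 \<le> partition_entropy \<mu> (D n)"
        unfolding pe by (intro sum_nonneg entropy_term_bounds) auto
      have "partition_entropy \<mu> (D n) = (\<Sum>B\<in>{B \<in> D n. B \<inter> Q \<noteq> {}}. - (measure \<mu> B * ln (measure \<mu> B)))"
        unfolding pe using dp(1)[of n] null by (intro sum.mono_neutral_right) auto
      also have "\<dots> \<le> (\<Sum>B\<in>{B \<in> D n. B \<inter> Q \<noteq> {}}. 1)"
        by (intro sum_mono entropy_term_bounds) auto
      also have "\<dots> \<le> real (card Q)" using card_le[of n] by simp
      finally show "partition_entropy \<mu> (D n) \<le> real (card Q)" .
    qed
    have "(\<lambda>n. partition_entropy \<mu> (D n) / real n) \<longlonglongrightarrow> 0"
    proof (rule tendsto_sandwich[OF _ _ tendsto_const lim_const_over_n[of "real (card Q)"]])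
      show "\<forall>\<^sub>F n in sequentially. 0 \<le> partition_entropy \<mu> (D n) / real n"
        using bounds(1) by simp
      show "\<forall>\<^sub>F n in sequentially. partition_entropy \<mu> (D n) / real n \<le> real (card Q) / real n"
        using bounds(2) by (simp add: divide_right_mono)
    qed
    then show "entropy_wrt \<mu> f P = 0" unfolding entropy_wrt_def D_def by (rule limI)
  qed
  then show ?thesis
    unfolding measure_entropy_def by (intro SUP_least) simp
qed

text \<open>Every atom contributes \<open>- m ln m = - n m ln c\<close>, also those of mass \<open>m = 0\<close>, and the masses add up
  to \<open>1\<close>; the atoms of positive mass need not be counted.\<close>

lemma measure_entropy_uniform:
  assumes "prob_space \<mu>" "f \<in> measurable \<mu> \<mu>" "finite_partition \<mu> P" "0 < c"
    and unif: "\<And>n B. B \<in> dynamical_partition \<mu> f P n \<Longrightarrow> measure \<mu> B = 0 \<or> measure \<mu> B = c ^ n"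
  shows "ereal (- ln c) \<le> measure_entropy \<mu> f"
proof -
  have "partition_entropy \<mu> (dynamical_partition \<mu> f P n) = - ln c * real n" for n
  proof -
    have "measure \<mu> B * ln (measure \<mu> B) = measure \<mu> B * (real n * ln c)"
      if "B \<in> dynamical_partition \<mu> f P n" for B
      using unif[OF that] assms(4) by (auto simp: ln_realpow)
    then have "partition_entropy \<mu> (dynamical_partition \<mu> f P n)
        = - ((\<Sum>B\<in>dynamical_partition \<mu> f P n. measure \<mu> B) * (real n * ln c))"
      unfolding partition_entropy_def sum_distrib_right by (intro arg_cong[of _ _ uminus] sum.cong refl)
    then show ?thesis
      unfolding sum_measure_dynamical_partition[OF assms(1-3)] by simp
  qed
  then have "\<forall>\<^sub>F n in sequentially. - ln c = partition_entropy \<mu> (dynamical_partition \<mu> f P n) / real n"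
    by (intro eventually_sequentiallyI[of 1]) simp
  from Lim_transform_eventually[OF tendsto_const this]
  have "entropy_wrt \<mu> f P = - ln c"
    unfolding entropy_wrt_def by (rule limI)
  moreover have "ereal (entropy_wrt \<mu> f P) \<le> measure_entropy \<mu> f"
    unfolding measure_entropy_def using assms(3) by (intro SUP_upper) simp
  ultimately show ?thesis by simp
qed

text \<open>If blocks with \<open>m\<close> zeros cover every position then they follow each other without
  interruption.\<close>

lemma gap_every_position_periodic:
  assumes "\<And>c. \<exists>i. c - int m \<le> i \<and> i \<le> c \<and> gap m i \<omega>"
  shows "\<omega> (c + int m + 1) = \<omega> c"
proof -
  obtain i where i: "c - int m \<le> i" "i \<le> c" "gap m i \<omega>" using assms by blast
  show ?thesis
  proof (cases "i = c")
    case True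
    then show ?thesis using i(3) by (simp add: gap_def)
  next
    case False
    then have c0: "\<omega> c = 0" using i by (simp add: gap_def)
    obtain j where j: "i + int m + 1 - int m \<le> j" "j \<le> i + int m + 1" "gap m j \<omega>" using assms by blast
    have "\<omega> (i + int m + 1) = 2" using i(3) by (simp add: gap_def)
    then have "j = i + int m + 1"
      using j unfolding gap_def by (metis add.commute diff_le_eq le_less zero_neq_numeral)
    then have "\<omega> (c + int m + 1) = 0" using j(3) i False by (simp add: gap_def)
    then show ?thesis using c0 by simp
  qed
qed

lemma periodic_mod:
  assumes "\<And>c. \<omega> (c + int m + 1) = \<omega> c"
  shows "\<omega> k = \<omega> (k mod (int m + 1))"
proof -
  have "\<omega> (c + j * (int m + 1)) = \<omega> c" for c j
  proof (induction j rule: int_induct[where k=0])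
    case (step1 j)
    then show ?case using assms[of "c + j * (int m + 1)"] by (simp add: algebra_simps)
  next
    case (step2 j)
    then show ?case using assms[of "c + (j - 1) * (int m + 1)"] by (simp add: algebra_simps)
  qed simp
  from this[of "k mod (int m + 1)" "k div (int m + 1)"] show ?thesis
    by (simp add: mult.commute)
qed

context shift_coding
begin

text \<open>By invariance almost every itinerary is covered by blocks with \<open>m\<close> zeros at every position,
  hence periodic with period \<open>m + 1\<close>. This leaves finitely many points.\<close>

lemma full_gap_weight_entropy:
  assumes \<mu>: "\<mu> \<in> invariants" and full: "gap_weight \<mu> m = 1"
  shows "measure_entropy \<mu> f \<le> 0"
proof -
  interpret prob_space \<mu> using invariantsD(3)[OF \<mu>] .
  have sets: "in_gap m c \<in> sets \<mu>" for c using sets_in_gap invariantsD(1)[OF \<mu>] by simp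
  define Q where "Q = (\<Inter>c. in_gap m c)"
  have Qs: "Q \<in> sets \<mu>" unfolding Q_def by (rule sets.countable_INT) (auto simp: sets)
  have "AE z in \<mu>. z \<in> in_gap m c" for c
    using prob_eq_1[OF sets] measure_in_gap[OF \<mu>] full by simp
  then have "AE z in \<mu>. \<forall>c. z \<in> in_gap m c" by (simp add: AE_all_countable)
  then have "AE z in \<mu>. z \<in> Q" by (simp add: Q_def)
  then have Q1: "prob Q = 1" using prob_eq_1[OF Qs] by simp
  have per: "code z k = code z (k mod (int m + 1))" if z: "z \<in> Q" for z k
  proof (rule periodic_mod, rule gap_every_position_periodic)
    show "\<exists>i. c - int m \<le> i \<and> i \<le> c \<and> gap m i (code z)" for c
    proof -
      have "z \<in> in_gap m c" using z by (simp add: Q_def)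
      then show ?thesis unfolding in_gap_def gap_set_def by auto
    qed
  qed
  have QX: "z \<in> topspace X" if "z \<in> Q" for z
  proof -
    have "z \<in> in_gap m 0" using that by (simp add: Q_def)
    then show ?thesis unfolding in_gap_def gap_set_def by blast
  qed
  have "inj_on (\<lambda>z. restrict (code z) {0..int m}) Q"
  proof (rule inj_onI)
    fix y z assume yz: "y \<in> Q" "z \<in> Q" "restrict (code y) {0..int m} = restrict (code z) {0..int m}"
    have "code y k = code z k" for k
    proof -
      have "k mod (int m + 1) \<in> {0..int m}" using pos_mod_bound[of "int m + 1" k] by simp
      then have "code y (k mod (int m + 1)) = code z (k mod (int m + 1))"
        using yz(3) by (metis restrict_apply')
      then show ?thesis using per yz(1,2) by metis
    qed
    then have "code y = code z" by blast
    then show "y = z" using dec_code[OF QX[OF yz(1)]] dec_code[OF QX[OF yz(2)]] by metis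
  qed
  moreover have "(\<lambda>z. restrict (code z) {0..int m}) ` Q \<subseteq> {0..int m} \<rightarrow>\<^sub>E {..<3}"
    using code_less QX by auto
  moreover have "finite ({0..int m} \<rightarrow>\<^sub>E {..<3::nat})" by (intro finite_PiE) auto
  ultimately have "finite Q" using inj_on_finite by blast
  then show ?thesis
    using measure_entropy_finite_support[OF invariantsD(3,4)[OF \<mu>]] Qs Q1 by blast
qed

end

section \<open>Invariant measures with prescribed block frequencies\<close>

context shift_coding
begin

lemma invariantsI:
  assumes "sets \<mu> = sets (borel_of X)" "prob_space \<mu>" "distr \<mu> (borel_of X) f = \<mu>"
  shows "\<mu> \<in> invariants"
proof -
  have "f \<in> measurable \<mu> \<mu>"
    using measurable_f measurable_cong_sets[OF assms(1) assms(1)] by simp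
  moreover have "distr \<mu> \<mu> f = distr \<mu> (borel_of X) f"
    by (rule distr_cong) (simp_all add: assms(1))
  ultimately show ?thesis using assms by (simp add: invariant_measures_def)
qed

lemma invariants_distr:
  assumes "prob_space N" "g \<in> measurable N (borel_of X)" "T \<in> measurable N N" "distr N N T = N"
    and "\<And>x. x \<in> space N \<Longrightarrow> f (g x) = g (T x)"
  shows "distr N (borel_of X) g \<in> invariants"
proof (rule invariantsI)
  show "prob_space (distr N (borel_of X) g)"
    by (rule prob_space.prob_space_distr[OF assms(1,2)])
  have "distr (distr N (borel_of X) g) (borel_of X) f = distr N (borel_of X) (f \<circ> g)"
    by (rule distr_distr[OF measurable_f assms(2)])
  also have "\<dots> = distr N (borel_of X) (g \<circ> T)"
    by (rule distr_cong) (simp_all add: assms(5))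
  also have "\<dots> = distr (distr N N T) (borel_of X) g"
    by (rule distr_distr[OF assms(2,3), symmetric])
  finally show "distr (distr N (borel_of X) g) (borel_of X) f = distr N (borel_of X) g"
    by (simp only: assms(4))
qed simp

definition spaced_twos :: "nat \<Rightarrow> int \<Rightarrow> nat" where
  "spaced_twos m k = (if k mod (int m + 1) = 0 then 2 else 0)"

definition periodic_measure :: "nat \<Rightarrow> 'a measure" where
  "periodic_measure m = distr (measure_pmf (pmf_of_set {..m})) (borel_of X) (\<lambda>i. dec (\<lambda>k. spaced_twos m (k + int i)))"

lemma gap_spaced_twos: "gap m 0 (spaced_twos m)"
  by (auto simp: gap_def spaced_twos_def)

lemma bij_betw_Suc_mod: "bij_betw (\<lambda>i. Suc i mod Suc m) {..m} {..m}"
proof -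
  have "inj_on (\<lambda>i. Suc i mod Suc m) {..m}"
  proof (rule inj_onI)
    fix i j assume "i \<in> {..m}" "j \<in> {..m}" "Suc i mod Suc m = Suc j mod Suc m"
    then show "i = j"
      by (cases "i = m"; cases "j = m") (auto simp: mod_if split: if_splits)
  qed
  moreover have "(\<lambda>i. Suc i mod Suc m) ` {..m} \<subseteq> {..m}"
    by (auto simp: less_Suc_eq_le[symmetric])
  ultimately show ?thesis
    by (simp add: bij_betw_def endo_inj_surj)
qed

lemma measurable_pmf_dec: "(\<lambda>i. dec (w i)) \<in> measurable (measure_pmf p) (borel_of X)"
  using dec_in by (simp add: measurable_def)

lemma periodic_invariant: "periodic_measure m \<in> invariants"
  unfolding periodic_measure_def
proof (rule invariants_distr[where T="\<lambda>i. Suc i mod Suc m"])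
  show "prob_space (measure_pmf (pmf_of_set {..m}))" by (rule measure_pmf.prob_space_axioms)
  have "map_pmf (\<lambda>i. Suc i mod Suc m) (pmf_of_set {..m}) = pmf_of_set {..m}"
    by (rule map_pmf_of_set_bij_betw[OF bij_betw_Suc_mod]) auto
  then have "measure_pmf (pmf_of_set {..m}) = distr (measure_pmf (pmf_of_set {..m})) (count_space UNIV) (\<lambda>i. Suc i mod Suc m)"
    by (metis map_pmf_rep_eq)
  also have "\<dots> = distr (measure_pmf (pmf_of_set {..m})) (measure_pmf (pmf_of_set {..m})) (\<lambda>i. Suc i mod Suc m)"
    by (rule distr_cong) simp_all
  finally show "distr (measure_pmf (pmf_of_set {..m})) (measure_pmf (pmf_of_set {..m})) (\<lambda>i. Suc i mod Suc m) = measure_pmf (pmf_of_set {..m})"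
    by (rule sym)
  fix i
  have "(k + 1 + int i) mod (int m + 1) = (k + int (Suc i mod Suc m)) mod (int m + 1)" for k
  proof -
    have "int (Suc i mod Suc m) = (1 + int i) mod (int m + 1)"
      by (simp add: zmod_int add.commute)
    then show ?thesis by (simp add: mod_add_right_eq add.assoc)
  qed
  then show "f (dec (\<lambda>k. spaced_twos m (k + int i))) = dec (\<lambda>k. spaced_twos m (k + int (Suc i mod Suc m)))"
    by (simp add: f_dec left_shift_def spaced_twos_def)
  show "(\<lambda>i. dec (\<lambda>k. spaced_twos m (k + int i))) \<in> measurable (measure_pmf (pmf_of_set {..m})) (borel_of X)"
    by (rule measurable_pmf_dec)
qed simp

text \<open>The orbit has \<open>m + 1\<close> points, and at one of them a block starts; so the \<open>m\<close>-th weight is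
  at least \<open>1\<close>, which leaves nothing for the others.\<close>

lemma gap_weight_periodic: "gap_weight (periodic_measure m) = unit_weight m"
proof (rule weights_eq_unit[OF gap_weight_weights[OF periodic_invariant]])
  have "code (dec (spaced_twos m)) = spaced_twos m"
    by (auto simp: code_dec spaced_twos_def)
  then have "dec (spaced_twos m) \<in> gap_set m 0"
    using dec_in gap_spaced_twos by (simp add: gap_set_def)
  then have sub: "{0} \<subseteq> (\<lambda>i. dec (\<lambda>k. spaced_twos m (k + int i))) -` gap_set m 0" by simp
  have "1 / (real m + 1) = measure (measure_pmf (pmf_of_set {..m})) {0}"
    by (simp add: measure_pmf_single)
  also have "\<dots> \<le> measure (measure_pmf (pmf_of_set {..m})) ((\<lambda>i. dec (\<lambda>k. spaced_twos m (k + int i))) -` gap_set m 0)"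
    by (rule measure_pmf.finite_measure_mono[OF sub]) simp
  also have "\<dots> = measure (periodic_measure m) (gap_set m 0)"
    unfolding periodic_measure_def
    by (subst measure_distr[OF measurable_pmf_dec sets_gap_set]) simp
  finally show "1 \<le> gap_weight (periodic_measure m) m"
    by (simp add: gap_weight_def field_simps)
qed

abbreviation coin :: "nat measure" where "coin \<equiv> measure_pmf (pmf_of_set {0, 1})"

abbreviation coins :: "(int \<Rightarrow> nat) measure" where "coins \<equiv> Pi\<^sub>M UNIV (\<lambda>_. coin)"

definition bernoulli_measure :: "'a measure" where
  "bernoulli_measure = distr coins (borel_of X) dec"

lemma measurable_dec_coins: "dec \<in> measurable coins (borel_of X)"
proof -
  have "sets coins = sets (Pi\<^sub>M UNIV (\<lambda>_. count_space UNIV))"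
    by (rule sets_PiM_cong) simp_all
  then show ?thesis using measurable_dec by (simp cong: measurable_cong_sets)
qed

lemma product_prob_space_coins: "product_prob_space (\<lambda>_::int. coin)"
  by (intro product_prob_spaceI measure_pmf.prob_space_axioms)

lemma space_coins [simp]: "space coins = UNIV"
  by (simp add: space_PiM PiE_def)

lemma bernoulli_invariant: "bernoulli_measure \<in> invariants"
  unfolding bernoulli_measure_def
proof (rule invariants_distr[OF _ measurable_dec_coins, where T=left_shift])
  show "prob_space coins" by (intro prob_space_PiM measure_pmf.prob_space_axioms)
  have "(\<lambda>\<omega>. \<lambda>n\<in>UNIV. \<omega> (n + 1)) = left_shift"
    by (simp add: fun_eq_iff left_shift_def)
  moreover have "distr coins coins (\<lambda>\<omega>. \<lambda>n\<in>UNIV. \<omega> (n + 1)) = coins"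
    using distr_PiM_reindex[of UNIV "\<lambda>_. coin" "\<lambda>n::int. n + 1" UNIV] by (simp add: inj_on_def measure_pmf.prob_space_axioms)
  ultimately show "distr coins coins left_shift = coins" by simp
  show "left_shift \<in> measurable coins coins"
    unfolding left_shift_def[abs_def]
    by (rule measurable_PiM_single') (auto intro: measurable_component_singleton)
qed (simp add: f_dec)

lemma measure_coin_digit:
  "measure coin {d. min d 2 = a} = (if a = 0 \<or> a = 1 then 1/2 else 0)"
proof -
  have "{0, 1} \<inter> {d. min d 2 = a} = (if a = 0 \<or> a = 1 then {a} else {})"
    by (auto simp: min_def)
  then show ?thesis by (subst measure_pmf_of_set) auto
qed

lemma measure_bernoulli_cylinder:
  "measure bernoulli_measure {z \<in> topspace X. \<forall>i<n. code z (int i) = w i} =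
    (\<Prod>i<n. if w i = 0 \<or> w i = 1 then 1/2 else 0)"
proof -
  interpret product_prob_space "\<lambda>_::int. coin" UNIV by (rule product_prob_space_coins)
  have "{z \<in> space (borel_of X). \<forall>i\<in>{..<n}. code z (int i) = w i} \<in> sets (borel_of X)"
    by measurable
  then have sets: "{z \<in> topspace X. \<forall>i<n. code z (int i) = w i} \<in> sets (borel_of X)"
    by (simp only: Ball_def lessThan_iff space_borel_of)
  have pre: "dec -` {z \<in> topspace X. \<forall>i<n. code z (int i) = w i} \<inter> space coins
      = {\<omega> \<in> space coins. \<forall>k\<in>int ` {..<n}. \<omega> k \<in> {d. min d 2 = w (nat k)}}"
    using dec_in by (auto simp: code_dec)
  have "measure bernoulli_measure {z \<in> topspace X. \<forall>i<n. code z (int i) = w i}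
      = measure coins {\<omega> \<in> space coins. \<forall>k\<in>int ` {..<n}. \<omega> k \<in> {d. min d 2 = w (nat k)}}"
    unfolding bernoulli_measure_def measure_distr[OF measurable_dec_coins sets] pre ..
  also have "\<dots> = (\<Prod>k\<in>int ` {..<n}. measure coin {d. min d 2 = w (nat k)})"
  proof (rule measure_eq_emeasure_eq_ennreal)
    have "emeasure coins {\<omega> \<in> space coins. \<forall>k\<in>int ` {..<n}. \<omega> k \<in> {d. min d 2 = w (nat k)}}
        = (\<Prod>k\<in>int ` {..<n}. emeasure coin {d. min d 2 = w (nat k)})"
      by (rule emeasure_PiM_Collect) auto
    also have "\<dots> = ennreal (\<Prod>k\<in>int ` {..<n}. measure coin {d. min d 2 = w (nat k)})"
      unfolding measure_pmf.emeasure_eq_measure by (rule prod_ennreal) simp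
    finally show "emeasure coins {\<omega> \<in> space coins. \<forall>k\<in>int ` {..<n}. \<omega> k \<in> {d. min d 2 = w (nat k)}}
        = ennreal (\<Prod>k\<in>int ` {..<n}. measure coin {d. min d 2 = w (nat k)})" .
  qed (simp add: prod_nonneg)
  also have "\<dots> = (\<Prod>i<n. measure coin {d. min d 2 = w i})"
    by (subst prod.reindex) (auto simp: inj_on_def)
  finally show ?thesis by (simp only: measure_coin_digit)
qed

lemma gap_weight_bernoulli: "gap_weight bernoulli_measure = (\<lambda>_. 0)"
proof
  fix n
  interpret prob_space bernoulli_measure using invariantsD(3)[OF bernoulli_invariant] .
  have "measure bernoulli_measure (gap_set n 0) \<le> measure bernoulli_measure {z \<in> topspace X. \<forall>i<Suc 0. code z (int i) = 2}"
  proof (rule finite_measure_mono)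
    show "{z \<in> topspace X. \<forall>i<Suc 0. code z (int i) = 2} \<in> sets bernoulli_measure"
      using openin_sets[OF openin_code[of 0 2]] invariantsD(1)[OF bernoulli_invariant] by simp
  qed (auto simp: gap_set_def gap_def)
  also have "\<dots> = 0" unfolding measure_bernoulli_cylinder by simp
  finally have "measure bernoulli_measure (gap_set n 0) = 0"
    using measure_nonneg[of bernoulli_measure "gap_set n 0"] by linarith
  then show "gap_weight bernoulli_measure n = 0" by (simp add: gap_weight_def)
qed

lemma code_funpow:
  "z \<in> topspace X \<Longrightarrow> (f ^^ n) z \<in> topspace X \<and> code ((f ^^ n) z) 0 = code z (int n)"
proof (induction n arbitrary: z)
  case (Suc n)
  have "(f ^^ Suc n) z = (f ^^ n) (f z)" by (simp only: funpow_Suc_right o_apply)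
  moreover have "code (f z) (int n) = code z (int (Suc n))"
    using code_f[OF Suc.prems] by (simp add: left_shift_def add.commute)
  ultimately show ?case using Suc.IH[OF f_in[OF Suc.prems]] by simp
qed simp

text \<open>For the partition by the digit at the origin, an atom fixes \<open>n\<close> digits and has mass
  \<open>2\<^sup>-\<^sup>n\<close>, or \<open>0\<close> if a digit \<open>2\<close> occurs.\<close>

lemma bernoulli_entropy: "ereal (ln 2) \<le> measure_entropy bernoulli_measure f"
proof -
  let ?\<mu> = bernoulli_measure
  define cyl where "cyl a = {z \<in> topspace X. code z 0 = a}" for a
  note inv = invariantsD[OF bernoulli_invariant]
  have P: "finite_partition ?\<mu> (cyl ` {..<3})"
    unfolding finite_partition_def
  proof (intro conjI partition_onI)
    show "cyl ` {..<3} \<subseteq> sets ?\<mu>"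
      using openin_sets[OF openin_code] inv(1) by (auto simp: cyl_def)
    show "\<Union>(cyl ` {..<3}) = space ?\<mu>" using inv(2) code_less by (auto simp: cyl_def)
    have "dec (\<lambda>_. a) \<in> cyl a" if "a < 3" for a
      using dec_in that by (simp add: cyl_def code_dec)
    then show "{} \<notin> cyl ` {..<3}" by blast
    show "disjnt p q" if "p \<in> cyl ` {..<3}" "q \<in> cyl ` {..<3}" "p \<noteq> q" for p q
      using that by (auto simp: cyl_def disjnt_def)
  qed simp
  have "ereal (- ln (1/2)) \<le> measure_entropy ?\<mu> f"
  proof (rule measure_entropy_uniform[OF inv(3,4) P])
    fix n B assume "B \<in> dynamical_partition ?\<mu> f (cyl ` {..<3}) n"
    then obtain a where a: "a \<in> {..<n} \<rightarrow>\<^sub>E cyl ` {..<3}" "B = {x \<in> space ?\<mu>. \<forall>i<n. (f ^^ i) x \<in> a i}"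
      unfolding dynamical_partition_def by blast
    have "\<forall>i\<in>{..<n}. \<exists>c. a i = cyl c" using a(1) by (auto dest!: PiE_mem)
    then obtain w where w: "\<And>i. i < n \<Longrightarrow> a i = cyl (w i)" by (metis lessThan_iff)
    have "B = {z \<in> topspace X. \<forall>i<n. code z (int i) = w i}"
      unfolding a(2) inv(2) using w code_funpow by (auto simp: cyl_def)
    then have m: "measure ?\<mu> B = (\<Prod>i<n. if w i = 0 \<or> w i = 1 then 1/2 else 0)"
      by (simp only: measure_bernoulli_cylinder)
    show "measure ?\<mu> B = 0 \<or> measure ?\<mu> B = (1/2) ^ n"
    proof (cases "\<forall>i<n. w i = 0 \<or> w i = 1")
      case True
      then have "measure ?\<mu> B = (\<Prod>i<n. 1/2)"
        unfolding m by (intro prod.cong) auto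
      then show ?thesis by simp
    next
      case False
      then have "measure ?\<mu> B = 0" unfolding m by (intro prod_zero) auto
      then show ?thesis ..
    qed
  qed simp
  then show ?thesis by (simp add: ln_div)
qed

lemma mixture:
  assumes "\<And>k::nat. M k \<in> invariants"
  shows "measure_pmf p \<bind> M \<in> invariants"
    and "A \<in> sets (borel_of X) \<Longrightarrow> emeasure (measure_pmf p \<bind> M) A = (\<integral>\<^sup>+k. emeasure (M k) A \<partial>measure_pmf p)"
proof -
  note inv = invariantsD[OF assms]
  have M: "M \<in> measurable (measure_pmf p) (subprob_algebra (borel_of X))"
    using inv(1,3) by (auto simp: measurable_def space_subprob_algebra prob_space_imp_subprob_space)
  have sets: "sets (measure_pmf p \<bind> M) = sets (borel_of X)"
    by (rule sets_bind[OF sets_kernel[OF M]]) simp_all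
  have em: "emeasure (measure_pmf p \<bind> M) A = (\<integral>\<^sup>+k. emeasure (M k) A \<partial>measure_pmf p)"
    if "A \<in> sets (borel_of X)" for A
    by (rule emeasure_bind[OF _ M that]) simp
  then show "A \<in> sets (borel_of X) \<Longrightarrow> emeasure (measure_pmf p \<bind> M) A = (\<integral>\<^sup>+k. emeasure (M k) A \<partial>measure_pmf p)" .
  have prob: "prob_space (measure_pmf p \<bind> M)"
    by (rule measure_pmf.prob_space_bind[OF _ M]) (use inv(3) in simp)
  show "measure_pmf p \<bind> M \<in> invariants"
  proof (rule invariantsI[OF sets prob], rule measure_eqI)
    fix A assume "A \<in> sets (distr (measure_pmf p \<bind> M) (borel_of X) f)"
    then have A: "A \<in> sets (borel_of X)" by simp
    have f: "f \<in> measurable (measure_pmf p \<bind> M) (borel_of X)"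
      using measurable_f by (simp cong: measurable_cong_sets add: sets)
    have fA: "f -` A \<inter> topspace X \<in> sets (borel_of X)"
      using measurable_sets[OF measurable_f A] by simp
    have "emeasure (distr (measure_pmf p \<bind> M) (borel_of X) f) A = emeasure (measure_pmf p \<bind> M) (f -` A \<inter> topspace X)"
      using emeasure_distr[OF f A] sets_eq_imp_space_eq[OF sets] by simp
    also have "\<dots> = (\<integral>\<^sup>+k. emeasure (M k) (f -` A \<inter> topspace X) \<partial>measure_pmf p)"
      by (rule em[OF fA])
    also have "\<dots> = (\<integral>\<^sup>+k. emeasure (M k) A \<partial>measure_pmf p)"
    proof (rule nn_integral_cong)
      fix k
      show "emeasure (M k) (f -` A \<inter> topspace X) = emeasure (M k) A"
        using emeasure_distr[OF inv(4)[of k], of A] A inv(1,2,5)[of k] by simp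
    qed
    also have "\<dots> = emeasure (measure_pmf p \<bind> M) A" by (rule em[OF A, symmetric])
    finally show "emeasure (distr (measure_pmf p \<bind> M) (borel_of X) f) A = emeasure (measure_pmf p \<bind> M) A" .
  qed (simp add: sets)
qed

text \<open>The periodic orbits are mixed with the given weights. The remaining mass goes to the Bernoulli
  measure, which sees no blocks at all.\<close>

lemma weights_realised:
  assumes q: "q \<in> weights" obtains \<mu> where "\<mu> \<in> invariants" "gap_weight \<mu> = q"
proof -
  define M where "M k = (case k of 0 \<Rightarrow> bernoulli_measure | Suc n \<Rightarrow> periodic_measure n)" for k
  define c where "c k = (case k of 0 \<Rightarrow> 1 - suminf q | Suc n \<Rightarrow> q n)" for k
  have c_nonneg: "0 \<le> c k" for k using q by (auto simp: c_def weights_def split: nat.split)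
  have "c sums (suminf q + c 0)"
    using q by (intro sums_Suc) (simp add: c_def weights_def summable_sums)
  then have "c sums 1" by (simp add: c_def)
  then have "(\<Sum>k. ennreal (c k)) = 1"
    using suminf_ennreal_eq[OF c_nonneg] by simp
  then have "(\<integral>\<^sup>+k. ennreal (c k) \<partial>count_space UNIV) = 1"
    by (simp add: nn_integral_count_space_nat)
  then have pmf_c: "pmf (embed_pmf c) k = c k" for k
    by (rule pmf_embed_pmf[OF c_nonneg])
  have inv: "M k \<in> invariants" for k
    by (simp add: M_def bernoulli_invariant periodic_invariant split: nat.split)
  define \<mu> where "\<mu> = measure_pmf (embed_pmf c) \<bind> M"
  have mu: "\<mu> \<in> invariants" unfolding \<mu>_def by (rule mixture(1)[OF inv])
  interpret prob_space \<mu> using invariantsD(3)[OF mu] .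
  have "gap_weight \<mu> = q"
  proof
    fix n
    have "(real n + 1) * measure (M k) (gap_set n 0) = indicator {Suc n} k" for k
      using fun_cong[OF gap_weight_bernoulli, of n] fun_cong[OF gap_weight_periodic, of "k - 1" n]
      by (cases k) (auto simp: M_def gap_weight_def unit_weight_def)
    then have meas: "measure (M k) (gap_set n 0) = 1 / (real n + 1) * indicator {Suc n} k" for k
      by (simp add: field_simps)
    have "emeasure (M k) (gap_set n 0) = ennreal (1 / (real n + 1)) * indicator {Suc n} k" for k
    proof -
      interpret Mk: prob_space "M k" using invariantsD(3)[OF inv] .
      show ?thesis unfolding Mk.emeasure_eq_measure meas by (simp add: indicator_def)
    qed
    then have "emeasure \<mu> (gap_set n 0) = (\<integral>\<^sup>+k. ennreal (1 / (real n + 1)) * indicator {Suc n} k \<partial>measure_pmf (embed_pmf c))"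
      unfolding \<mu>_def using mixture(2)[where M=M and p="embed_pmf c", OF inv sets_gap_set] by simp
    also have "\<dots> = ennreal (1 / (real n + 1)) * ennreal (q n)"
      by (subst nn_integral_cmult_indicator) (simp_all add: emeasure_pmf_single pmf_c c_def)
    also have "\<dots> = ennreal (1 / (real n + 1) * q n)"
      by (rule ennreal_mult''[symmetric]) (use q in \<open>simp add: weights_def\<close>)
    finally have "measure \<mu> (gap_set n 0) = 1 / (real n + 1) * q n"
      using q by (simp add: measure_eq_emeasure_eq_ennreal weights_def)
    then show "gap_weight \<mu> n = q n" by (simp add: gap_weight_def)
  qed
  with mu show ?thesis by (rule that)
qed

end

section \<open>Rotation set and entropy spectrum\<close>

text \<open>The factor \<open>n + 1\<close> is the number of positions that a block covers; it turns the probability that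
  a block starts at the origin into \<open>gap_weight\<close>, and \<open>rv\<close> into an affine function of the weights.\<close>

locale gap_potentials = shift_coding X f code dec
  for X :: "'a topology" and f code dec +
  fixes \<phi>s \<phi>u :: "'a \<Rightarrow> real" and L :: real
  assumes \<phi>u_gap: "z \<in> topspace X \<Longrightarrow> gap n 0 (code z) \<Longrightarrow> \<phi>u z = L + (real n + 1) * (radius n)\<^sup>2 / 4"
    and \<phi>u_no_gap: "z \<in> topspace X \<Longrightarrow> (\<And>n. \<not> gap n 0 (code z)) \<Longrightarrow> \<phi>u z = L"
    and \<phi>s_gap: "z \<in> topspace X \<Longrightarrow> gap n (- 1 - int n) (code z) \<Longrightarrow> - \<phi>s z = L + (real n + 1) * radius n / 4"
    and \<phi>s_no_gap: "z \<in> topspace X \<Longrightarrow> (\<And>n. \<not> gap n (- 1 - int n) (code z)) \<Longrightarrow> - \<phi>s z = L"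
begin

lemma summable_heights: "summable (\<lambda>n. (real n + 1) * radius n / 4)"
proof (rule summable_comparison_test'[of "\<lambda>n. (1/10) ^ n" 0])
  show "norm ((real n + 1) * radius n / 4) \<le> (1/10) ^ n" for n
  proof -
    have "real n + 1 \<le> 2 ^ n" by (induction n) auto
    then have "(real n + 1) * radius n \<le> 2 ^ n * radius n"
      using radius_pos[of n] by (intro mult_right_mono) auto
    also have "\<dots> = (1/10) ^ n"
      using power_mult_distrib[of 2 "1/20::real" n] by (simp add: radius_def)
    finally have "(real n + 1) * radius n \<le> (1/10) ^ n" .
    moreover have "(0::real) \<le> (1/10) ^ n" "0 \<le> (real n + 1) * radius n"
      using radius_pos[of n] by simp_all
    ultimately have "(real n + 1) * radius n / 4 \<le> (1/10) ^ n" by linarith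
    then show ?thesis using radius_pos[of n] by simp
  qed
qed simp

lemma summable_heights': "summable (\<lambda>n. (real n + 1) * (radius n)\<^sup>2 / 4)"
proof (rule summable_comparison_test'[OF summable_heights, of 0])
  fix n
  have "(radius n)\<^sup>2 \<le> radius n"
    using radius_pos[of n] radius_le_1[of n] by (simp add: power2_eq_square mult_left_le)
  then have "(real n + 1) * (radius n)\<^sup>2 \<le> (real n + 1) * radius n"
    by (intro mult_left_mono) auto
  then show "norm ((real n + 1) * (radius n)\<^sup>2 / 4) \<le> (real n + 1) * radius n / 4"
    by simp
qed

lemma rv_eq:
  assumes \<mu>: "\<mu> \<in> invariants"
  shows "rv \<phi>s \<phi>u \<mu> = (L, L) + barycentre (gap_weight \<mu>)"
proof -
  note sm = summable_radius[OF gap_weight_weights[OF \<mu>]]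
  have "(LINT z|\<mu>. \<phi>u z) = L + (\<Sum>n. ((real n + 1) * (radius n)\<^sup>2 / 4) * measure \<mu> (gap_set n 0))"
  proof (rule integral_gap_function[OF \<mu> summable_heights', where i="\<lambda>_. 0" and c=0])
    show "0 \<le> (real n + 1) * (radius n)\<^sup>2 / 4" for n by simp
  qed (simp_all add: \<phi>u_gap \<phi>u_no_gap)
  also have "(\<lambda>n. ((real n + 1) * (radius n)\<^sup>2 / 4) * measure \<mu> (gap_set n 0)) = (\<lambda>n. gap_weight \<mu> n * (radius n)\<^sup>2 / 4)"
    by (simp add: gap_weight_def fun_eq_iff)
  also have "(\<Sum>n. gap_weight \<mu> n * (radius n)\<^sup>2 / 4) = (\<Sum>n. gap_weight \<mu> n * (radius n)\<^sup>2) / 4"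
    by (rule suminf_divide[OF sm(2)])
  finally have u: "(LINT z|\<mu>. \<phi>u z) = L + (\<Sum>n. gap_weight \<mu> n * (radius n)\<^sup>2) / 4" .
  have "(LINT z|\<mu>. - \<phi>s z) = L + (\<Sum>n. ((real n + 1) * radius n / 4) * measure \<mu> (gap_set n 0))"
  proof (rule integral_gap_function[OF \<mu> summable_heights, where i="\<lambda>n. - 1 - int n" and c="- 1"])
    show "0 \<le> (real n + 1) * radius n / 4" for n using radius_pos[of n] by simp
    show "- \<phi>s z = L + (real n + 1) * radius n / 4" if "z \<in> topspace X" "gap n (- 1 - int n) (code z)" for z n
      using that by (rule \<phi>s_gap)
    show "- \<phi>s z = L" if "z \<in> topspace X" "\<And>n. \<not> gap n (- 1 - int n) (code z)" for z
      using that by (rule \<phi>s_no_gap)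
  qed simp_all
  also have "(\<lambda>n. ((real n + 1) * radius n / 4) * measure \<mu> (gap_set n 0)) = (\<lambda>n. gap_weight \<mu> n * radius n / 4)"
    by (simp add: gap_weight_def fun_eq_iff)
  also have "(\<Sum>n. gap_weight \<mu> n * radius n / 4) = (\<Sum>n. gap_weight \<mu> n * radius n) / 4"
    by (rule suminf_divide[OF sm(1)])
  finally have s: "- (LINT z|\<mu>. \<phi>s z) = L + (\<Sum>n. gap_weight \<mu> n * radius n) / 4"
    by simp
  show ?thesis unfolding rv_def u s by (simp add: barycentre_def)
qed

lemma RL_eq: "RL X f \<phi>s \<phi>u = (+) (L, L) ` parabola_hull"
proof
  show "RL X f \<phi>s \<phi>u \<subseteq> (+) (L, L) ` parabola_hull"
    unfolding RL_def parabola_hull_def using rv_eq gap_weight_weights by auto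
  show "(+) (L, L) ` parabola_hull \<subseteq> RL X f \<phi>s \<phi>u"
  proof
    fix w assume "w \<in> (+) (L, L) ` parabola_hull"
    then obtain q where q: "q \<in> weights" "w = (L, L) + barycentre q" by (auto simp: parabola_hull_def)
    obtain \<mu> where \<mu>: "\<mu> \<in> invariants" "gap_weight \<mu> = q" using weights_realised[OF q(1)] .
    have "w = rv \<phi>s \<phi>u \<mu>" using rv_eq[OF \<mu>(1)] \<mu>(2) q(2) by simp
    then show "w \<in> RL X f \<phi>s \<phi>u" unfolding RL_def using \<mu>(1) by (rule image_eqI)
  qed
qed

definition vertex :: "nat \<Rightarrow> real \<times> real" where
  "vertex m = (L, L) + barycentre (unit_weight m)"

abbreviation "extremes \<equiv> {w. w extreme_point_of RL X f \<phi>s \<phi>u}"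

lemma extremes_eq: "extremes = insert (L, L) (range vertex)"
proof -
  have "extremes = (+) (L, L) ` {x. x extreme_point_of parabola_hull}"
    unfolding RL_eq by (rule extreme_points_of_translation)
  then show ?thesis
    unfolding extreme_points_parabola_hull by (simp add: image_image vertex_def[abs_def])
qed

lemma vertex_tendsto: "vertex \<longlonglongrightarrow> (L, L)"
  unfolding vertex_def[abs_def]
  using tendsto_add[OF tendsto_const[of "(L, L)"] barycentre_unit_tendsto] by simp

lemma inj_vertex: "inj vertex"
  using inj_barycentre_unit by (simp add: inj_def vertex_def)

lemma vertex_ne: "vertex m \<noteq> (L, L)"
  using barycentre_unit_nonzero[of m] by (simp add: vertex_def)

lemma infinite_extremes: "infinite extremes"
  unfolding extremes_eq using range_inj_infinite[OF inj_vertex] by simp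

lemma countable_extremes: "countable extremes"
  unfolding extremes_eq by simp

lemma not_isolated: "\<not> (L, L) isolated_in extremes"
proof
  assume "(L, L) isolated_in extremes"
  then obtain T where T: "open T" "T \<inter> extremes = {(L, L)}" by (auto simp: isolated_in_def)
  then have "(L, L) \<in> T" by blast
  then have "\<forall>\<^sub>F m in sequentially. vertex m \<in> T"
    using vertex_tendsto T(1) by (simp add: tendsto_def)
  then obtain m where "vertex m \<in> T" by (auto simp: eventually_sequentially)
  moreover have "vertex m \<in> extremes" unfolding extremes_eq by simp
  ultimately show False using T(2) vertex_ne[of m] by blast
qed

lemma isolated_vertex: "vertex m isolated_in extremes"
proof -
  \<comment> \<open>The first coordinate exceeds \<open>L\<close> by \<open>20 r\<close> at this vertex, by at most \<open>r\<close> at the later ones, and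
    by at least \<open>400 r\<close> at the earlier ones.\<close>
  define r where "r = radius m / 80"
  have r: "0 < r" using radius_pos[of m] by (simp add: r_def)
  define T where "T = {w :: real \<times> real. L + 10 * r < fst w} \<inter> {w. fst w < L + 100 * r}"
  have "open T" unfolding T_def by (intro open_Int open_Collect_less continuous_intros)
  moreover have "T \<inter> extremes = {vertex m}"
  proof -
    have fst_v: "fst (vertex n) = L + radius n / 4" for n
      by (simp add: vertex_def barycentre_unit)
    have "n = m" if "vertex n \<in> T" for n
    proof (rule ccontr)
      assume "n \<noteq> m"
      then consider "Suc m \<le> n" | "Suc n \<le> m" by linarith
      then show False
      proof cases
        case 1
        then have "radius n \<le> radius (Suc m)" unfolding radius_def by (intro power_decreasing) auto
        then show False using that r by (simp add: T_def fst_v r_def radius_def)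
      next
        case 2
        then have "radius m \<le> radius (Suc n)" unfolding radius_def by (intro power_decreasing) auto
        then show False using that r by (simp add: T_def fst_v r_def radius_def)
      qed
    qed
    moreover have "vertex m \<in> T" using r by (simp add: T_def fst_v r_def)
    moreover have "(L, L) \<notin> T" using r by (simp add: T_def)
    ultimately show ?thesis unfolding extremes_eq by blast
  qed
  moreover have "vertex m \<in> extremes" unfolding extremes_eq by blast
  ultimately show ?thesis
    unfolding isolated_in_def by blast
qed

lemma interior_RL: "interior (RL X f \<phi>s \<phi>u) \<noteq> {}"
  unfolding RL_eq interior_translation using interior_parabola_hull by simp

lemma entropy_spectrum_corner: "ereal (ln 2) \<le> entropy_spectrum X f \<phi>s \<phi>u (L, L)"
proof -
  have "rv \<phi>s \<phi>u bernoulli_measure = (L, L)"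
    using rv_eq[OF bernoulli_invariant] by (simp add: gap_weight_bernoulli zero_weight(2))
  then show ?thesis
    unfolding entropy_spectrum_def using bernoulli_invariant bernoulli_entropy
    by (intro SUP_upper2[of bernoulli_measure]) auto
qed

text \<open>The vertex is exposed, so a measure over it has full weight there.\<close>

lemma entropy_spectrum_vertex: "entropy_spectrum X f \<phi>s \<phi>u (vertex m) \<le> 0"
  unfolding entropy_spectrum_def
proof (rule SUP_least)
  fix \<mu> assume "\<mu> \<in> {\<mu> \<in> invariants. rv \<phi>s \<phi>u \<mu> = vertex m}"
  then have \<mu>: "\<mu> \<in> invariants" and eq: "rv \<phi>s \<phi>u \<mu> = vertex m" by auto
  have "barycentre (gap_weight \<mu>) = barycentre (unit_weight m)"
    using eq rv_eq[OF \<mu>] by (simp add: vertex_def)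
  then have "gap_weight \<mu> = unit_weight m"
    by (rule barycentre_eq_unit[OF gap_weight_weights[OF \<mu>]])
  then have "gap_weight \<mu> m = 1" by (simp add: unit_weight_def)
  then show "measure_entropy \<mu> f \<le> 0" by (rule full_gap_weight_entropy[OF \<mu>])
qed

text \<open>The vertices, where the entropy vanishes, converge to the corner.\<close>

lemma entropy_spectrum_discontinuous:
  "\<not> continuous (at (L, L) within RL X f \<phi>s \<phi>u) (entropy_spectrum X f \<phi>s \<phi>u)"
proof
  let ?H = "entropy_spectrum X f \<phi>s \<phi>u"
  assume "continuous (at (L, L) within RL X f \<phi>s \<phi>u) ?H"
  moreover have "vertex m \<in> RL X f \<phi>s \<phi>u" for m
    unfolding RL_eq vertex_def parabola_hull_def using unit_weight by blast
  ultimately have lim: "(\<lambda>m. ?H (vertex m)) \<longlonglongrightarrow> ?H (L, L)"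
    using vertex_tendsto by (auto simp: continuous_within_sequentially o_def)
  have "?H (L, L) \<le> 0"
    by (rule tendsto_upperbound[OF lim]) (simp_all add: entropy_spectrum_vertex)
  moreover have "(0::ereal) < ereal (ln 2)" by simp
  ultimately show False using entropy_spectrum_corner by (meson leD order.strict_trans2)
qed

end

text \<open>The heights solve \<open>- ln (1 - h n) = (n + 1) (radius n)\<^sup>2 / 4\<close>, the prescribed increase of the
  logarithmic expansion; similarly for the contraction.\<close>

definition unstable_heights :: "nat \<Rightarrow> real" where
  "unstable_heights n = 1 - exp (- ((real n + 1) * (radius n)\<^sup>2 / 4))"

definition stable_heights :: "nat \<Rightarrow> real" where
  "stable_heights n = 1 - exp (- ((real n + 1) * radius n / 4))"

lemma height_bounds:
  assumes "0 \<le> x" "x \<le> radius n"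
  shows "0 \<le> 1 - exp (- ((real n + 1) * x / 4))" "1 - exp (- ((real n + 1) * x / 4)) \<le> (1/4) * (1/10) ^ n"
proof -
  have n: "real n + 1 \<le> 2 ^ n" by (induction n) auto
  show "0 \<le> 1 - exp (- ((real n + 1) * x / 4))" using assms by simp
  have "1 - exp (- ((real n + 1) * x / 4)) \<le> (real n + 1) * x / 4"
    using exp_ge_add_one_self[of "- ((real n + 1) * x / 4)"] by simp
  also have "\<dots> \<le> 2 ^ n * radius n / 4"
    using assms n by (intro divide_right_mono mult_mono) auto
  also have "\<dots> = (1/4) * (1/10) ^ n"
    using power_mult_distrib[of 2 "1/20::real" n] by (simp add: radius_def)
  finally show "1 - exp (- ((real n + 1) * x / 4)) \<le> (1/4) * (1/10) ^ n" .
qed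

interpretation hs: horseshoe unstable_heights stable_heights
proof (unfold_locales)
  fix n
  have "(radius n)\<^sup>2 \<le> radius n"
    using radius_pos[of n] radius_le_1[of n] by (simp add: power2_eq_square mult_left_le)
  then show "0 \<le> unstable_heights n" "unstable_heights n \<le> (1/4) * (1/10) ^ n"
    unfolding unstable_heights_def by (intro height_bounds; simp)+
  show "0 \<le> stable_heights n" "stable_heights n \<le> (1/4) * (1/10) ^ n"
    unfolding stable_heights_def using radius_pos[of n] by (intro height_bounds; simp)+
qed

interpretation gp: gap_potentials "top_of_set hs.\<Lambda>" hs.horse hs.code hs.dec
  "log_norm plane_atlas plane_metric hs.horse hs.Es" "log_norm plane_atlas plane_metric hs.horse hs.Eu" "ln 5"
proof (unfold_locales)
  fix z k \<omega> a n
  show "hs.code z k < 3" if "z \<in> topspace (top_of_set hs.\<Lambda>)"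
    using hs.code_seqs[of z] that by (simp add: hs.seqs_def)
  show "hs.dec \<omega> \<in> topspace (top_of_set hs.\<Lambda>)" by (simp add: hs.\<Lambda>_def)
  show "hs.code (hs.dec \<omega>) = (\<lambda>k. min (\<omega> k) 2)"
    using hs.code_dec[OF hs.min_seqs[of \<omega>]] by (simp only: hs.dec_min)
  show "hs.dec (hs.code z) = z" if "z \<in> topspace (top_of_set hs.\<Lambda>)" using that by simp
  show "hs.horse (hs.dec \<omega>) = hs.dec (left_shift \<omega>)" by (rule hs.horse_dec)
  show "openin (top_of_set hs.\<Lambda>) {z \<in> topspace (top_of_set hs.\<Lambda>). hs.code z k = a}"
    using hs.openin_code_cylinder by simp
  show "hs.dec \<in> measurable (Pi\<^sub>M UNIV (\<lambda>_. count_space UNIV)) (borel_of (top_of_set hs.\<Lambda>))"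
    by (rule hs.measurable_dec_borel)
  show "continuous_map (top_of_set hs.\<Lambda>) (top_of_set hs.\<Lambda>) hs.horse"
    by (rule hs.continuous_map_horse)
next
  fix z n assume "z \<in> topspace (top_of_set hs.\<Lambda>)"
  then have z: "z \<in> hs.\<Lambda>" by simp
  show "log_norm plane_atlas plane_metric hs.horse hs.Eu z = ln 5 + (real n + 1) * (radius n)\<^sup>2 / 4"
    if "gap n 0 (hs.code z)"
    using hs.expansion_gap[OF z that] by (simp add: hs.log_norm_Eu[OF z] unstable_heights_def ln_div)
  show "log_norm plane_atlas plane_metric hs.horse hs.Eu z = ln 5" if "\<And>n. \<not> gap n 0 (hs.code z)"
    using hs.expansion_no_gap[OF z that] by (simp add: hs.log_norm_Eu[OF z])
  show "- log_norm plane_atlas plane_metric hs.horse hs.Es z = ln 5 + (real n + 1) * radius n / 4"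
    if "gap n (- 1 - int n) (hs.code z)"
  proof -
    have "hs.contraction z = exp (- ((real n + 1) * radius n / 4)) / 5"
      using hs.contraction_gap[OF z that] by (simp only: stable_heights_def) simp
    then show ?thesis unfolding hs.log_norm_Es[OF z] by (simp only: ln_div ln_exp) simp
  qed
  show "- log_norm plane_atlas plane_metric hs.horse hs.Es z = ln 5" if "\<And>n. \<not> gap n (- 1 - int n) (hs.code z)"
    unfolding hs.log_norm_Es[OF z] hs.contraction_no_gap[OF z that] by (simp add: ln_div)
qed

theorem mainTheorem1:
  shows "\<exists>(M :: (real \<times> real) topology) A g f \<Lambda> Es Eu.
    smooth_surface M A \<and> riemannian_metric M A g \<and> Ck_diffeo M A 2 f \<and>
    basic_set M A g f \<Lambda> Es Eu \<and>
    topologically_conjugate (subtopology M \<Lambda>) f (full_shift 3) left_shift \<and>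
    (let \<phi>s = log_norm A g f Es;
         \<phi>u = log_norm A g f Eu;
         R = RL (subtopology M \<Lambda>) f \<phi>s \<phi>u;
         H = entropy_spectrum (subtopology M \<Lambda>) f \<phi>s \<phi>u;
         E = {w. w extreme_point_of R}
     in interior R \<noteq> {} \<and> countable E \<and> infinite E \<and>
        (\<exists>w\<^sub>0\<in>E. \<not> w\<^sub>0 isolated_in E \<and> (\<forall>w\<in>E - {w\<^sub>0}. w isolated_in E) \<and>
                 \<not> continuous (at w\<^sub>0 within R) H))"
proof (intro exI conjI)
  show "smooth_surface euclidean plane_atlas" by (rule smooth_surface_plane)
  show "riemannian_metric euclidean plane_atlas plane_metric" by (rule riemannian_metric_plane)
  show "Ck_diffeo euclidean plane_atlas 2 hs.horse" by (rule hs.Ck_diffeo_horse)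
  show "basic_set euclidean plane_atlas plane_metric hs.horse hs.\<Lambda> hs.Es hs.Eu" by (rule hs.basic_set_\<Lambda>)
  show "topologically_conjugate (top_of_set hs.\<Lambda>) hs.horse (full_shift 3) left_shift"
    by (rule hs.topologically_conjugate_full_shift)
  have "\<exists>w\<^sub>0\<in>gp.extremes. \<not> w\<^sub>0 isolated_in gp.extremes \<and> (\<forall>w\<in>gp.extremes - {w\<^sub>0}. w isolated_in gp.extremes) \<and>
      \<not> continuous (at w\<^sub>0 within RL (top_of_set hs.\<Lambda>) hs.horse (log_norm plane_atlas plane_metric hs.horse hs.Es)
          (log_norm plane_atlas plane_metric hs.horse hs.Eu))
        (entropy_spectrum (top_of_set hs.\<Lambda>) hs.horse (log_norm plane_atlas plane_metric hs.horse hs.Es)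
          (log_norm plane_atlas plane_metric hs.horse hs.Eu))"
  proof (intro bexI conjI ballI)
    show "(ln 5, ln 5) \<in> gp.extremes" using gp.extremes_eq by blast
    show "w isolated_in gp.extremes" if "w \<in> gp.extremes - {(ln 5, ln 5)}" for w
      using that gp.isolated_vertex gp.extremes_eq by blast
  qed (rule gp.not_isolated gp.entropy_spectrum_discontinuous)+
  then show "let \<phi>s = log_norm plane_atlas plane_metric hs.horse hs.Es;
         \<phi>u = log_norm plane_atlas plane_metric hs.horse hs.Eu;
         R = RL (top_of_set hs.\<Lambda>) hs.horse \<phi>s \<phi>u;
         H = entropy_spectrum (top_of_set hs.\<Lambda>) hs.horse \<phi>s \<phi>u;
         E = {w. w extreme_point_of R}
     in interior R \<noteq> {} \<and> countable E \<and> infinite E \<and>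
        (\<exists>w\<^sub>0\<in>E. \<not> w\<^sub>0 isolated_in E \<and> (\<forall>w\<in>E - {w\<^sub>0}. w isolated_in E) \<and>
                 \<not> continuous (at w\<^sub>0 within R) H)"
    unfolding Let_def
    by (intro conjI gp.interior_RL gp.countable_extremes gp.infinite_extremes)
qed

end
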